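(* Let $E\subset\mathfrak{LC}$ have $L^1_{loc}$-bounded $l$-bounds and let $D$ be any dense and countable subset of $\mathbb R^N$. Assume that $(f_n)_{n\ge1}\subset E$ converges to $f$ in $(\mathfrak{LC},\mathcal T_D)$ and $(z_n)_{n\ge1}\subset X$ converges to $z\in X$, as $n\to\infty$. Then the mild solutions $u_n(t):=u(t,f_n,z_n)$ converge uniformly as $n\to\infty$ to the mild solution $u(t):=u(t,f,z)$ on every time-interval $[0,T]\subset I_{f,z}$.
   Context: Setting. $M,N\ge 1$; $U\subset\mathbb R^M$ is a bounded, open, connected set with sufficiently smooth boundary; $|y|=|y_1|+\dots+|y_N|$ on $\mathbb R^N$; $B_j\subset\mathbb R^N$ is the closed ball of radius $j$ centered at $0$; $L^1_{loc}$ is the space of locally integrable functions $\mathbb R\to\mathbb R$; $\mathbb N=\{1,2,\dots\}$. One fixes Neumann, Robin or Dirichlet boundary conditions: for $1\le i\le N$, $\alpha_i(x)y_i+\kappa\,\partial y_i/\partial n=0$ on $\partial U$, with $\kappa=0,\alpha_i\equiv1$ (Dirichlet), $\kappa=1,\alpha_i\equiv 0$ (Neumann), or $\kappa=1$ and $\alpha_i:\partial U\to\mathbb R$ nonnegative and sufficiently regular (Robin). Put $Y=C(\overline U)$, $X=C(\overline U,\mathbb R^N)$ in the Neumann/Robin case, and $Y=C_0(\overline U)$, $X=C_0(\overline U,\mathbb R^N)$ (continuous functions vanishing on $\partial U$) in the Dirichlet case. $\|z\|=\sup_{x\in\overline U}|z(x)|$. Semigroup. $A_i$ is the closure in $Y$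 of $A_i^0z_i=\Delta z_i$ with domain $\{z_i\in C^2(U)\cap C^1(\overline U): \Delta z_i\in C(\overline U),\ \alpha_i z_i+\partial z_i/\partial n=0 \text{ on }\partial U\}$ (Neumann/Robin), resp. $\{z_i\in C^2(U)\cap C_0(\overline U):\Delta z_i\in C_0(\overline U)\}$ (Dirichlet). It is a known fact (the regularity of $\partial U$ and $\alpha_i$ is assumed sufficient for it) that $A_i$ is sectorial and generates a strongly continuous analytic semigroup $(e^{tA_i})_{t\ge0}$ on $Y$, with $e^{tA_i}$ compact for $t>0$ and $\|e^{tA_i}\|\le1$. Then $A=\prod_{i=1}^N A_i$ on $X=Y^N$, $e^{tA}=\prod_i e^{tA_i}$, and $\|e^{tA}\|\le N$ for all $t\ge0$ in the operator norm associated to $\|\cdot\|$. Carathéodory maps. $f:\mathbb R\times\overline U\times\mathbb R^N\to\mathbb R^N$ is in $\mathfrak{SC}$ if it is Borel measurable; for every compact $K\subset\mathbb R^N$ there is a nonnegative $m^K\in L^1_{loc}$ with, for a.e. $t$, $|f(t,x,y)|\le m^K(t)$ for all $x\in\overline U$, $y\in K$; and for a.e. $t$ the map $f(t,\cdot,\cdot)$ is continuous. $f\in\mathfrak{LC}$ if moreover for every compact $K$ there is a nonnegative $l^K\in L^1_{loc}$ (an $l$-bound of $f$ on $K$) such that for a.e. $t$, $|f(t,x,y_1)-f(t,x,y_2)|\le l^K(t)|y_1-y_2|$ for all $x\in\overline U$, $y_1,y_2\in K$. Functions differing on a negligible set are identified. In the Dirichlet case it is a standing assumption that all maps $f$ considered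 satisfy $f(t,x,0)=0$ for all $t\in\mathbb R$, $x\in\partial U$. Set $\tilde f(t,z)(x)=f(t,x,z(x))$ for $z\in C(\overline U,\mathbb R^N)$. $E\subset\mathfrak{LC}$ has $L^1_{loc}$-bounded $l$-bounds if for every $j\in\mathbb N$ there is a set $S^j\subset L^1_{loc}$ of $l$-bounds on $B_j$ of the functions of $E$ (containing one for each $f\in E$) such that $\sup_{l\in S^j}\int_{-r}^r l<\infty$ for every $r>0$. Topology $\mathcal T_D$: the topology on $\mathfrak{SC}$ (restricted to $\mathfrak{LC}$) generated by the seminorms $p_{I,y}(f)=\int_I\|\tilde f(s,\tilde y)\|\,ds=\int_I\sup_{x\in\overline U}|f(s,x,y)|\,ds$, over $y\in D$ and $I=[q_1,q_2]$, $q_1<q_2$ rational ($\tilde y$ is the constant map equal to $y$ on $\overline U$). Mild solutions. For $f\in\mathfrak{LC}$, $z\in X$, a mild solution on $[0,\delta]$ of $u'=Au+\tilde f(t,u)$, $u(0)=z$, is $u\in C([0,\delta],X)$ with $u(t)=e^{tA}z+\int_0^t e^{(t-s)A}\tilde f(s,u(s))\,ds$ for $t\in[0,\delta]$ (Bochner integral); it is unique when it exists. $I_{f,z}$ is the union of all $[0,\delta]$ on which a mild solution exists and $u(\cdot,f,z)$ is the resulting maximal mild solution on $I_{f,z}$. "$u_n\to u$ uniformly on $[0,T]$" means that $u_n$ is defined on $[0,T]$ for all large $n$ and $\sup_{t\in[0,T]}\|u_n(t)-u(t)\|\to0$. *)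

theory Defs
  imports "HOL-Analysis.Analysis"
begin

section \<open>Norms and function spaces\<close>

definition norm1 :: "real^'n \<Rightarrow> real"
  where "norm1 y = (\<Sum>i\<in>UNIV. \<bar>y $ i\<bar>)"

definition sup_norm :: "'a set \<Rightarrow> ('a \<Rightarrow> 'b::real_normed_vector) \<Rightarrow> real"
  where "sup_norm K z = (SUP x\<in>K. norm (z x))"

definition sup_norm1 :: "'a set \<Rightarrow> ('a \<Rightarrow> real^'n) \<Rightarrow> real"
  where "sup_norm1 K z = (SUP x\<in>K. norm1 (z x))"

text \<open>
  The space of continuous functions on the closure of \<open>U\<close>, vanishing on the boundary of
  \<open>U\<close> when \<open>\<kappa> = 0\<close> (Dirichlet case). A function on the closure of \<open>U\<close> is represented by its
  extension by \<open>0\<close> to the whole type, so that equality of representatives is equality in the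
  space and the pointwise operations are those of the space. Values in \<open>real\<close> give \<open>Y\<close>,
  values in \<open>real^'n\<close> give \<open>X\<close>, and values in \<open>complex\<close> give the complexification of \<open>Y\<close>.
\<close>

definition cspace :: "real \<Rightarrow> (real^'m) set \<Rightarrow> (real^'m \<Rightarrow> 'b::real_normed_vector) set"
  where "cspace \<kappa> U = {z. continuous_on (closure U) z \<and> (\<forall>x. x \<notin> closure U \<longrightarrow> z x = 0) \<and>
    (\<kappa> = 0 \<longrightarrow> (\<forall>x\<in>frontier U. z x = 0))}"


section \<open>The domain and the boundary conditions\<close>

text \<open>
  Near a boundary point, \<open>U\<close> is the sublevel set \<open>\<rho> < 0\<close> of a \<open>C\<^sup>1\<close> function \<open>\<rho>\<close> with gradient
  \<open>g\<close> vanishing nowhere; the normalised gradient is then the outward unit normal.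
\<close>

definition C1_defining_function ::
    "(real^'m) set \<Rightarrow> (real^'m) set \<Rightarrow> (real^'m \<Rightarrow> real) \<Rightarrow> (real^'m \<Rightarrow> real^'m) \<Rightarrow> bool"
  where "C1_defining_function U V \<rho> g \<longleftrightarrow>
    open V \<and> (\<forall>x\<in>V. GDERIV \<rho> x :> g x \<and> g x \<noteq> 0) \<and> continuous_on V g \<and>
    U \<inter> V = {x\<in>V. \<rho> x < 0}"

definition C1_boundary :: "(real^'m) set \<Rightarrow> bool"
  where "C1_boundary U \<longleftrightarrow> (\<forall>p\<in>frontier U. \<exists>V \<rho> g. p \<in> V \<and> C1_defining_function U V \<rho> g)"

definition outward_normal :: "(real^'m) set \<Rightarrow> real^'m \<Rightarrow> real^'m"
  where "outward_normal U p =
    (THE n. \<exists>V \<rho> g. p \<in> V \<and> C1_defining_function U V \<rho> g \<and> n = g p /\<^sub>R norm (g p))"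

text \<open>
  The boundary condition is \<open>\<alpha>\<^sub>i y\<^sub>i + \<kappa> \<partial>y\<^sub>i/\<partial>n = 0\<close>; the three alternatives are Dirichlet,
  Neumann and Robin.
\<close>

definition boundary_condition :: "real \<Rightarrow> ('n \<Rightarrow> real^'m \<Rightarrow> real) \<Rightarrow> (real^'m) set \<Rightarrow> bool"
  where "boundary_condition \<kappa> \<alpha> U \<longleftrightarrow>
    (\<kappa> = 0 \<and> (\<forall>i. \<forall>x\<in>frontier U. \<alpha> i x = 1)) \<or>
    (\<kappa> = 1 \<and> (\<forall>i. \<forall>x\<in>frontier U. \<alpha> i x = 0)) \<or>
    (\<kappa> = 1 \<and> (\<forall>i. continuous_on (frontier U) (\<alpha> i) \<and> (\<forall>x\<in>frontier U. 0 \<le> \<alpha> i x)))"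


section \<open>The operators and their semigroups\<close>

text \<open>
  Unbounded operators are represented by their graphs.

  In the graph of the Laplacian below, \<open>g\<close> and \<open>H\<close> are the gradient and the Hessian of \<open>z\<close> on \<open>U\<close>,
  and \<open>w\<close> is the continuous extension of the Laplacian of \<open>z\<close> to the closure of \<open>U\<close>
  (vanishing on the boundary in the Dirichlet case, by membership in \<open>cspace \<kappa> U\<close>). When
  \<open>\<kappa> \<noteq> 0\<close>, \<open>G\<close> is the continuous extension of the gradient to the closure of \<open>U\<close>, whose
  existence expresses that \<open>z\<close> is \<open>C\<^sup>1\<close> up to the boundary.
\<close>

definition laplacian_graph ::
    "real \<Rightarrow> (real^'m \<Rightarrow> real) \<Rightarrow> (real^'m) set \<Rightarrow> ((real^'m \<Rightarrow> real) \<times> (real^'m \<Rightarrow> real)) set"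
  where "laplacian_graph \<kappa> a U = {(z, w). z \<in> cspace \<kappa> U \<and> w \<in> cspace \<kappa> U \<and>
    (\<exists>g (H :: real^'m \<Rightarrow> real^'m^'m).
      (\<forall>x\<in>U. GDERIV z x :> g x \<and> (g has_derivative (\<lambda>h. H x *v h)) (at x)) \<and>
      continuous_on U H \<and>
      (\<forall>x\<in>U. w x = trace (H x)) \<and>
      (\<kappa> \<noteq> 0 \<longrightarrow> (\<exists>G. continuous_on (closure U) G \<and> (\<forall>x\<in>U. G x = g x) \<and>
        (\<forall>x\<in>frontier U. a x * z x + \<kappa> * (G x \<bullet> outward_normal U x) = 0))))}"

definition graph_closure ::
    "real \<Rightarrow> (real^'m) set \<Rightarrow> ((real^'m \<Rightarrow> real) \<times> (real^'m \<Rightarrow> real)) set \<Rightarrow>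
     ((real^'m \<Rightarrow> real) \<times> (real^'m \<Rightarrow> real)) set"
  where "graph_closure \<kappa> U A = {(z, w). z \<in> cspace \<kappa> U \<and> w \<in> cspace \<kappa> U \<and>
    (\<exists>zs ws. (\<forall>k::nat. (zs k, ws k) \<in> A) \<and>
      (\<lambda>k. sup_norm (closure U) (\<lambda>x. zs k x - z x)) \<longlonglongrightarrow> 0 \<and>
      (\<lambda>k. sup_norm (closure U) (\<lambda>x. ws k x - w x)) \<longlonglongrightarrow> 0)}"

definition C0_semigroup ::
    "real \<Rightarrow> (real^'m) set \<Rightarrow> (real \<Rightarrow> (real^'m \<Rightarrow> real) \<Rightarrow> (real^'m \<Rightarrow> real)) \<Rightarrow> bool"
  where "C0_semigroup \<kappa> U S \<longleftrightarrow>
    (\<forall>t\<ge>0. (\<forall>z\<in>cspace \<kappa> U. S t z \<in> cspace \<kappa> U) \<and>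
      (\<forall>z\<in>cspace \<kappa> U. \<forall>w\<in>cspace \<kappa> U. \<forall>a b.
        S t (\<lambda>x. a * z x + b * w x) = (\<lambda>x. a * S t z x + b * S t w x)) \<and>
      (\<exists>C. \<forall>z\<in>cspace \<kappa> U. sup_norm (closure U) (S t z) \<le> C * sup_norm (closure U) z)) \<and>
    (\<forall>z\<in>cspace \<kappa> U. S 0 z = z) \<and>
    (\<forall>s\<ge>0. \<forall>t\<ge>0. \<forall>z\<in>cspace \<kappa> U. S (s + t) z = S s (S t z)) \<and>
    (\<forall>z\<in>cspace \<kappa> U. ((\<lambda>t. sup_norm (closure U) (\<lambda>x. S t z x - z x)) \<longlongrightarrow> 0) (at_right 0))"

definition generator_graph ::
    "real \<Rightarrow> (real^'m) set \<Rightarrow> (real \<Rightarrow> (real^'m \<Rightarrow> real) \<Rightarrow> (real^'m \<Rightarrow> real)) \<Rightarrow>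
     ((real^'m \<Rightarrow> real) \<times> (real^'m \<Rightarrow> real)) set"
  where "generator_graph \<kappa> U S = {(z, w). z \<in> cspace \<kappa> U \<and> w \<in> cspace \<kappa> U \<and>
    ((\<lambda>t. sup_norm (closure U) (\<lambda>x. (S t z x - z x) / t - w x)) \<longlongrightarrow> 0) (at_right 0)}"

text \<open>
  Sectoriality concerns the complexification of \<open>A\<close>, which acts separately on real and imaginary
  parts: some sector of opening angle \<open>\<theta> > \<pi>/2\<close> and vertex \<open>\<omega>\<close> lies in the resolvent set,
  with resolvent bounded by \<open>C / \<bar>\<lambda> - \<omega>\<bar>\<close> there.
\<close>

definition complexified_graph ::
    "((real^'m \<Rightarrow> real) \<times> (real^'m \<Rightarrow> real)) set \<Rightarrow>
     ((real^'m \<Rightarrow> complex) \<times> (real^'m \<Rightarrow> complex)) set"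
  where "complexified_graph A = {(z, w).
    ((\<lambda>x. Re (z x)), (\<lambda>x. Re (w x))) \<in> A \<and> ((\<lambda>x. Im (z x)), (\<lambda>x. Im (w x))) \<in> A}"

definition sectorial ::
    "real \<Rightarrow> (real^'m) set \<Rightarrow> ((real^'m \<Rightarrow> real) \<times> (real^'m \<Rightarrow> real)) set \<Rightarrow> bool"
  where "sectorial \<kappa> U A \<longleftrightarrow> (\<exists>\<omega>::real. \<exists>\<theta>::real. \<exists>C>0. pi / 2 < \<theta> \<and> \<theta> < pi \<and>
    (\<forall>\<mu>::complex. \<mu> \<noteq> of_real \<omega> \<and> \<bar>Arg (\<mu> - of_real \<omega>)\<bar> < \<theta> \<longrightarrow>
      (\<forall>h\<in>cspace \<kappa> U. \<exists>!z. (z, (\<lambda>x. \<mu> * z x - h x)) \<in> complexified_graph A) \<and>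
      (\<forall>h\<in>cspace \<kappa> U. \<forall>z. (z, (\<lambda>x. \<mu> * z x - h x)) \<in> complexified_graph A \<longrightarrow>
        sup_norm (closure U) z \<le> C / cmod (\<mu> - of_real \<omega>) * sup_norm (closure U) h)))"

definition compact_operator ::
    "real \<Rightarrow> (real^'m) set \<Rightarrow> ((real^'m \<Rightarrow> real) \<Rightarrow> (real^'m \<Rightarrow> real)) \<Rightarrow> bool"
  where "compact_operator \<kappa> U L \<longleftrightarrow>
    (\<forall>zs :: nat \<Rightarrow> real^'m \<Rightarrow> real. (\<forall>k. zs k \<in> cspace \<kappa> U \<and> sup_norm (closure U) (zs k) \<le> 1) \<longrightarrow>
      (\<exists>r w. strict_mono r \<and> w \<in> cspace \<kappa> U \<and>
        (\<lambda>k. sup_norm (closure U) (\<lambda>x. L (zs (r k)) x - w x)) \<longlonglongrightarrow> 0))"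

text \<open>
  \<open>S t\<close> is \<open>exp (t A)\<close> for the closure \<open>A\<close> of the Laplacian with the given boundary
  condition: \<open>S\<close> is the strongly continuous semigroup generated by \<open>A\<close>, which is analytic because
  \<open>A\<close> is sectorial. These properties hold when \<open>\<partial>U\<close> and \<open>a\<close> are regular enough; requiring them is
  how "sufficient regularity" is made precise.
\<close>

definition diffusion_semigroup ::
    "real \<Rightarrow> (real^'m \<Rightarrow> real) \<Rightarrow> (real^'m) set \<Rightarrow>
     (real \<Rightarrow> (real^'m \<Rightarrow> real) \<Rightarrow> (real^'m \<Rightarrow> real)) \<Rightarrow> bool"
  where "diffusion_semigroup \<kappa> a U S \<longleftrightarrow>
    sectorial \<kappa> U (graph_closure \<kappa> U (laplacian_graph \<kappa> a U)) \<and>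
    C0_semigroup \<kappa> U S \<and>
    generator_graph \<kappa> U S = graph_closure \<kappa> U (laplacian_graph \<kappa> a U) \<and>
    (\<forall>t>0. compact_operator \<kappa> U (S t)) \<and>
    (\<forall>t\<ge>0. \<forall>z\<in>cspace \<kappa> U. sup_norm (closure U) (S t z) \<le> sup_norm (closure U) z)"

definition product_semigroup ::
    "('n \<Rightarrow> real \<Rightarrow> (real^'m \<Rightarrow> real) \<Rightarrow> (real^'m \<Rightarrow> real)) \<Rightarrow>
     real \<Rightarrow> (real^'m \<Rightarrow> real^'n) \<Rightarrow> (real^'m \<Rightarrow> real^'n)"
  where "product_semigroup S t z = (\<lambda>x. \<chi> i. S i t (\<lambda>x. z x $ i) x)"


section \<open>Caratheodory maps\<close>

text \<open>
  Only the values \<open>f t x y\<close> with \<open>x\<close> in the closure of \<open>U\<close> matter. Maps are not quotiented by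
  almost everywhere equality: every notion below is invariant under it.
\<close>

type_synonym ('m, 'n) cmap = "real \<Rightarrow> real^'m \<Rightarrow> real^'n \<Rightarrow> real^'n"

definition L1_loc :: "(real \<Rightarrow> real) set"
  where "L1_loc = {m. \<forall>a b. set_integrable lebesgue {a..b} m}"

definition is_m_bound ::
    "(real^'m) set \<Rightarrow> ('m::finite, 'n::finite) cmap \<Rightarrow> (real^'n) set \<Rightarrow> (real \<Rightarrow> real) \<Rightarrow> bool"
  where "is_m_bound U f K m \<longleftrightarrow> m \<in> L1_loc \<and> (\<forall>t. 0 \<le> m t) \<and>
    (AE t in lebesgue. \<forall>x\<in>closure U. \<forall>y\<in>K. norm1 (f t x y) \<le> m t)"

definition is_l_bound ::
    "(real^'m) set \<Rightarrow> ('m::finite, 'n::finite) cmap \<Rightarrow> (real^'n) set \<Rightarrow> (real \<Rightarrow> real) \<Rightarrow> bool"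
  where "is_l_bound U f K l \<longleftrightarrow> l \<in> L1_loc \<and> (\<forall>t. 0 \<le> l t) \<and>
    (AE t in lebesgue. \<forall>x\<in>closure U. \<forall>y1\<in>K. \<forall>y2\<in>K.
      norm1 (f t x y1 - f t x y2) \<le> l t * norm1 (y1 - y2))"

definition SC :: "(real^'m) set \<Rightarrow> ('m::finite, 'n::finite) cmap set"
  where "SC U = {f.
    (\<lambda>(t, x, y). f t x y) \<in> borel_measurable (restrict_space borel (UNIV \<times> closure U \<times> UNIV)) \<and>
    (\<forall>K. compact K \<longrightarrow> (\<exists>m. is_m_bound U f K m)) \<and>
    (AE t in lebesgue. continuous_on (closure U \<times> UNIV) (\<lambda>(x, y). f t x y))}"

definition LC :: "(real^'m) set \<Rightarrow> ('m::finite, 'n::finite) cmap set"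
  where "LC U = {f \<in> SC U. \<forall>K. compact K \<longrightarrow> (\<exists>l. is_l_bound U f K l)}"

definition L1_loc_bounded_l_bounds :: "(real^'m) set \<Rightarrow> ('m::finite, 'n::finite) cmap set \<Rightarrow> bool"
  where "L1_loc_bounded_l_bounds U E \<longleftrightarrow>
    (\<forall>j::nat. 1 \<le> j \<longrightarrow> (\<exists>S.
      (\<forall>l\<in>S. \<exists>f\<in>E. is_l_bound U f {y. norm1 y \<le> real j} l) \<and>
      (\<forall>f\<in>E. \<exists>l\<in>S. is_l_bound U f {y. norm1 y \<le> real j} l) \<and>
      (\<forall>r>0. bdd_above ((\<lambda>l. LINT t:{-r..r}|lebesgue. l t) ` S))))"

definition TD_seminorm :: "(real^'m) set \<Rightarrow> real \<Rightarrow> real \<Rightarrow> real^'n \<Rightarrow> ('m::finite, 'n::finite) cmap \<Rightarrow> real"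
  where "TD_seminorm U q1 q2 y f =
    (LINT s:{q1..q2}|lebesgue. sup_norm1 (closure U) (\<lambda>x. f s x y))"

definition TD_topology :: "(real^'m) set \<Rightarrow> (real^'n) set \<Rightarrow> ('m::finite, 'n::finite) cmap topology"
  where "TD_topology U D = topology_generated_by
    {B. \<exists>f\<in>SC U. \<exists>y\<in>D. \<exists>q1\<in>\<rat>. \<exists>q2\<in>\<rat>. \<exists>e>0. q1 < q2 \<and>
      B = {g \<in> SC U. TD_seminorm U q1 q2 y (\<lambda>t x v. g t x v - f t x v) < e}}"


section \<open>Bochner integral and mild solutions\<close>

text \<open>
  The library's Bochner integral is for Banach spaces that form a second countable type; the
  definition is repeated here for functions with values in the carrier \<open>cspace \<kappa> U\<close> (values in
  \<open>real^'n\<close>) with norm \<open>sup_norm1 (closure U)\<close>. Simple functions live on a bounded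
  measurable set \<open>I\<close>. The integrand is strongly measurable, being almost everywhere a limit of simple
  functions.
\<close>

definition simple_on ::
    "real \<Rightarrow> (real^'m) set \<Rightarrow> real set \<Rightarrow> (real \<Rightarrow> real^'m \<Rightarrow> real^'n) \<Rightarrow> bool"
  where "simple_on \<kappa> U I s \<longleftrightarrow> finite (s ` I) \<and> s ` I \<subseteq> cspace \<kappa> U \<and>
    (\<forall>v\<in>s ` I. {\<tau>\<in>I. s \<tau> = v} \<in> sets lebesgue)"

definition simple_integral_on ::
    "real set \<Rightarrow> (real \<Rightarrow> real^'m \<Rightarrow> real^'n) \<Rightarrow> real^'m \<Rightarrow> real^'n"
  where "simple_integral_on I s = (\<lambda>x. \<Sum>v\<in>s ` I. measure lebesgue {\<tau>\<in>I. s \<tau> = v} *\<^sub>R v x)"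

definition has_X_integral ::
    "real \<Rightarrow> (real^'m) set \<Rightarrow> real set \<Rightarrow> (real \<Rightarrow> real^'m \<Rightarrow> real^'n) \<Rightarrow>
     (real^'m \<Rightarrow> real^'n) \<Rightarrow> bool"
  where "has_X_integral \<kappa> U I h J \<longleftrightarrow> J \<in> cspace \<kappa> U \<and>
    (\<exists>s. (\<forall>k::nat. simple_on \<kappa> U I (s k)) \<and>
      (AE \<tau> in lebesgue. \<tau> \<in> I \<longrightarrow> h \<tau> \<in> cspace \<kappa> U \<and>
        (\<lambda>k. sup_norm1 (closure U) (\<lambda>x. h \<tau> x - s k \<tau> x)) \<longlonglongrightarrow> 0) \<and>
      (\<lambda>k. \<integral>\<^sup>+\<tau>\<in>I. ennreal (sup_norm1 (closure U) (\<lambda>x. h \<tau> x - s k \<tau> x)) \<partial>lebesgue)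
        \<longlonglongrightarrow> 0 \<and>
      (\<lambda>k. sup_norm1 (closure U) (\<lambda>x. simple_integral_on I (s k) x - J x)) \<longlonglongrightarrow> 0)"

definition superposition ::
    "(real^'m) set \<Rightarrow> ('m::finite, 'n::finite) cmap \<Rightarrow> real \<Rightarrow> (real^'m \<Rightarrow> real^'n) \<Rightarrow> real^'m \<Rightarrow> real^'n"
  where "superposition U f t z = (\<lambda>x. if x \<in> closure U then f t x (z x) else 0)"

definition mild_solution ::
    "real \<Rightarrow> (real^'m) set \<Rightarrow> ('n \<Rightarrow> real \<Rightarrow> (real^'m \<Rightarrow> real) \<Rightarrow> (real^'m \<Rightarrow> real)) \<Rightarrow>
     ('m::finite, 'n::finite) cmap \<Rightarrow> (real^'m \<Rightarrow> real^'n) \<Rightarrow> real \<Rightarrow> (real \<Rightarrow> real^'m \<Rightarrow> real^'n) \<Rightarrow> bool"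
  where "mild_solution \<kappa> U S f z \<delta> u \<longleftrightarrow>
    (\<forall>t\<in>{0..\<delta>}. u t \<in> cspace \<kappa> U) \<and>
    (\<forall>t\<in>{0..\<delta>}. ((\<lambda>s. sup_norm1 (closure U) (\<lambda>x. u s x - u t x)) \<longlongrightarrow> 0) (at t within {0..\<delta>})) \<and>
    (\<forall>t\<in>{0..\<delta>}. \<exists>J.
      has_X_integral \<kappa> U {0..t}
        (\<lambda>s. product_semigroup S (t - s) (superposition U f s (u s))) J \<and>
      u t = (\<lambda>x. product_semigroup S t z x + J x))"

definition solution_interval ::
    "real \<Rightarrow> (real^'m) set \<Rightarrow> ('n \<Rightarrow> real \<Rightarrow> (real^'m \<Rightarrow> real) \<Rightarrow> (real^'m \<Rightarrow> real)) \<Rightarrow>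
     ('m::finite, 'n::finite) cmap \<Rightarrow> (real^'m \<Rightarrow> real^'n) \<Rightarrow> real set"
  where "solution_interval \<kappa> U S f z = \<Union>{{0..\<delta>} |\<delta>. 0 < \<delta> \<and> (\<exists>u. mild_solution \<kappa> U S f z \<delta> u)}"

text \<open>
  The value at \<open>t\<close> of the maximal mild solution is the common value at \<open>t\<close> of all mild solutions
  defined on some \<open>{0..\<delta>}\<close> containing \<open>t\<close>; it is meaningful for \<open>t \<in> solution_interval \<kappa> U S f z\<close>.
\<close>

definition max_solution ::
    "real \<Rightarrow> (real^'m) set \<Rightarrow> ('n \<Rightarrow> real \<Rightarrow> (real^'m \<Rightarrow> real) \<Rightarrow> (real^'m \<Rightarrow> real)) \<Rightarrow>
     ('m::finite, 'n::finite) cmap \<Rightarrow> (real^'m \<Rightarrow> real^'n) \<Rightarrow> real \<Rightarrow> real^'m \<Rightarrow> real^'n"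
  where "max_solution \<kappa> U S f z t =
    (THE v. \<exists>\<delta> u. 0 < \<delta> \<and> t \<in> {0..\<delta>} \<and> mild_solution \<kappa> U S f z \<delta> u \<and> v = u t)"

end

theory Submission
  imports Defs
begin

text \<open>
  By density of \<open>D\<close>, convergence for \<open>\<T>\<^sub>D\<close> together with
  the \<open>L\<^sup>1\<close>-bounded Lipschitz bounds makes
  \<open>\<integral> sup\<^sub>x \<bar>f\<^sub>n(s, x, u(s)(x)) - f(s, x, u(s)(x))\<bar> ds\<close> tend to \<open>0\<close>: the values of \<open>u\<close> lie in a
  compact set, which has a finite \<open>\<epsilon>\<close>-net in \<open>D\<close>, and the cost of moving to the net is at most
  \<open>\<epsilon> \<integral> (l\<^sub>n + l)\<close>. Let \<open>v\<^sub>n\<close> be the mild solution for \<open>f\<^sub>n\<close> truncated outside a ball somewhat larger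
  than the range of \<open>u\<close>; it exists on all of \<open>{0..T}\<close> by Picard iteration. Gronwall's inequality,
  whose constant depends only on \<open>\<integral> l\<^sub>n\<close>, gives \<open>v\<^sub>n \<longlonglongrightarrow> u\<close> uniformly. So eventually \<open>v\<^sub>n\<close> does not
  meet the truncation and is the solution for \<open>f\<^sub>n\<close> itself, which yields existence on \<open>{0..T}\<close>
  and convergence at once. Both Picard and Gronwall use the weight \<open>exp (2 N \<integral>\<^sub>0\<^sup>t l)\<close>, for which the
  integral operator has norm at most \<open>1/2\<close>.
\<close>

section \<open>The norms and the function spaces\<close>

text \<open>The integral in the mild equation takes values in a set of functions that is not a type.
  The proof therefore trades it for the ordinary integrals of \<open>h \<tau> x\<close> over
  \<open>\<tau>\<close>, one for each \<open>x\<close>; separability of the space of continuous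
  functions lets measurability be checked in the same pointwise way, and norm estimates are made at
  a fixed \<open>x\<close> before passing to the supremum. Splitting the difference of the
  nonlinearities as f(u) - f_n(u) plus f_n(u) - f_n(v_n) puts the first part on the fixed path u, so
  that one finite net serves all n, and lets only the Lipschitz bound of f_n enter the exponential.
  The l_n have bounded integrals but possibly no common integrable majorant, hence a weight that
  depends on n. Truncation replaces a continuation argument: a solution is produced on the whole
  interval at once, and its closeness to u then shows that nothing was truncated. The constant N is
  the bound on the norm of the product semigroup in the supremum of the 1-norm.\<close>

lemma norm1_nonneg [simp]: "0 \<le> norm1 y"
  by (simp add: norm1_def sum_nonneg)

lemma norm1_zero [simp]: "norm1 0 = 0"
  by (simp add: norm1_def)

lemma norm1_minus_commute: "norm1 (x - y) = norm1 (y - x)"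
  by (simp add: norm1_def abs_minus_commute)

lemma norm1_triangle: "norm1 (x + y) \<le> norm1 x + norm1 y"
  by (auto simp: norm1_def sum.distrib [symmetric] intro!: sum_mono)

lemma norm1_diff_triangle: "norm1 (x - z) \<le> norm1 (x - y) + norm1 (y - z)"
  using norm1_triangle [of "x - y" "y - z"] by simp

lemma norm1_le_add_diff: "norm1 x \<le> norm1 y + norm1 (x - y)"
  using norm1_triangle [of y "x - y"] by simp

lemma norm_le_norm1: "norm y \<le> norm1 y"
  unfolding norm1_def by (rule norm_le_l1_cart)

lemma norm1_le_norm: "norm1 (y::real^'n) \<le> real CARD('n) * norm y"
proof -
  have "norm1 y \<le> (\<Sum>i\<in>(UNIV::'n set). norm y)"
    unfolding norm1_def by (intro sum_mono component_le_norm_cart)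
  then show ?thesis by simp
qed

lemma continuous_on_norm1 [continuous_intros]:
  "continuous_on A f \<Longrightarrow> continuous_on A (\<lambda>x. norm1 (f x))"
  unfolding norm1_def by (intro continuous_intros)

lemma borel_measurable_norm1 [measurable]:
  assumes "f \<in> borel_measurable M"
  shows "(\<lambda>x. norm1 (f x)) \<in> borel_measurable M"
  using measurable_compose [OF assms borel_measurable_continuous_onI, of norm1]
    continuous_on_norm1 [OF continuous_on_id] by auto

lemma compact_norm1_ball: "compact {y. norm1 y \<le> r}"
proof (subst compact_eq_bounded_closed, rule conjI)
  show "bounded {y. norm1 y \<le> r}"
    unfolding bounded_iff using norm_le_norm1 order_trans by blast
  show "closed {y. norm1 y \<le> r}"
    by (intro closed_Collect_le continuous_intros)
qed

lemma integrable_norm1: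
  assumes "integrable M h"
  shows "integrable M (\<lambda>x. norm1 (h x))"
  unfolding norm1_def
  by (intro Bochner_Integration.integrable_sum integrable_abs
      integrable_bounded_linear [OF bounded_linear_vec_nth assms])

lemma norm1_integral_le:
  assumes "integrable M h"
  shows "norm1 (integral\<^sup>L M h) \<le> (\<integral>x. norm1 (h x) \<partial>M)"
proof -
  have *: "integrable M (\<lambda>x. h x $ i)" for i
    by (rule integrable_bounded_linear [OF bounded_linear_vec_nth assms])
  have "integral\<^sup>L M h $ i = (\<integral>x. h x $ i \<partial>M)" for i
    by (rule integral_bounded_linear [OF bounded_linear_vec_nth assms, symmetric])
  then have "norm1 (integral\<^sup>L M h) = (\<Sum>i\<in>UNIV. \<bar>\<integral>x. h x $ i \<partial>M\<bar>)"
    by (simp add: norm1_def)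
  also have "\<dots> \<le> (\<Sum>i\<in>UNIV. \<integral>x. \<bar>h x $ i\<bar> \<partial>M)"
    by (intro sum_mono integral_abs_bound)
  also have "\<dots> = (\<integral>x. norm1 (h x) \<partial>M)"
    unfolding norm1_def using * by (intro Bochner_Integration.integral_sum [symmetric]) auto
  finally show ?thesis .
qed

section \<open>Supremum norms and the spaces of continuous functions\<close>

lemma sup_norm1_leI:
  "\<lbrakk>K \<noteq> {}; \<And>x. x \<in> K \<Longrightarrow> norm1 (z x) \<le> c\<rbrakk> \<Longrightarrow> sup_norm1 K z \<le> c"
  unfolding sup_norm1_def by (rule cSUP_least)

lemma norm1_le_sup_norm1:
  assumes "compact K" "continuous_on K z" "x \<in> K"
  shows "norm1 (z x) \<le> sup_norm1 K z"
  unfolding sup_norm1_def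
proof (rule cSUP_upper [OF assms(3)])
  have "compact ((\<lambda>x. norm1 (z x)) ` K)"
    using assms by (intro compact_continuous_image continuous_intros)
  then show "bdd_above ((\<lambda>x. norm1 (z x)) ` K)"
    by (simp add: bounded_imp_bdd_above compact_imp_bounded)
qed

lemma norm_le_sup_norm:
  assumes "compact K" "continuous_on K z" "x \<in> K"
  shows "norm (z x) \<le> sup_norm K z"
  unfolding sup_norm_def
proof (rule cSUP_upper [OF assms(3)])
  have "compact ((\<lambda>x. norm (z x)) ` K)"
    using assms by (intro compact_continuous_image continuous_intros)
  then show "bdd_above ((\<lambda>x. norm (z x)) ` K)"
    by (simp add: bounded_imp_bdd_above compact_imp_bounded)
qed

lemma cspace_add: "\<lbrakk>z \<in> cspace \<kappa> U; w \<in> cspace \<kappa> U\<rbrakk> \<Longrightarrow> (\<lambda>x. z x + w x) \<in> cspace \<kappa> U"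
  and cspace_diff: "\<lbrakk>z \<in> cspace \<kappa> U; w \<in> cspace \<kappa> U\<rbrakk> \<Longrightarrow> (\<lambda>x. z x - w x) \<in> cspace \<kappa> U"
  and cspace_scale: "z \<in> cspace \<kappa> U \<Longrightarrow> (\<lambda>x. c *\<^sub>R z x) \<in> cspace \<kappa> U"
  and cspace_zero: "(\<lambda>x. 0) \<in> cspace \<kappa> U"
  and cspace_continuous: "z \<in> cspace \<kappa> U \<Longrightarrow> continuous_on (closure U) z"
  and cspace_outside: "\<lbrakk>z \<in> cspace \<kappa> U; x \<notin> closure U\<rbrakk> \<Longrightarrow> z x = 0"
  by (auto simp: cspace_def intro!: continuous_intros)

lemma cspace_sum:
  "(\<And>v. v \<in> V \<Longrightarrow> g v \<in> cspace \<kappa> U) \<Longrightarrow> (\<lambda>x. \<Sum>v\<in>V. g v x) \<in> cspace \<kappa> U"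
  by (induction V rule: infinite_finite_induct) (simp_all add: cspace_zero cspace_add)

lemma cspace_nth: "z \<in> cspace \<kappa> U \<Longrightarrow> (\<lambda>x. z x $ i) \<in> cspace \<kappa> U"
  by (auto simp: cspace_def intro!: continuous_intros)

lemma cspace_vec_lambda:
  "(\<And>i. (\<lambda>x. z i x) \<in> cspace \<kappa> U) \<Longrightarrow> (\<lambda>x. \<chi> i. z i x) \<in> cspace \<kappa> U"
  by (auto simp: cspace_def vec_eq_iff intro!: continuous_on_vec_lambda)

text \<open>Completeness: the vanishing conditions are pointwise and survive a uniform limit along
  with continuity. This places both the pointwise integral and the limit of the Picard iterates in
  \<open>cspace \<kappa> U\<close>.\<close>

lemma cspace_uniform_limit:
  fixes z :: "real^'m \<Rightarrow> real^'n"
  assumes out: "\<And>x. x \<notin> closure U \<Longrightarrow> z x = 0"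
    and appr: "\<And>e. 0 < e \<Longrightarrow> \<exists>w\<in>cspace \<kappa> U. \<forall>x\<in>closure U. norm1 (w x - z x) \<le> e"
  shows "z \<in> cspace \<kappa> U"
proof -
  have "\<forall>k. \<exists>w. w \<in> cspace \<kappa> U \<and> (\<forall>x\<in>closure U. norm1 (w x - z x) \<le> inverse (real (Suc k)))"
    using appr [of "inverse (real (Suc _))"] by (simp add: Bex_def del: of_nat_Suc)
  then obtain w where "\<forall>k. w k \<in> cspace \<kappa> U \<and>
      (\<forall>x\<in>closure U. norm1 (w k x - z x) \<le> inverse (real (Suc k)))"
    by (rule choice [THEN exE])
  then have w: "\<And>k. w k \<in> cspace \<kappa> U"
    "\<And>k x. x \<in> closure U \<Longrightarrow> norm1 (w k x - z x) \<le> inverse (real (Suc k))"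
    by auto
  have *: "norm (w k x - z x) \<le> inverse (real (Suc k))" if "x \<in> closure U" for k x
    by (rule order_trans [OF norm_le_norm1 w(2) [OF that]])
  have ul: "uniform_limit (closure U) w z sequentially"
  proof (rule uniform_limitI)
    fix e :: real assume "0 < e"
    have "\<forall>\<^sub>F k in sequentially. inverse (real (Suc k)) < e"
      using LIMSEQ_inverse_real_of_nat \<open>0 < e\<close> by (rule order_tendstoD)
    then show "\<forall>\<^sub>F k in sequentially. \<forall>x\<in>closure U. dist (w k x) (z x) < e"
      by eventually_elim (auto simp: dist_norm simp del: of_nat_Suc intro: order.strict_trans1 [OF *])
  qed
  have "z x = 0" if "x \<in> frontier U" "\<kappa> = 0" for x
  proof -
    have x: "x \<in> closure U" using that(1) by (simp add: frontier_def)
    have "(\<lambda>k. w k x) \<longlonglongrightarrow> z x" using tendsto_uniform_limitI [OF ul x] .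
    moreover have "w k x = 0" for k using w(1) that by (auto simp: cspace_def)
    ultimately show ?thesis by (simp add: LIMSEQ_const_iff)
  qed
  moreover have "continuous_on (closure U) z"
    by (rule uniform_limit_theorem [OF _ ul])
       (use w(1) cspace_continuous in \<open>auto intro!: always_eventually\<close>)
  ultimately show ?thesis using out by (auto simp: cspace_def)
qed

text \<open>Clipping coordinate by coordinate is nonexpansive for \<open>norm1\<close>, so a
  truncated map keeps the Lipschitz bound of the original. The price is that the range fills a cube,
  whose \<open>norm1\<close> radius is \<open>CARD('n) * R\<close> instead of
  \<open>R\<close>.\<close>

definition trunc :: "real \<Rightarrow> real^'n \<Rightarrow> real^'n"
  where "trunc R y = (\<chi> i. max (- R) (min R (y $ i)))"

lemma norm1_trunc_diff_le: "norm1 (trunc R y - trunc R y') \<le> norm1 (y - y')"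
  unfolding norm1_def trunc_def by (intro sum_mono) auto

lemma norm1_trunc_le:
  assumes "0 \<le> R"
  shows "norm1 (trunc R (y :: real^'n)) \<le> real CARD('n) * R"
proof -
  have "norm1 (trunc R y) \<le> (\<Sum>i\<in>(UNIV::'n set). R)"
    unfolding norm1_def trunc_def using assms by (intro sum_mono) auto
  then show ?thesis by simp
qed

lemma trunc_eq:
  assumes "norm1 y \<le> R"
  shows "trunc R y = y"
proof -
  have "\<bar>y $ i\<bar> \<le> R" for i
    using component_le_norm_cart [of y i] norm_le_norm1 [of y] assms by linarith
  then have "- R \<le> y $ i" "y $ i \<le> R" for i
    by (simp_all add: abs_le_iff minus_le_iff)
  then show ?thesis by (simp add: trunc_def vec_eq_iff)
qed

lemma continuous_on_trunc [continuous_intros]: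
  "continuous_on A f \<Longrightarrow> continuous_on A (\<lambda>x. trunc R (f x))"
  unfolding trunc_def by (intro continuous_on_vec_lambda continuous_intros)

lemma SC_m_bound: "\<lbrakk>f \<in> SC U; compact K\<rbrakk> \<Longrightarrow> \<exists>m. is_m_bound U f K m"
  by (simp add: SC_def)

lemma LC_l_bound: "\<lbrakk>f \<in> LC U; compact K\<rbrakk> \<Longrightarrow> \<exists>l. is_l_bound U f K l"
  by (simp add: LC_def)

text \<open>Truncated arguments stay in one compact ball, so the m-bound of \<open>f\<close> there
  works for every \<open>y\<close>. It gives all Picard iterates the same integrable
  majorant.\<close>

lemma trunc_in_SC:
  fixes f :: "('m::finite, 'n::finite) cmap"
  assumes f: "f \<in> SC U" and R: "0 \<le> R"
  shows "(\<lambda>t x y. f t x (trunc R y)) \<in> SC U"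
    and "\<exists>m. is_m_bound U (\<lambda>t x y. f t x (trunc R y)) UNIV m"
proof -
  let ?V = "UNIV \<times> closure U \<times> UNIV :: (real \<times> (real^'m) \<times> (real^'n)) set"
  obtain m where m: "is_m_bound U f {y. norm1 y \<le> real CARD('n) * R} m"
    using SC_m_bound [OF f compact_norm1_ball] by blast
  then have m': "is_m_bound U (\<lambda>t x y. f t x (trunc R y)) K m" for K
    unfolding is_m_bound_def using norm1_trunc_le [OF R] by (auto elim!: eventually_mono)
  then show "\<exists>m. is_m_bound U (\<lambda>t x y. f t x (trunc R y)) UNIV m" by blast
  have "continuous_on UNIV (\<lambda>p :: real \<times> (real^'m) \<times> (real^'n). (fst p, fst (snd p), trunc R (snd (snd p))))"
    by (intro continuous_intros)
  then have "(\<lambda>p. (fst p, fst (snd p), trunc R (snd (snd p)))) \<in> borel_measurable (restrict_space borel ?V)"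
    by (intro measurable_restrict_space1 borel_measurable_continuous_onI)
  then have 1: "(\<lambda>p. (fst p, fst (snd p), trunc R (snd (snd p)))) \<in>
      measurable (restrict_space borel ?V) (restrict_space borel ?V)"
    by (intro measurable_restrict_space2) (auto simp: space_restrict_space)
  have 2: "(\<lambda>(t, x, y). f t x y) \<in> borel_measurable (restrict_space borel ?V)"
    using f by (simp add: SC_def)
  have "(\<lambda>(t, x, y). f t x (trunc R y)) \<in> borel_measurable (restrict_space borel ?V)"
    using measurable_compose [OF 1 2] by (simp add: case_prod_beta)
  moreover have "AE t in lebesgue. continuous_on (closure U \<times> UNIV) (\<lambda>(x, y). f t x (trunc R y))"
  proof -
    have "AE t in lebesgue. continuous_on (closure U \<times> UNIV) (\<lambda>(x, y). f t x y)"
      using f by (simp add: SC_def)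
    then show ?thesis
    proof eventually_elim
      case (elim t)
      have "continuous_on (closure U \<times> UNIV) (\<lambda>p. (fst p, trunc R (snd p)))"
        by (intro continuous_intros)
      then have "continuous_on (closure U \<times> UNIV) (\<lambda>p. case (fst p, trunc R (snd p)) of (x, y) \<Rightarrow> f t x y)"
        by (rule continuous_on_compose2 [OF elim]) auto
      then show ?case by (simp add: case_prod_beta)
    qed
  qed
  ultimately show "(\<lambda>t x y. f t x (trunc R y)) \<in> SC U"
    using m' by (auto simp: SC_def)
qed

text \<open>The very same \<open>l\<close> has to serve, since only the integrals of the given
  l-bounds are controlled uniformly over \<open>E\<close>; nonexpansiveness of \<open>trunc\<close>
  provides this.\<close>

lemma is_l_bound_trunc:
  assumes l: "is_l_bound U f {y. norm1 y \<le> r} l" and R: "0 \<le> R" "real CARD('n) * R \<le> r"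
  shows "is_l_bound U (\<lambda>t x y. f t x (trunc R (y :: real^'n))) UNIV l"
proof -
  have l0: "\<And>t. 0 \<le> l t" using l by (simp add: is_l_bound_def)
  have ball: "norm1 (trunc R y) \<le> r" for y :: "real^'n"
    using norm1_trunc_le [OF R(1), of y] R(2) by linarith
  have "AE t in lebesgue. \<forall>x\<in>closure U. \<forall>y1\<in>{y. norm1 y \<le> r}. \<forall>y2\<in>{y. norm1 y \<le> r}.
      norm1 (f t x y1 - f t x y2) \<le> l t * norm1 (y1 - y2)"
    using l by (simp add: is_l_bound_def)
  then have "AE t in lebesgue. \<forall>x\<in>closure U. \<forall>y1\<in>UNIV. \<forall>y2\<in>UNIV.
      norm1 (f t x (trunc R y1) - f t x (trunc R y2)) \<le> l t * norm1 (y1 - y2)"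
  proof eventually_elim
    case (elim t)
    show ?case
    proof (intro ballI)
      fix x y1 y2 assume "x \<in> closure U"
      then have "norm1 (f t x (trunc R y1) - f t x (trunc R y2)) \<le> l t * norm1 (trunc R y1 - trunc R y2)"
        using elim ball by blast
      also have "\<dots> \<le> l t * norm1 (y1 - y2)"
        by (intro mult_left_mono norm1_trunc_diff_le l0)
      finally show "norm1 (f t x (trunc R y1) - f t x (trunc R y2)) \<le> l t * norm1 (y1 - y2)" .
    qed
  qed
  then show ?thesis using l by (simp add: is_l_bound_def)
qed

text \<open>The net must lie in \<open>D\<close>, where the seminorms are known, and in a fixed
  ball, where l-bounds are available. Points within \<open>e \<le> 1\<close> of the ball of radius
  \<open>R\<close> have norm at most \<open>R + 1\<close>.\<close>

lemma dense_finite_net: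
  fixes D :: "(real^'n) set"
  assumes D: "closure D = UNIV" and e: "0 < e" "e \<le> 1"
  obtains Y where "finite Y" "Y \<subseteq> D" "\<And>y. y \<in> Y \<Longrightarrow> norm1 y \<le> R + 1"
    "\<And>y. norm1 y \<le> R \<Longrightarrow> \<exists>y'\<in>Y. norm1 (y - y') < e"
proof -
  let ?D = "{d \<in> D. norm1 d \<le> R + 1}"
  let ?B = "\<lambda>d. {y. norm1 (y - d) < e}"
  have op: "open (?B d)" for d
    by (intro open_Collect_less continuous_intros)
  have cover: "{y. norm1 y \<le> R} \<subseteq> (\<Union>d\<in>?D. ?B d)"
  proof
    fix y :: "real^'n" assume y: "y \<in> {y. norm1 y \<le> R}"
    have "y \<in> closure D" by (simp add: D)
    \<comment> \<open>Density refers to the Euclidean metric, and \<open>norm1\<close> exceeds that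
      norm by a factor of at most \<open>CARD('n)\<close>.\<close>
    moreover have "0 < e / real CARD('n)" using e by simp
    ultimately obtain d where d: "d \<in> D" "dist d y < e / real CARD('n)"
      unfolding closure_approachable by blast
    have "norm1 (y - d) \<le> real CARD('n) * norm (y - d)"
      by (rule norm1_le_norm)
    also have "\<dots> < e"
      using d(2) by (simp add: dist_norm norm_minus_commute field_simps)
    finally have "norm1 (y - d) < e" .
    moreover have "norm1 d \<le> R + 1"
      using norm1_le_add_diff [of d y] norm1_minus_commute [of d y] calculation e y by simp
    ultimately show "y \<in> (\<Union>d\<in>?D. ?B d)" using d(1) by blast
  qed
  obtain Y where "Y \<subseteq> ?D" "finite Y" "{y. norm1 y \<le> R} \<subseteq> (\<Union>d\<in>Y. ?B d)"
    by (rule compactE_image [OF compact_norm1_ball op cover])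
  then show thesis by (intro that [of Y]) auto
qed

section \<open>Integration preliminaries\<close>

lemma set_integrable_lebesgue_on:
  fixes f :: "real \<Rightarrow> 'b::{banach, second_countable_topology}"
  assumes "A \<in> sets lebesgue"
  shows "set_integrable lebesgue A f \<longleftrightarrow> integrable (lebesgue_on A) f"
    and "(LINT x:A|lebesgue. f x) = integral\<^sup>L (lebesgue_on A) f"
  using assms
  by (simp_all add: set_integrable_def set_lebesgue_integral_def integrable_restrict_space
      integral_restrict_space)

lemma borel_measurable_lebesgue_on_AE:
  fixes f :: "'a::euclidean_space \<Rightarrow> 'b::euclidean_space"
  assumes I: "I \<in> sets lebesgue" and f: "f \<in> borel_measurable (lebesgue_on I)"
    and ae: "AE x in lebesgue. x \<in> I \<longrightarrow> f x = g x"
  shows "g \<in> borel_measurable (lebesgue_on I)"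
proof -
  have "(\<lambda>x. if x \<in> I then f x else 0) \<in> borel_measurable lebesgue"
    using I f by (simp add: borel_measurable_if)
  then have "(\<lambda>x. if x \<in> I then g x else 0) \<in> borel_measurable lebesgue"
    by (rule borel_measurable_AE) (use ae in \<open>auto elim: eventually_mono\<close>)
  then show ?thesis using I by (simp add: borel_measurable_if)
qed

lemma AE_lebesgue_on_iff:
  "I \<in> sets lebesgue \<Longrightarrow> (AE x in lebesgue_on I. P x) \<longleftrightarrow> (AE x in lebesgue. x \<in> I \<longrightarrow> P x)"
  by (simp add: AE_restrict_space_iff)

text \<open>Cut the range of \<open>L\<close>, not the interval, into \<open>n + 1\<close> equal
  parts: each step of \<open>g\<close> costs order \<open>1 / (n + 1)\<^sup>2\<close>, the total
  order \<open>1 / (n + 1)\<close>. Continuity of \<open>L\<close> supplies the cut points.\<close>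

lemma quadratic_modulus_imp_equal:
  fixes g L :: "real \<Rightarrow> real"
  assumes "a \<le> b" and L: "continuous_on {a..b} L"
    and g: "\<And>s t. s \<in> {a..b} \<Longrightarrow> t \<in> {a..b} \<Longrightarrow> \<bar>g t - g s\<bar> \<le> K * (L t - L s)\<^sup>2"
  shows "g b = g a"
proof -
  let ?D = "L b - L a"
  have "\<bar>g b - g a\<bar> \<le> K * ?D\<^sup>2 / real (Suc n)" for n
  proof -
    let ?y = "\<lambda>i. L a + real i / real (Suc n) * ?D"
    have "\<exists>t. t \<in> {a..b} \<and> L t = ?y i" if "i \<le> Suc n" for i
    proof -
      have "is_interval (L ` {a..b})"
        using connected_continuous_image [OF L] by (simp add: is_interval_connected_1)
      moreover have "?y i \<in> closed_segment (L a) (L b)"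
        unfolding in_segment
      proof (intro exI conjI)
        show "?y i = (1 - real i / real (Suc n)) *\<^sub>R L a + (real i / real (Suc n)) *\<^sub>R L b"
          unfolding real_scaleR_def by algebra
      qed (use that in \<open>auto simp: divide_le_eq_1\<close>)
      ultimately have "?y i \<in> L ` {a..b}"
        using \<open>a \<le> b\<close> by (metis (no_types, lifting) atLeastAtMost_iff closed_segment_subset imageI
            is_interval_convex order_refl subsetD)
      then show ?thesis by (auto simp: image_iff intro: sym)
    qed
    then obtain t where t: "\<And>i. i \<le> Suc n \<Longrightarrow> t i \<in> {a..b} \<and> L (t i) = ?y i"
      by metis
    have step: "\<bar>g (t (Suc i)) - g (t i)\<bar> \<le> K * (?D / real (Suc n))\<^sup>2" if "i < Suc n" for i
    proof -
      have "L (t (Suc i)) - L (t i) = ?D / real (Suc n)"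
        using t [of i] t [of "Suc i"] that by (simp add: field_simps)
      then show ?thesis using g [of "t i" "t (Suc i)"] t [of i] t [of "Suc i"] that by simp
    qed
    \<comment> \<open>The points \<open>t 0\<close> and \<open>t (Suc n)\<close> may differ from
      \<open>a\<close> and \<open>b\<close>; having the same value of \<open>L\<close>, they have
      the same value of \<open>g\<close> by assumption.\<close>
    have "g b = g (t (Suc n))"
      using g [of "t (Suc n)" b] t [of "Suc n"] \<open>a \<le> b\<close> by simp
    moreover have "g a = g (t 0)"
      using g [of "t 0" a] t [of 0] \<open>a \<le> b\<close> by simp
    ultimately have "\<bar>g b - g a\<bar> = \<bar>\<Sum>i<Suc n. g (t (Suc i)) - g (t i)\<bar>"
      using sum_lessThan_telescope [of "\<lambda>i. g (t i)" "Suc n"] by presburger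
    also have "\<dots> \<le> (\<Sum>i<Suc n. \<bar>g (t (Suc i)) - g (t i)\<bar>)"
      by (rule sum_abs)
    also have "\<dots> \<le> (\<Sum>i<Suc n. K * (?D / real (Suc n))\<^sup>2)"
      by (intro sum_mono step) simp
    also have "\<dots> = real (Suc n) * (K * (?D / real (Suc n))\<^sup>2)"
      by simp
    also have "\<dots> = K * ?D\<^sup>2 / real (Suc n)"
      by (simp add: power2_eq_square field_simps del: of_nat_Suc)
    finally show ?thesis .
  qed
  moreover have "(\<lambda>n. K * ?D\<^sup>2 / real (Suc n)) \<longlonglongrightarrow> 0"
    using tendsto_mult_right_zero [OF LIMSEQ_inverse_real_of_nat] by (simp only: divide_inverse)
  ultimately have "\<bar>g b - g a\<bar> \<le> 0"
    by (intro LIMSEQ_le_const) auto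
  then show ?thesis by simp
qed

text \<open>
  For merely integrable \<open>l\<close> the chain rule for \<open>exp (c L)\<close> is not available; the error of the
  identity over \<open>{a..b}\<close> is quadratic in \<open>L b - L a\<close> instead.
\<close>

lemma integral_exp_weight:
  fixes l :: "real \<Rightarrow> real"
  assumes l: "integrable (lebesgue_on {0..T}) l" and nonneg: "\<And>t. 0 \<le> l t"
    and "0 < c" "0 \<le> t" "t \<le> T"
  defines "L \<equiv> \<lambda>t. integral\<^sup>L (lebesgue_on {0..t}) l"
  shows "integrable (lebesgue_on {0..t}) (\<lambda>s. l s * exp (c * L s))"
    and "integral\<^sup>L (lebesgue_on {0..t}) (\<lambda>s. l s * exp (c * L s)) = (exp (c * L t) - 1) / c"
proof -
  have l': "integrable (lebesgue_on {a..b}) l" if "0 \<le> a" "b \<le> T" for a b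
    by (rule integrable_subinterval [OF l]) (use that in auto)
  have L_eq: "L s = integral {0..s} l" if "s \<in> {0..T}" for s
    unfolding L_def using that by (intro lebesgue_integral_eq_integral l') auto
  have contL: "continuous_on {0..T} L"
    unfolding L_def by (rule indefinite_integral_continuous_real [OF l])
  have int_l: "l integrable_on {0..T}"
    using l by (intro integrable_on_lebesgue_on) auto
  have diffL: "L b - L a = integral {a..b} l" if "0 \<le> a" "a \<le> b" "b \<le> T" for a b
  proof -
    have "integral {0..a} l + integral {a..b} l = integral {0..b} l"
      using that by (intro Henstock_Kurzweil_Integration.integral_combine integrable_subinterval_real [OF int_l]) auto
    then show ?thesis using that by (simp add: L_eq)
  qed
  have monoL: "L a \<le> L b" if "0 \<le> a" "a \<le> b" "b \<le> T" for a b
  proof -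
    have "0 \<le> integral {a..b} l"
      using nonneg by (intro Henstock_Kurzweil_Integration.integral_nonneg integrable_subinterval_real [OF int_l]) (use that in auto)
    then show ?thesis using diffL [OF that] by simp
  qed
  let ?E = "\<lambda>s. exp (c * L s)"
  have contE: "continuous_on {0..T} ?E"
    by (intro continuous_intros contL)
  have "(\<lambda>s. ?E s * l s) absolutely_integrable_on {0..T}"
  proof (rule absolutely_integrable_bounded_measurable_product_real)
    show "?E \<in> borel_measurable (lebesgue_on {0..T})"
      by (intro continuous_imp_measurable_on_sets_lebesgue contE) auto
    show "bounded (?E ` {0..T})"
      by (intro compact_imp_bounded compact_continuous_image contE) auto
    show "l absolutely_integrable_on {0..T}"
      using l by (simp add: set_integrable_lebesgue_on)
  qed auto
  then have int0: "integrable (lebesgue_on {0..T}) (\<lambda>s. l s * ?E s)"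
    by (simp add: set_integrable_lebesgue_on mult.commute)
  then have int_lE: "integrable (lebesgue_on {a..b}) (\<lambda>s. l s * ?E s)" if "0 \<le> a" "b \<le> T" for a b
    by (rule integrable_subinterval) (use that in auto)
  show "integrable (lebesgue_on {0..t}) (\<lambda>s. l s * ?E s)"
    using assms by (intro int_lE) auto
  have hk_lE: "(\<lambda>s. l s * ?E s) integrable_on {a..b}" if "0 \<le> a" "b \<le> T" for a b
    using int_lE [OF that] by (intro integrable_on_lebesgue_on) auto
  define \<phi> where "\<phi> \<equiv> \<lambda>s. integral {0..s} (\<lambda>s. l s * ?E s) - (?E s - 1) / c"
  let ?K = "c * ?E T"
  \<comment> \<open>Monotonicity of \<open>?E\<close> puts the integral over \<open>{a..b}\<close>
    between \<open>(L b - L a) * ?E a\<close> and \<open>(L b - L a) * ?E b\<close>; the two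
    exponential inequalities put \<open>(?E b - ?E a) / c\<close> between the same numbers. The gap
    between these is quadratic in \<open>L b - L a\<close>.\<close>
  have bound: "\<bar>\<phi> b - \<phi> a\<bar> \<le> ?K * (L b - L a)\<^sup>2" if ab: "0 \<le> a" "a \<le> b" "b \<le> t" for a b
  proof -
    have bT: "b \<le> T" using ab assms by simp
    have comb: "integral {0..a} (\<lambda>s. l s * ?E s) + integral {a..b} (\<lambda>s. l s * ?E s) = integral {0..b} (\<lambda>s. l s * ?E s)"
      using ab bT by (intro Henstock_Kurzweil_Integration.integral_combine hk_lE) auto
    have lab: "l integrable_on {a..b}"
      using ab bT by (intro integrable_subinterval_real [OF int_l]) auto
    have Es: "?E a \<le> ?E s" "?E s \<le> ?E b" if "s \<in> {a..b}" for s
      using monoL [of a s] monoL [of s b] that ab bT \<open>0 < c\<close> by auto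
    have lo: "(L b - L a) * ?E a \<le> integral {a..b} (\<lambda>s. l s * ?E s)"
    proof -
      have "integral {a..b} (\<lambda>s. l s * ?E a) \<le> integral {a..b} (\<lambda>s. l s * ?E s)"
        by (intro integral_le hk_lE mult_left_mono Es nonneg)
           (use ab bT lab in \<open>auto intro: integrable_on_mult_left\<close>)
      then show ?thesis using diffL [of a b] ab bT by simp
    qed
    have hi: "integral {a..b} (\<lambda>s. l s * ?E s) \<le> (L b - L a) * ?E b"
    proof -
      have "integral {a..b} (\<lambda>s. l s * ?E s) \<le> integral {a..b} (\<lambda>s. l s * ?E b)"
        by (intro integral_le hk_lE mult_left_mono Es nonneg)
           (use ab bT lab in \<open>auto intro: integrable_on_mult_left\<close>)
      then show ?thesis using diffL [of a b] ab bT by simp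
    qed
    have D: "0 \<le> L b - L a" using monoL [of a b] ab bT by simp
    have e1: "c * (L b - L a) \<le> exp (c * (L b - L a)) - 1"
      using exp_ge_add_one_self [of "c * (L b - L a)"] by linarith
    have e2: "1 - exp (- (c * (L b - L a))) \<le> c * (L b - L a)"
      using exp_ge_add_one_self [of "- (c * (L b - L a))"] by linarith
    have Eb: "?E b = ?E a * exp (c * (L b - L a))" and Ea: "?E a = ?E b * exp (- (c * (L b - L a)))"
      by (simp_all add: exp_add [symmetric] algebra_simps)
    have "?E a * (c * (L b - L a)) \<le> ?E a * (exp (c * (L b - L a)) - 1)"
      by (intro mult_left_mono e1) simp
    then have lo': "(L b - L a) * ?E a \<le> (?E b - ?E a) / c"
      using \<open>0 < c\<close> by (simp add: Eb field_simps)
    have "?E b * (1 - exp (- (c * (L b - L a)))) \<le> ?E b * (c * (L b - L a))"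
      by (intro mult_left_mono e2) simp
    then have *: "?E b - ?E a \<le> ?E b * (c * (L b - L a))"
      using Ea by (simp add: right_diff_distrib)
    then have hi': "(?E b - ?E a) / c \<le> (L b - L a) * ?E b"
      using \<open>0 < c\<close> by (simp add: field_simps)
    have "\<phi> b - \<phi> a = integral {a..b} (\<lambda>s. l s * ?E s) - (?E b - ?E a) / c"
      unfolding \<phi>_def comb [symmetric] by (simp add: diff_divide_distrib)
    then have "\<bar>\<phi> b - \<phi> a\<bar> \<le> (L b - L a) * (?E b - ?E a)"
      using lo hi lo' hi' by (simp add: abs_le_iff algebra_simps)
    also have "\<dots> \<le> (L b - L a) * (?E T * (c * (L b - L a)))"
    proof (intro mult_left_mono D)
      have "?E b * (c * (L b - L a)) \<le> ?E T * (c * (L b - L a))"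
        using monoL [of b T] ab bT D \<open>0 < c\<close> by (intro mult_right_mono) auto
      then show "?E b - ?E a \<le> ?E T * (c * (L b - L a))" using * by linarith
    qed
    finally show ?thesis by (simp add: power2_eq_square algebra_simps)
  qed
  have "\<phi> t = \<phi> 0"
  proof (rule quadratic_modulus_imp_equal [where g = \<phi> and a = 0 and b = t and K = ?K and L = L])
    show "continuous_on {0..t} L"
      by (rule continuous_on_subset [OF contL]) (use assms in auto)
    fix a b assume ab: "a \<in> {0..t}" "b \<in> {0..t}"
    show "\<bar>\<phi> b - \<phi> a\<bar> \<le> ?K * (L b - L a)\<^sup>2"
    proof (cases "a \<le> b")
      case True
      then show ?thesis using ab bound by auto
    next
      case False
      then show ?thesis
        using ab bound [of b a] by (simp add: abs_minus_commute power2_commute)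
    qed
  qed (use assms in auto)
  moreover have "L 0 = 0" using L_eq [of 0] assms(4,5) by simp
  ultimately have "integral {0..t} (\<lambda>s. l s * ?E s) = (?E t - 1) / c"
    by (simp add: \<phi>_def)
  then show "integral\<^sup>L (lebesgue_on {0..t}) (\<lambda>s. l s * ?E s) = (?E t - 1) / c"
    using lebesgue_integral_eq_integral [OF int_lE [of 0 t]] assms(5) by simp
qed

text \<open>Only countably many triples (precision, mesh, list of values on a finite net) exist.
  Choosing one member of \<open>F\<close> for each triple that some member realises keeps the dense
  set inside \<open>F\<close>, whatever side conditions, such as vanishing on the boundary, define
  \<open>F\<close>.\<close>

lemma continuous_functions_separable:
  fixes F :: "('a::metric_space \<Rightarrow> 'b::{metric_space, second_countable_topology}) set"
  assumes K: "compact K" and F: "\<And>z. z \<in> F \<Longrightarrow> continuous_on K z"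
  obtains C where "countable C" "C \<subseteq> F"
    "\<And>z e. \<lbrakk>z \<in> F; 0 < e\<rbrakk> \<Longrightarrow> \<exists>w\<in>C. \<forall>x\<in>K. dist (w x) (z x) < e"
proof -
  obtain Q :: "'b set" where Q: "countable Q" "\<And>V. open V \<Longrightarrow> V \<noteq> {} \<Longrightarrow> \<exists>q\<in>Q. q \<in> V"
    by (rule countable_dense_setE) blast
  have "\<exists>ps. K \<subseteq> (\<Union>p\<in>set ps. ball p (inverse (real (Suc k)))) \<and> set ps \<subseteq> K" for k
  proof -
    obtain P where "finite P" "P \<subseteq> K" "K \<subseteq> (\<Union>p\<in>P. ball p (inverse (real (Suc k))))"
    proof (rule compactE_image [OF K, of K "\<lambda>p. ball p (inverse (real (Suc k)))"])
      show "K \<subseteq> (\<Union>p\<in>K. ball p (inverse (real (Suc k))))"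
        by (auto simp del: of_nat_Suc intro!: bexI)
    qed auto
    moreover obtain ps where "set ps = P" using finite_list [OF \<open>finite P\<close>] by blast
    ultimately show ?thesis by auto
  qed
  then obtain net where net: "\<And>k. K \<subseteq> (\<Union>p\<in>set (net k). ball p (inverse (real (Suc k))))"
    "\<And>k. set (net k) \<subseteq> K" by metis
  \<comment> \<open>Functions sharing an index are uniformly close: their values nearly agree at the
    net points, and their oscillation around these points is controlled.\<close>
  define P where "P \<equiv> \<lambda>(j::nat, k::nat, qs) w. w \<in> F \<and> length qs = length (net k) \<and>
    (\<forall>i<length qs. dist (w (net k ! i)) (qs ! i) < inverse (real (Suc j))) \<and>
    (\<forall>x\<in>K. \<forall>y\<in>K. dist x y < inverse (real (Suc k)) \<longrightarrow> dist (w x) (w y) < inverse (real (Suc j)))"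
  define J where "J = {\<iota> \<in> UNIV \<times> UNIV \<times> lists Q. \<exists>w. P \<iota> w}"
  define C where "C = (\<lambda>\<iota>. SOME w. P \<iota> w) ` J"
  have P_some: "P \<iota> (SOME w. P \<iota> w)" if "\<iota> \<in> J" for \<iota>
    using that someI_ex [of "P \<iota>"] unfolding J_def by blast
  have "countable (UNIV \<times> UNIV \<times> lists Q :: (nat \<times> nat \<times> 'b list) set)"
    by (intro countable_SIGMA countable_lists Q) auto
  then have "countable C"
    unfolding C_def by (intro countable_image) (auto simp: J_def intro: countable_subset [rotated])
  moreover have "C \<subseteq> F"
    using P_some by (force simp: C_def P_def split: prod.splits)
  moreover have "\<exists>w\<in>C. \<forall>x\<in>K. dist (w x) (z x) < e" if z: "z \<in> F" and "0 < e" for z e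
  proof -
    \<comment> \<open>Four distances below \<open>?j\<close> link \<open>w x\<close> to
      \<open>z x\<close>: along \<open>w\<close> to a net point, to the value listed there, to
      \<open>z\<close> at that point, and back along \<open>z\<close>.\<close>
    obtain j where j: "inverse (real (Suc j)) < e / 4"
      using reals_Archimedean [of "e / 4"] \<open>0 < e\<close> by auto
    let ?j = "inverse (real (Suc j))"
    have "uniformly_continuous_on K z"
      using F [OF z] K by (rule compact_uniformly_continuous)
    then obtain d where d: "0 < d" "\<And>x y. \<lbrakk>x \<in> K; y \<in> K; dist y x < d\<rbrakk> \<Longrightarrow> dist (z y) (z x) < ?j"
      unfolding uniformly_continuous_on_def by (metis inverse_positive_iff_positive of_nat_0_less_iff zero_less_Suc)
    obtain k where k: "inverse (real (Suc k)) < d"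
      using reals_Archimedean [OF d(1)] by auto
    have "\<exists>q\<in>Q. dist (z p) q < ?j" for p
      using Q(2) [of "ball (z p) ?j"] by (auto simp del: of_nat_Suc)
    then obtain q where q: "\<And>p. q p \<in> Q" "\<And>p. dist (z p) (q p) < ?j" by metis
    let ?qs = "map q (net k)"
    have Pz: "P (j, k, ?qs) z"
      using z q(2) d(2) k by (auto simp: P_def simp del: of_nat_Suc)
    then have J: "(j, k, ?qs) \<in> J" using q(1) by (auto simp: J_def)
    define w where "w = (SOME w. P (j, k, ?qs) w)"
    have Pw: "P (j, k, ?qs) w" using P_some [OF J] by (simp add: w_def)
    have "dist (w x) (z x) < e" if x: "x \<in> K" for x
    proof -
      obtain p where p: "p \<in> set (net k)" "dist x p < inverse (real (Suc k))"
        using net(1) [of k] x by (auto simp: dist_commute)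
      then obtain i where i: "i < length (net k)" "net k ! i = p" by (auto simp: in_set_conv_nth)
      have "p \<in> K" using p net(2) by blast
      have "dist (w x) (w p) < ?j" using Pw x \<open>p \<in> K\<close> p by (simp add: P_def del: of_nat_Suc)
      moreover have "dist (w p) (q p) < ?j" using Pw i by (auto simp: P_def simp del: of_nat_Suc)
      moreover have "dist (z p) (q p) < ?j" by (rule q)
      moreover have "dist (z x) (z p) < ?j" using Pz x \<open>p \<in> K\<close> p by (simp add: P_def del: of_nat_Suc)
      moreover have "dist (w x) (z x) \<le> dist (w x) (w p) + dist (w p) (q p) + dist (z p) (q p) + dist (z x) (z p)"
        by metric
      ultimately show ?thesis using j by linarith
    qed
    moreover have "w \<in> C" using J by (auto simp: C_def w_def)
    ultimately show ?thesis by blast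
  qed
  ultimately show thesis by (rule that)
qed

section \<open>The semigroup on the product space\<close>

locale diffusion_problem =
  fixes \<kappa> :: real and U :: "(real^'m) set"
    and S :: "'n::finite \<Rightarrow> real \<Rightarrow> (real^'m \<Rightarrow> real) \<Rightarrow> (real^'m \<Rightarrow> real)"
  assumes nonempty: "U \<noteq> {}" and bounded: "bounded U"
    and semigroup: "C0_semigroup \<kappa> U (S i)"
    and contraction: "\<lbrakk>0 \<le> t; y \<in> cspace \<kappa> U\<rbrakk> \<Longrightarrow>
      sup_norm (closure U) (S i t y) \<le> sup_norm (closure U) y"
begin

abbreviation X :: "(real^'m \<Rightarrow> real^'n) set"
  where "X \<equiv> cspace \<kappa> U"

abbreviation nrm :: "(real^'m \<Rightarrow> real^'n) \<Rightarrow> real"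
  where "nrm \<equiv> sup_norm1 (closure U)"

abbreviation PS :: "real \<Rightarrow> (real^'m \<Rightarrow> real^'n) \<Rightarrow> real^'m \<Rightarrow> real^'n"
  where "PS \<equiv> product_semigroup S"

lemma closure_nonempty: "closure U \<noteq> {}"
  using nonempty by simp

lemma compact_closure_U: "compact (closure U)"
  using bounded by simp

lemma norm1_le_nrm: "\<lbrakk>z \<in> X; x \<in> closure U\<rbrakk> \<Longrightarrow> norm1 (z x) \<le> nrm z"
  by (intro norm1_le_sup_norm1 compact_closure_U cspace_continuous)

lemma norm1_le_nrm': "z \<in> X \<Longrightarrow> norm1 (z x) \<le> nrm z"
proof (cases "x \<in> closure U")
  case False
  assume z: "z \<in> X"
  obtain x0 where "x0 \<in> closure U" using closure_nonempty by (meson ex_in_conv)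
  then have "0 \<le> nrm z" using norm1_le_nrm [OF z] norm1_nonneg order_trans by blast
  then show ?thesis using cspace_outside [OF z False] by simp
qed (rule norm1_le_nrm)

lemma nrm_leI: "(\<And>x. x \<in> closure U \<Longrightarrow> norm1 (z x) \<le> c) \<Longrightarrow> nrm z \<le> c"
  by (intro sup_norm1_leI closure_nonempty)

lemma nrm_nonneg: "z \<in> X \<Longrightarrow> 0 \<le> nrm z"
  using norm1_le_nrm' norm1_nonneg order_trans by blast

lemma nrm_zero [simp]: "nrm (\<lambda>x. 0) = 0"
  using nrm_leI [of "\<lambda>x. 0" 0] nrm_nonneg [OF cspace_zero] by simp

lemma nrm_cong: "(\<And>x. x \<in> closure U \<Longrightarrow> norm1 (z x) = norm1 (w x)) \<Longrightarrow> nrm z = nrm w"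
  by (simp add: sup_norm1_def)

lemma nrm_minus_commute: "nrm (\<lambda>x. z x - w x) = nrm (\<lambda>x. w x - z x)"
  by (intro nrm_cong norm1_minus_commute)

lemma nrm_triangle:
  assumes "y \<in> X" "z \<in> X" "w \<in> X"
  shows "nrm (\<lambda>x. y x - w x) \<le> nrm (\<lambda>x. y x - z x) + nrm (\<lambda>x. z x - w x)"
proof (rule nrm_leI)
  fix x assume "x \<in> closure U"
  then have "norm1 (y x - z x) \<le> nrm (\<lambda>x. y x - z x)" "norm1 (z x - w x) \<le> nrm (\<lambda>x. z x - w x)"
    using assms by (auto intro!: norm1_le_nrm [of "\<lambda>x. _ x - _ x"] cspace_diff)
  then show "norm1 (y x - w x) \<le> nrm (\<lambda>x. y x - z x) + nrm (\<lambda>x. z x - w x)"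
    using norm1_diff_triangle [of "y x" "w x" "z x"] by linarith
qed

lemma nrm_add_le:
  assumes "y \<in> X" "z \<in> X"
  shows "nrm (\<lambda>x. y x + z x) \<le> nrm y + nrm z"
proof (rule nrm_leI)
  fix x
  show "norm1 (y x + z x) \<le> nrm y + nrm z"
    using norm1_triangle [of "y x" "z x"] norm1_le_nrm' [OF assms(1), of x] norm1_le_nrm' [OF assms(2), of x]
    by linarith
qed

lemma sup_norm_nth_le_nrm:
  assumes "z \<in> X"
  shows "sup_norm (closure U) (\<lambda>x. z x $ i) \<le> nrm z"
  unfolding sup_norm_def
proof (rule cSUP_least [OF closure_nonempty])
  fix x assume "x \<in> closure U"
  have "norm (z x $ i) \<le> norm1 (z x)"
    using component_le_norm_cart [of "z x" i] norm_le_norm1 [of "z x"] by simp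
  then show "norm (z x $ i) \<le> nrm z"
    using norm1_le_nrm' [OF assms, of x] by linarith
qed

lemma nrm_le_sum_sup_norm:
  assumes "\<And>i. (\<lambda>x. z x $ i) \<in> cspace \<kappa> U"
  shows "nrm z \<le> (\<Sum>i\<in>UNIV. sup_norm (closure U) (\<lambda>x. z x $ i))"
proof (rule nrm_leI)
  fix x assume x: "x \<in> closure U"
  have "\<bar>z x $ i\<bar> \<le> sup_norm (closure U) (\<lambda>x. z x $ i)" for i
    using norm_le_sup_norm [OF compact_closure_U cspace_continuous [OF assms [of i]] x] by simp
  then show "norm1 (z x) \<le> (\<Sum>i\<in>UNIV. sup_norm (closure U) (\<lambda>x. z x $ i))"
    unfolding norm1_def by (intro sum_mono)
qed

section \<open>The semigroup acting componentwise\<close>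

lemma S_in: "\<lbrakk>0 \<le> t; y \<in> cspace \<kappa> U\<rbrakk> \<Longrightarrow> S i t y \<in> cspace \<kappa> U"
  and S_add: "\<lbrakk>0 \<le> s; 0 \<le> t; y \<in> cspace \<kappa> U\<rbrakk> \<Longrightarrow> S i (s + t) y = S i s (S i t y)"
  and S_continuous: "y \<in> cspace \<kappa> U \<Longrightarrow>
    ((\<lambda>t. sup_norm (closure U) (\<lambda>x. S i t y x - y x)) \<longlongrightarrow> 0) (at_right 0)"
  using semigroup [of i] by (auto simp: C0_semigroup_def)

lemma S_diff:
  assumes "0 \<le> t" "y \<in> cspace \<kappa> U" "w \<in> cspace \<kappa> U"
  shows "S i t (\<lambda>x. y x - w x) = (\<lambda>x. S i t y x - S i t w x)"
proof -
  have "\<forall>a b. S i t (\<lambda>x. a * y x + b * w x) = (\<lambda>x. a * S i t y x + b * S i t w x)"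
    using semigroup [of i] assms by (auto simp: C0_semigroup_def)
  from this [rule_format, of 1 "-1"] show ?thesis by simp
qed

lemma PS_in: "\<lbrakk>0 \<le> t; z \<in> X\<rbrakk> \<Longrightarrow> PS t z \<in> X"
  unfolding product_semigroup_def by (intro cspace_vec_lambda S_in cspace_nth)

lemma PS_add: "\<lbrakk>0 \<le> s; 0 \<le> t; z \<in> X\<rbrakk> \<Longrightarrow> PS (s + t) z = PS s (PS t z)"
  unfolding product_semigroup_def by (simp add: S_add cspace_nth)

lemma PS_diff:
  assumes "0 \<le> t" "z \<in> X" "w \<in> X"
  shows "PS t (\<lambda>x. z x - w x) = (\<lambda>x. PS t z x - PS t w x)"
  unfolding product_semigroup_def using assms by (auto simp: S_diff cspace_nth vec_eq_iff)

text \<open>Each component of \<open>PS t z\<close> is bounded by the full norm of \<open>z\<close>,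
  and \<open>norm1\<close> adds up \<open>CARD('n)\<close> of them. This is the source of the factor
  \<open>CARD('n)\<close> in the later estimates.\<close>

lemma PS_bound:
  assumes "0 \<le> t" "z \<in> X"
  shows "nrm (PS t z) \<le> real CARD('n) * nrm z"
proof -
  have "nrm (PS t z) \<le> (\<Sum>i\<in>UNIV. sup_norm (closure U) (\<lambda>x. PS t z x $ i))"
    by (intro nrm_le_sum_sup_norm cspace_nth PS_in assms)
  also have "\<dots> \<le> (\<Sum>i\<in>(UNIV::'n set). nrm z)"
  proof (rule sum_mono)
    fix i
    have "sup_norm (closure U) (\<lambda>x. PS t z x $ i) = sup_norm (closure U) (S i t (\<lambda>x. z x $ i))"
      by (simp add: product_semigroup_def)
    also have "\<dots> \<le> sup_norm (closure U) (\<lambda>x. z x $ i)"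
      by (intro contraction cspace_nth assms)
    also have "\<dots> \<le> nrm z" by (intro sup_norm_nth_le_nrm assms)
    finally show "sup_norm (closure U) (\<lambda>x. PS t z x $ i) \<le> nrm z" .
  qed
  finally show ?thesis by simp
qed

lemma PS_diff_bound:
  assumes "0 \<le> t" "z \<in> X" "w \<in> X"
  shows "nrm (\<lambda>x. PS t z x - PS t w x) \<le> real CARD('n) * nrm (\<lambda>x. z x - w x)"
  using PS_bound [OF assms(1) cspace_diff [OF assms(2,3)]] PS_diff [OF assms] by simp

lemma PS_continuous_0:
  assumes "z \<in> X"
  shows "((\<lambda>t. nrm (\<lambda>x. PS t z x - z x)) \<longlongrightarrow> 0) (at_right 0)"
proof (rule tendsto_sandwich [OF _ _ tendsto_const])
  have *: "((\<lambda>t. \<Sum>i\<in>UNIV. sup_norm (closure U) (\<lambda>x. S i t (\<lambda>x. z x $ i) x - z x $ i)) \<longlongrightarrow>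
    (\<Sum>i\<in>(UNIV::'n set). 0)) (at_right 0)"
    by (intro tendsto_sum S_continuous cspace_nth assms)
  then show "((\<lambda>t. \<Sum>i\<in>UNIV. sup_norm (closure U) (\<lambda>x. S i t (\<lambda>x. z x $ i) x - z x $ i)) \<longlongrightarrow> 0)
    (at_right 0)" by simp
  have pos: "\<forall>\<^sub>F t in at_right 0. (0::real) < t" by (simp add: eventually_at_right_less)
  show "\<forall>\<^sub>F t in at_right 0. 0 \<le> nrm (\<lambda>x. PS t z x - z x)"
    using pos by eventually_elim (intro nrm_nonneg cspace_diff PS_in assms, simp)
  show "\<forall>\<^sub>F t in at_right 0. nrm (\<lambda>x. PS t z x - z x) \<le>
    (\<Sum>i\<in>UNIV. sup_norm (closure U) (\<lambda>x. S i t (\<lambda>x. z x $ i) x - z x $ i))"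
    using pos
  proof eventually_elim
    case (elim t)
    have "nrm (\<lambda>x. PS t z x - z x) \<le> (\<Sum>i\<in>UNIV. sup_norm (closure U) (\<lambda>x. (PS t z x - z x) $ i))"
      using elim by (intro nrm_le_sum_sup_norm cspace_nth cspace_diff PS_in assms) simp
    then show ?case by (simp add: product_semigroup_def)
  qed
qed

lemma PS_shift_bound:
  assumes "0 \<le> s" "s \<le> t" "z \<in> X"
  shows "nrm (\<lambda>x. PS t z x - PS s z x) \<le> real CARD('n) * nrm (\<lambda>x. PS (t - s) z x - z x)"
  using PS_diff_bound [of s "PS (t - s) z" z] PS_add [of s "t - s" z] PS_in [of "t - s" z] assms
  by simp

text \<open>Continuity from both sides follows from right continuity at \<open>0\<close>: the
  smaller of the two times is factored out as a bounded operator, leaving only the increment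
  \<open>\<bar>s - t\<bar>\<close>.\<close>

lemma PS_continuous:
  assumes "z \<in> X" "0 \<le> t"
  shows "((\<lambda>s. nrm (\<lambda>x. PS s z x - PS t z x)) \<longlongrightarrow> 0) (at t within {0..})"
proof (rule tendsto_sandwich [OF _ _ tendsto_const])
  have ev: "\<forall>\<^sub>F s in at t within {0..}. 0 \<le> s \<and> s \<noteq> t"
    by (auto simp: eventually_at_filter)
  show "\<forall>\<^sub>F s in at t within {0..}. 0 \<le> nrm (\<lambda>x. PS s z x - PS t z x)"
    using ev by eventually_elim (intro nrm_nonneg cspace_diff PS_in assms, simp)
  show "\<forall>\<^sub>F s in at t within {0..}. nrm (\<lambda>x. PS s z x - PS t z x) \<le>
      real CARD('n) * nrm (\<lambda>x. PS \<bar>s - t\<bar> z x - z x)"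
    using ev
  proof eventually_elim
    case (elim s)
    show ?case
    proof (cases "s \<le> t")
      case True
      then show ?thesis
        using PS_shift_bound [of s t z] elim assms nrm_minus_commute [of "PS s z" "PS t z"] by simp
    next
      case False
      then show ?thesis using PS_shift_bound [of t s z] elim assms by simp
    qed
  qed
  have "((\<lambda>s. \<bar>s - t\<bar>) \<longlongrightarrow> \<bar>t - t\<bar>) (at t within {0..})"
    by (intro tendsto_intros)
  then have "filterlim (\<lambda>s. \<bar>s - t\<bar>) (at_right 0) (at t within {0..})"
    unfolding filterlim_at using ev by (auto elim!: eventually_mono)
  from tendsto_mult_right_zero [OF filterlim_compose [OF PS_continuous_0 [OF assms(1)] this]]
  show "((\<lambda>s. real CARD('n) * nrm (\<lambda>x. PS \<bar>s - t\<bar> z x - z x)) \<longlongrightarrow> 0) (at t within {0..})" .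
qed

section \<open>The integral in the product space\<close>

text \<open>Measurability is asked only at each \<open>x\<close>, where Caratheodory maps give it
  directly. By separability of the space this already yields approximation by simple functions in
  norm.\<close>

definition measurable_on_X :: "real set \<Rightarrow> (real \<Rightarrow> real^'m \<Rightarrow> real^'n) \<Rightarrow> bool"
  where "measurable_on_X I h \<longleftrightarrow>
    (\<forall>\<tau>\<in>I. h \<tau> \<in> X) \<and> (\<forall>x\<in>closure U. (\<lambda>\<tau>. h \<tau> x) \<in> borel_measurable (lebesgue_on I))"

lemma measurable_on_X_I:
  "\<lbrakk>\<And>\<tau>. \<tau> \<in> I \<Longrightarrow> h \<tau> \<in> X;
    \<And>x. x \<in> closure U \<Longrightarrow> (\<lambda>\<tau>. h \<tau> x) \<in> borel_measurable (lebesgue_on I)\<rbrakk> \<Longrightarrow> measurable_on_X I h"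
  by (simp add: measurable_on_X_def)

lemma measurable_on_X_in: "\<lbrakk>measurable_on_X I h; \<tau> \<in> I\<rbrakk> \<Longrightarrow> h \<tau> \<in> X"
  by (simp add: measurable_on_X_def)

lemma measurable_on_X_at:
  assumes "measurable_on_X I h"
  shows "(\<lambda>\<tau>. h \<tau> x) \<in> borel_measurable (lebesgue_on I)"
proof (cases "x \<in> closure U")
  case False
  then have "(\<lambda>\<tau>. h \<tau> x) \<in> borel_measurable (lebesgue_on I) \<longleftrightarrow>
      (\<lambda>\<tau>. 0 :: real^'n) \<in> borel_measurable (lebesgue_on I)"
    using cspace_outside [OF measurable_on_X_in [OF assms]] by (intro measurable_cong) auto
  then show ?thesis by simp
qed (use assms in \<open>simp add: measurable_on_X_def\<close>)

lemma measurable_on_X_const: "v \<in> X \<Longrightarrow> measurable_on_X I (\<lambda>\<tau>. v)"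
  by (simp add: measurable_on_X_def)

lemma measurable_on_X_diff:
  "\<lbrakk>measurable_on_X I h; measurable_on_X I h'\<rbrakk> \<Longrightarrow> measurable_on_X I (\<lambda>\<tau> x. h \<tau> x - h' \<tau> x)"
  by (auto simp: measurable_on_X_def intro: cspace_diff borel_measurable_diff)

text \<open>By continuity the supremum may be taken over a countable dense set. Continuity is
  assumed rather than membership in \<open>X\<close>, because differences of Caratheodory maps at a
  constant \<open>y\<close>, which need not vanish on the boundary, are treated too.\<close>

lemma borel_measurable_nrm_gen:
  assumes cont: "\<And>\<tau>. \<tau> \<in> space M \<Longrightarrow> continuous_on (closure U) (h \<tau>)"
    and meas: "\<And>x. x \<in> closure U \<Longrightarrow> (\<lambda>\<tau>. h \<tau> x) \<in> borel_measurable M"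
  shows "(\<lambda>\<tau>. nrm (h \<tau>)) \<in> borel_measurable M"
proof -
  obtain Q where Q: "countable Q" "Q \<subseteq> U" "U \<subseteq> closure Q" by (rule separable)
  then have clQ: "closure Q = closure U"
    by (intro subset_antisym closure_mono closure_minimal) auto
  have "Q \<noteq> {}" using nonempty Q(3) by auto
  have QU: "x \<in> closure U" if "x \<in> Q" for x
    using Q(2) that closure_subset by blast
  have bdd: "bdd_above ((\<lambda>x. norm1 (h \<tau> x)) ` Q)" if "\<tau> \<in> space M" for \<tau>
    by (rule bdd_aboveI2 [where M = "nrm (h \<tau>)"])
       (rule norm1_le_sup_norm1 [OF compact_closure_U cont [OF that] QU])
  have "(\<lambda>\<tau>. SUP x\<in>Q. norm1 (h \<tau> x)) \<in> borel_measurable M"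
    by (rule borel_measurable_cSUP [OF Q(1) _ bdd]) (rule borel_measurable_norm1 [OF meas [OF QU]])
  moreover have "nrm (h \<tau>) = (SUP x\<in>Q. norm1 (h \<tau> x))" if \<tau>: "\<tau> \<in> space M" for \<tau>
  proof (rule antisym)
    have "continuous_on (closure Q) (\<lambda>x. norm1 (h \<tau> x))"
      unfolding clQ by (rule continuous_on_norm1 [OF cont [OF \<tau>]])
    then show "nrm (h \<tau>) \<le> (SUP x\<in>Q. norm1 (h \<tau> x))"
      using clQ by (intro nrm_leI) (rule continuous_le_on_closure, assumption, simp, rule cSUP_upper [OF _ bdd [OF \<tau>]])
    show "(SUP x\<in>Q. norm1 (h \<tau> x)) \<le> nrm (h \<tau>)"
      by (intro cSUP_least norm1_le_sup_norm1 [OF compact_closure_U cont [OF \<tau>]] QU \<open>Q \<noteq> {}\<close>)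
  qed
  ultimately show ?thesis
    by (simp cong: measurable_cong)
qed

lemma borel_measurable_nrm:
  assumes "measurable_on_X I h"
  shows "(\<lambda>\<tau>. nrm (h \<tau>)) \<in> borel_measurable (lebesgue_on I)"
proof (rule borel_measurable_nrm_gen)
  show "continuous_on (closure U) (h \<tau>)" if "\<tau> \<in> space (lebesgue_on I)" for \<tau>
    using that by (intro cspace_continuous [of _ \<kappa>] measurable_on_X_in [OF assms]) simp
qed (rule measurable_on_X_at [OF assms])

section \<open>Measurable approximation from a dense sequence\<close>

lemma dense_sequence_exists:
  "\<exists>d :: nat \<Rightarrow> real^'m \<Rightarrow> real^'n. d 0 = (\<lambda>x. 0) \<and> range d \<subseteq> X \<and>
    (\<forall>z\<in>X. \<forall>e>0. \<exists>k. nrm (\<lambda>x. z x - d k x) < e)"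
proof -
  obtain Q :: "(real^'m \<Rightarrow> real^'n) set" where Q: "countable Q" "Q \<subseteq> X"
    and dense: "\<And>z e. \<lbrakk>z \<in> X; 0 < e\<rbrakk> \<Longrightarrow> \<exists>w\<in>Q. \<forall>x\<in>closure U. dist (w x) (z x) < e"
  proof (rule continuous_functions_separable [OF compact_closure_U, of X])
    show "continuous_on (closure U) z" if "z \<in> X" for z
      using that by (rule cspace_continuous)
  qed (rule that)
  have "Q \<noteq> {}" using dense [OF cspace_zero, of 1] by auto
  define d where "d = (\<lambda>k. case k of 0 \<Rightarrow> (\<lambda>x. 0) | Suc j \<Rightarrow> from_nat_into Q j)"
  have "range d \<subseteq> X"
    using subsetD [OF Q(2) from_nat_into [OF \<open>Q \<noteq> {}\<close>]] cspace_zero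
    by (auto simp: d_def split: nat.splits)
  moreover have "\<exists>k. nrm (\<lambda>x. z x - d k x) < e" if z: "z \<in> X" and e: "0 < e" for z e
  proof -
    let ?N = "real CARD('n)"
    obtain w where w: "w \<in> Q" "\<And>x. x \<in> closure U \<Longrightarrow> dist (w x) (z x) < e / (2 * ?N)"
      using dense [OF z, of "e / (2 * ?N)"] e by auto
    have "nrm (\<lambda>x. z x - w x) \<le> e / 2"
    proof (rule nrm_leI)
      fix x assume "x \<in> closure U"
      then have "norm (z x - w x) \<le> e / (2 * ?N)"
        using w(2) [of x] by (simp add: dist_norm norm_minus_commute)
      then have "?N * norm (z x - w x) \<le> ?N * (e / (2 * ?N))"
        by (intro mult_left_mono) auto
      then show "norm1 (z x - w x) \<le> e / 2"
        using norm1_le_norm [of "z x - w x"] by simp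
    qed
    moreover obtain j where "from_nat_into Q j = w"
      using from_nat_into_surj [OF Q(1) w(1)] by blast
    then have "w = d (Suc j)" by (simp add: d_def)
    ultimately show ?thesis using e by (intro exI [of _ "Suc j"]) simp
  qed
  ultimately show ?thesis by (intro exI [of _ d]) (auto simp: d_def)
qed

definition dense_seq :: "nat \<Rightarrow> real^'m \<Rightarrow> real^'n"
  where "dense_seq = (SOME d. d 0 = (\<lambda>x. 0) \<and> range d \<subseteq> X \<and>
    (\<forall>z\<in>X. \<forall>e>0. \<exists>k. nrm (\<lambda>x. z x - d k x) < e))"

lemma dense_seq_0: "dense_seq 0 = (\<lambda>x. 0)"
  and dense_seq_in: "dense_seq k \<in> X"
  and dense_seq_dense: "\<lbrakk>z \<in> X; 0 < e\<rbrakk> \<Longrightarrow> \<exists>k. nrm (\<lambda>x. z x - dense_seq k x) < e"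
  using someI_ex [OF dense_sequence_exists] unfolding dense_seq_def [symmetric] by auto

text \<open>
  Since \<open>dense_seq\<close> starts with \<open>0\<close>, the approximation error never exceeds the norm of \<open>z\<close>; this
  is what dominated convergence needs.
\<close>

definition approx_index :: "nat \<Rightarrow> (real^'m \<Rightarrow> real^'n) \<Rightarrow> nat"
  where "approx_index k z = (LEAST j. j \<le> k \<and>
    (\<forall>i\<le>k. nrm (\<lambda>x. z x - dense_seq j x) \<le> nrm (\<lambda>x. z x - dense_seq i x)))"

abbreviation approx :: "nat \<Rightarrow> (real^'m \<Rightarrow> real^'n) \<Rightarrow> real^'m \<Rightarrow> real^'n"
  where "approx k z \<equiv> dense_seq (approx_index k z)"

lemma approx_index_le: "approx_index k z \<le> k"
  and approx_best: "i \<le> k \<Longrightarrow> nrm (\<lambda>x. z x - approx k z x) \<le> nrm (\<lambda>x. z x - dense_seq i x)"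
proof -
  let ?P = "\<lambda>j. j \<le> k \<and>
    (\<forall>i\<le>k. nrm (\<lambda>x. z x - dense_seq j x) \<le> nrm (\<lambda>x. z x - dense_seq i x))"
  obtain j where "j \<in> {..k}"
      "\<And>i. i \<in> {..k} \<Longrightarrow> nrm (\<lambda>x. z x - dense_seq j x) \<le> nrm (\<lambda>x. z x - dense_seq i x)"
    using ex_is_arg_min_if_finite [of "{..k}" "\<lambda>j. nrm (\<lambda>x. z x - dense_seq j x)"]
    by (auto simp: is_arg_min_linorder)
  then have "?P j" by auto
  then have "?P (approx_index k z)"
    unfolding approx_index_def by (rule LeastI)
  then show "approx_index k z \<le> k"
    and "i \<le> k \<Longrightarrow> nrm (\<lambda>x. z x - approx k z x) \<le> nrm (\<lambda>x. z x - dense_seq i x)" by auto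
qed

lemma approx_le_nrm: "nrm (\<lambda>x. z x - approx k z x) \<le> nrm z"
  using approx_best [of 0 k z] by (simp add: dense_seq_0)

lemma approx_tendsto:
  assumes "z \<in> X"
  shows "(\<lambda>k. nrm (\<lambda>x. z x - approx k z x)) \<longlonglongrightarrow> 0"
proof (rule LIMSEQ_I)
  fix e :: real assume "0 < e"
  then obtain i where i: "nrm (\<lambda>x. z x - dense_seq i x) < e"
    using dense_seq_dense [OF assms] by blast
  have "norm (nrm (\<lambda>x. z x - approx k z x) - 0) < e" if "i \<le> k" for k
    using approx_best [OF that, of z] i nrm_nonneg [OF cspace_diff [OF assms dense_seq_in, of "approx_index k z"]]
    by simp
  then show "\<exists>no. \<forall>k\<ge>no. norm (nrm (\<lambda>x. z x - approx k z x) - 0) < e" by blast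
qed

text \<open>Taking the least among the best indices reduces the choice to countably many comparisons
  of measurable distances.\<close>

lemma measurable_approx_index:
  assumes "measurable_on_X I h"
  shows "(\<lambda>\<tau>. approx_index k (h \<tau>)) \<in> measurable (lebesgue_on I) (count_space UNIV)"
proof -
  have [measurable]: "(\<lambda>\<tau>. nrm (\<lambda>x. h \<tau> x - dense_seq j x)) \<in> borel_measurable (lebesgue_on I)" for j
    by (intro borel_measurable_nrm measurable_on_X_diff assms measurable_on_X_const dense_seq_in)
  show ?thesis unfolding approx_index_def by measurable
qed

lemma measurable_on_X_approx:
  assumes "measurable_on_X I h"
  shows "measurable_on_X I (\<lambda>\<tau>. approx k (h \<tau>))"
proof (intro measurable_on_X_I dense_seq_in)
  fix x
  show "(\<lambda>\<tau>. approx k (h \<tau>) x) \<in> borel_measurable (lebesgue_on I)"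
    by (rule measurable_compose_countable [OF _ measurable_approx_index [OF assms]]) simp
qed

lemma integrable_nrm_bound:
  assumes "measurable_on_X I h" "integrable (lebesgue_on I) m"
    "AE \<tau> in lebesgue_on I. nrm (h \<tau>) \<le> m \<tau>"
  shows "integrable (lebesgue_on I) (\<lambda>\<tau>. nrm (h \<tau>))"
proof (rule Bochner_Integration.integrable_bound [OF assms(2) borel_measurable_nrm [OF assms(1)]])
  have "AE \<tau> in lebesgue_on I. h \<tau> \<in> X"
    using assms(1) by (auto simp: measurable_on_X_def intro!: AE_I2)
  then show "AE \<tau> in lebesgue_on I. norm (nrm (h \<tau>)) \<le> norm (m \<tau>)"
    using assms(3) by eventually_elim (use nrm_nonneg in fastforce)
qed

lemma integrable_at:
  assumes "measurable_on_X I h" "integrable (lebesgue_on I) (\<lambda>\<tau>. nrm (h \<tau>))"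
  shows "integrable (lebesgue_on I) (\<lambda>\<tau>. h \<tau> x)"
proof (rule Bochner_Integration.integrable_bound [OF assms(2) measurable_on_X_at [OF assms(1)]])
  show "AE \<tau> in lebesgue_on I. norm (h \<tau> x) \<le> norm (nrm (h \<tau>))"
  proof (rule AE_I2)
    fix \<tau> assume "\<tau> \<in> space (lebesgue_on I)"
    then have "h \<tau> \<in> X" using assms(1) by (auto simp: measurable_on_X_def)
    from norm1_le_nrm' [OF this, of x] norm_le_norm1 [of "h \<tau> x"]
    show "norm (h \<tau> x) \<le> norm (nrm (h \<tau>))" by simp
  qed
qed

lemma norm1_integral_at_le:
  assumes "measurable_on_X I h" "integrable (lebesgue_on I) (\<lambda>\<tau>. nrm (h \<tau>))"
  shows "norm1 (\<integral>\<tau>. h \<tau> x \<partial>lebesgue_on I) \<le> (\<integral>\<tau>. nrm (h \<tau>) \<partial>lebesgue_on I)"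
proof -
  note int = integrable_at [OF assms]
  have "norm1 (\<integral>\<tau>. h \<tau> x \<partial>lebesgue_on I) \<le> (\<integral>\<tau>. norm1 (h \<tau> x) \<partial>lebesgue_on I)"
    by (rule norm1_integral_le [OF int])
  also have "\<dots> \<le> (\<integral>\<tau>. nrm (h \<tau>) \<partial>lebesgue_on I)"
    using assms(1)
    by (intro integral_mono integrable_norm1 int assms(2) norm1_le_nrm') (auto simp: measurable_on_X_def)
  finally show ?thesis .
qed

text \<open>Evaluation at \<open>x\<close> turns the sum over values into an ordinary integral; the
  finite measure of \<open>I\<close> makes the indicator of each level set integrable.\<close>

lemma simple_integral_on_eq:
  fixes s :: "real \<Rightarrow> real^'m \<Rightarrow> real^'n"
  assumes I: "I \<in> lmeasurable" and s: "simple_on \<kappa> U I s"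
  shows "integrable (lebesgue_on I) (\<lambda>\<tau>. s \<tau> x)"
    and "simple_integral_on I s x = (\<integral>\<tau>. s \<tau> x \<partial>lebesgue_on I)"
proof -
  let ?A = "\<lambda>v. {\<tau> \<in> I. s \<tau> = v}"
  have fin: "finite (s ` I)" and A: "\<And>v. v \<in> s ` I \<Longrightarrow> ?A v \<in> sets lebesgue"
    using s by (auto simp: simple_on_def)
  have Iset: "I \<in> sets lebesgue" using I by auto
  have A': "?A v \<in> sets (lebesgue_on I)" if "v \<in> s ` I" for v
    using A [OF that] Iset by (auto simp: sets_restrict_space_iff)
  have emA: "emeasure (lebesgue_on I) (?A v) = emeasure lebesgue (?A v)" for v
    using Iset by (intro emeasure_restrict_space) auto
  have fin_em: "emeasure (lebesgue_on I) (?A v) < \<infinity>" if "v \<in> s ` I" for v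
  proof -
    have "emeasure lebesgue (?A v) \<le> emeasure lebesgue I"
      using Iset by (intro emeasure_mono) auto
    then show ?thesis using I by (auto simp: emA fmeasurable_def intro: le_less_trans)
  qed
  have eq: "s \<tau> x = (\<Sum>v\<in>s ` I. indicator (?A v) \<tau> *\<^sub>R v x)" if "\<tau> \<in> space (lebesgue_on I)" for \<tau>
  proof -
    have "(\<Sum>v\<in>s ` I. indicator (?A v) \<tau> *\<^sub>R v x) = (\<Sum>v\<in>s ` I. if v = s \<tau> then v x else 0)"
      using that by (intro sum.cong) (auto simp: indicator_def)
    also have "\<dots> = s \<tau> x" using fin that by (simp add: sum.delta)
    finally show ?thesis by simp
  qed
  have int: "integrable (lebesgue_on I) (\<lambda>\<tau>. \<Sum>v\<in>s ` I. indicator (?A v) \<tau> *\<^sub>R v x)"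
    using A' fin_em by (intro Bochner_Integration.integrable_sum integrable_scaleR_left integrable_real_indicator) auto
  then show "integrable (lebesgue_on I) (\<lambda>\<tau>. s \<tau> x)"
    by (simp only: eq cong: Bochner_Integration.integrable_cong)
  have AI: "?A v \<inter> I = ?A v" for v by auto
  have "(\<integral>\<tau>. s \<tau> x \<partial>lebesgue_on I) = (\<integral>\<tau>. (\<Sum>v\<in>s ` I. indicator (?A v) \<tau> *\<^sub>R v x) \<partial>lebesgue_on I)"
    by (rule Bochner_Integration.integral_cong [OF refl eq])
  also have "\<dots> = (\<Sum>v\<in>s ` I. measure (lebesgue_on I) (?A v) *\<^sub>R v x)"
    using A' fin_em
    by (subst Bochner_Integration.integral_sum)
       (auto intro!: integrable_scaleR_left integrable_real_indicator sum.cong simp: AI)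
  also have "\<dots> = simple_integral_on I s x"
    unfolding simple_integral_on_def by (simp add: measure_def emA)
  finally show "simple_integral_on I s x = (\<integral>\<tau>. s \<tau> x \<partial>lebesgue_on I)" by simp
qed

lemma simple_integral_on_in:
  assumes "simple_on \<kappa> U I s"
  shows "simple_integral_on I s \<in> X"
  using assms unfolding simple_integral_on_def simple_on_def
  by (intro cspace_sum cspace_scale) auto

text \<open>The approximants \<open>approx k (h \<tau>)\<close> converge in norm at each
  \<open>\<tau>\<close> with error at most \<open>nrm (h \<tau>)\<close>. Dominated convergence
  makes the integrated error vanish, and this error bounds the distance between the simple integrals
  and the pointwise integral for all \<open>x\<close> at once.\<close>

lemma has_X_integralI:
  assumes I: "I \<in> lmeasurable" and h: "measurable_on_X I h"
    and m: "integrable (lebesgue_on I) m" "AE \<tau> in lebesgue_on I. nrm (h \<tau>) \<le> m \<tau>"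
  shows "has_X_integral \<kappa> U I h (\<lambda>x. \<integral>\<tau>. h \<tau> x \<partial>lebesgue_on I)"
proof -
  have Iset: "I \<in> sets lebesgue" using I by auto
  define s where "s \<equiv> \<lambda>k \<tau>. approx k (h \<tau>)"
  let ?J = "\<lambda>x. \<integral>\<tau>. h \<tau> x \<partial>lebesgue_on I"
  define e where "e \<equiv> \<lambda>k. \<integral>\<tau>. nrm (\<lambda>x. h \<tau> x - s k \<tau> x) \<partial>lebesgue_on I"
  have meas_diff: "measurable_on_X I (\<lambda>\<tau> x. h \<tau> x - s k \<tau> x)" for k
    unfolding s_def by (intro measurable_on_X_diff h measurable_on_X_approx)
  have int_h: "integrable (lebesgue_on I) (\<lambda>\<tau>. nrm (h \<tau>))"
    by (rule integrable_nrm_bound [OF h m])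
  have int_diff: "integrable (lebesgue_on I) (\<lambda>\<tau>. nrm (\<lambda>x. h \<tau> x - s k \<tau> x))" for k
    by (rule integrable_nrm_bound [OF meas_diff int_h]) (simp add: s_def approx_le_nrm)
  have simp_s: "simple_on \<kappa> U I (s k)" for k
    unfolding simple_on_def
  proof (intro conjI ballI)
    have "s k ` I \<subseteq> dense_seq ` {..k}" using approx_index_le by (auto simp: s_def)
    then show "finite (s k ` I)" by (rule finite_subset) simp
    show "s k ` I \<subseteq> X" using dense_seq_in by (auto simp: s_def)
    fix v
    have "{\<tau> \<in> space (lebesgue_on I). approx_index k (h \<tau>) \<in> {j. dense_seq j = v}} \<in> sets (lebesgue_on I)"
      by (rule measurable_sets_Collect [OF measurable_approx_index [OF h]]) auto
    then show "{\<tau> \<in> I. s k \<tau> = v} \<in> sets lebesgue"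
      using Iset by (simp add: s_def sets_restrict_space_iff)
  qed
  have e_lim: "e \<longlonglongrightarrow> 0"
  proof -
    have "(\<lambda>k. \<integral>\<tau>. nrm (\<lambda>x. h \<tau> x - s k \<tau> x) \<partial>lebesgue_on I) \<longlonglongrightarrow> (\<integral>\<tau>. 0 \<partial>lebesgue_on I)"
    proof (rule integral_dominated_convergence [OF _ _ int_h])
      show "(\<lambda>\<tau>. nrm (\<lambda>x. h \<tau> x - s k \<tau> x)) \<in> borel_measurable (lebesgue_on I)" for k
        by (rule borel_measurable_nrm [OF meas_diff])
      show "AE \<tau> in lebesgue_on I. (\<lambda>k. nrm (\<lambda>x. h \<tau> x - s k \<tau> x)) \<longlonglongrightarrow> 0"
        using measurable_on_X_in [OF h] by (intro AE_I2) (auto simp: s_def intro: approx_tendsto)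
      show "AE \<tau> in lebesgue_on I. norm (nrm (\<lambda>x. h \<tau> x - s k \<tau> x)) \<le> nrm (h \<tau>)" for k
      proof (rule AE_I2)
        fix \<tau> assume "\<tau> \<in> space (lebesgue_on I)"
        then have "0 \<le> nrm (\<lambda>x. h \<tau> x - s k \<tau> x)"
          by (intro nrm_nonneg measurable_on_X_in [OF meas_diff]) simp
        then show "norm (nrm (\<lambda>x. h \<tau> x - s k \<tau> x)) \<le> nrm (h \<tau>)"
          using approx_le_nrm by (simp add: s_def)
      qed
    qed simp
    then show ?thesis by (simp add: e_def [abs_def])
  qed
  have int_bound: "norm1 (simple_integral_on I (s k) x - ?J x) \<le> e k" for k x
  proof -
    have "simple_integral_on I (s k) x - ?J x = - (\<integral>\<tau>. h \<tau> x - s k \<tau> x \<partial>lebesgue_on I)"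
      using simple_integral_on_eq [OF I simp_s [of k], of x] integrable_at [OF h int_h, of x] by simp
    then show ?thesis
      using norm1_integral_at_le [OF meas_diff [of k] int_diff [of k], of x] norm1_minus_commute [of 0 "\<integral>\<tau>. h \<tau> x - s k \<tau> x \<partial>lebesgue_on I"]
      by (simp add: e_def)
  qed
  have J: "?J \<in> X"
  proof (rule cspace_uniform_limit)
    fix x assume x: "x \<notin> closure U"
    have "?J x = (\<integral>\<tau>. 0 \<partial>lebesgue_on I)"
      using cspace_outside [OF measurable_on_X_in [OF h] x]
      by (intro Bochner_Integration.integral_cong) auto
    then show "?J x = 0" by simp
  next
    fix \<epsilon> :: real assume "0 < \<epsilon>"
    then obtain k where "e k < \<epsilon>"
      using order_tendstoD(2) [OF e_lim] by (auto simp: eventually_sequentially)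
    then show "\<exists>w\<in>X. \<forall>x\<in>closure U. norm1 (w x - ?J x) \<le> \<epsilon>"
      using int_bound [of k] simple_integral_on_in [OF simp_s [of k]]
      by (intro bexI [of _ "simple_integral_on I (s k)"]) (auto intro: order_trans less_imp_le)
  qed
  show ?thesis unfolding has_X_integral_def
  proof (intro conjI J exI [of _ s] allI simp_s)
    show "AE \<tau> in lebesgue. \<tau> \<in> I \<longrightarrow> h \<tau> \<in> X \<and> (\<lambda>k. nrm (\<lambda>x. h \<tau> x - s k \<tau> x)) \<longlonglongrightarrow> 0"
      using measurable_on_X_in [OF h] approx_tendsto by (intro AE_I2) (auto simp: s_def)
    have "(\<integral>\<^sup>+\<tau>\<in>I. ennreal (nrm (\<lambda>x. h \<tau> x - s k \<tau> x)) \<partial>lebesgue) = ennreal (e k)" for k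
    proof -
      have "(\<integral>\<^sup>+\<tau>\<in>I. ennreal (nrm (\<lambda>x. h \<tau> x - s k \<tau> x)) \<partial>lebesgue) =
          (\<integral>\<^sup>+\<tau>. ennreal (nrm (\<lambda>x. h \<tau> x - s k \<tau> x)) \<partial>lebesgue_on I)"
        using Iset by (simp add: nn_integral_restrict_space)
      also have "\<dots> = ennreal (e k)"
        unfolding e_def
        using nrm_nonneg [OF measurable_on_X_in [OF meas_diff]]
        by (intro nn_integral_eq_integral int_diff AE_I2) auto
      finally show ?thesis .
    qed
    then show "(\<lambda>k. \<integral>\<^sup>+\<tau>\<in>I. ennreal (nrm (\<lambda>x. h \<tau> x - s k \<tau> x)) \<partial>lebesgue) \<longlonglongrightarrow> 0"
      using tendsto_ennrealI [OF e_lim] by simp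
    show "(\<lambda>k. nrm (\<lambda>x. simple_integral_on I (s k) x - ?J x)) \<longlonglongrightarrow> 0"
    proof (rule tendsto_sandwich [OF _ _ tendsto_const e_lim])
      show "\<forall>\<^sub>F k in sequentially. 0 \<le> nrm (\<lambda>x. simple_integral_on I (s k) x - ?J x)"
        by (intro always_eventually allI nrm_nonneg cspace_diff J simple_integral_on_in simp_s)
      show "\<forall>\<^sub>F k in sequentially. nrm (\<lambda>x. simple_integral_on I (s k) x - ?J x) \<le> e k"
        using int_bound by (intro always_eventually allI nrm_leI) auto
    qed
  qed
qed

lemma has_X_integral_cong_AE:
  fixes h :: "real \<Rightarrow> real^'m \<Rightarrow> real^'n"
  assumes h: "has_X_integral \<kappa> U I h J" and ae: "AE \<tau> in lebesgue. \<tau> \<in> I \<longrightarrow> h \<tau> = h' \<tau>"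
  shows "has_X_integral \<kappa> U I h' J"
proof -
  obtain s where s: "\<And>k. simple_on \<kappa> U I (s k)"
    and lim: "AE \<tau> in lebesgue. \<tau> \<in> I \<longrightarrow> h \<tau> \<in> X \<and> (\<lambda>k. nrm (\<lambda>x. h \<tau> x - s k \<tau> x)) \<longlonglongrightarrow> 0"
    and nn: "(\<lambda>k. \<integral>\<^sup>+\<tau>\<in>I. ennreal (nrm (\<lambda>x. h \<tau> x - s k \<tau> x)) \<partial>lebesgue) \<longlonglongrightarrow> 0"
    and J: "(\<lambda>k. nrm (\<lambda>x. simple_integral_on I (s k) x - J x)) \<longlonglongrightarrow> 0" "J \<in> X"
    using h unfolding has_X_integral_def by blast
  have "(\<integral>\<^sup>+\<tau>\<in>I. ennreal (nrm (\<lambda>x. h \<tau> x - s k \<tau> x)) \<partial>lebesgue) =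
      (\<integral>\<^sup>+\<tau>\<in>I. ennreal (nrm (\<lambda>x. h' \<tau> x - s k \<tau> x)) \<partial>lebesgue)" for k
    using ae by (intro nn_integral_cong_AE) (auto simp: indicator_def elim: eventually_mono)
  with nn have "(\<lambda>k. \<integral>\<^sup>+\<tau>\<in>I. ennreal (nrm (\<lambda>x. h' \<tau> x - s k \<tau> x)) \<partial>lebesgue) \<longlonglongrightarrow> 0" by simp
  moreover have "AE \<tau> in lebesgue. \<tau> \<in> I \<longrightarrow> h' \<tau> \<in> X \<and> (\<lambda>k. nrm (\<lambda>x. h' \<tau> x - s k \<tau> x)) \<longlonglongrightarrow> 0"
    using ae lim by eventually_elim auto
  ultimately show ?thesis using s J unfolding has_X_integral_def by blast
qed

text \<open>Convergence in the supremum norm dominates convergence at \<open>x\<close>, so the value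
  of the integral is determined by ordinary integrals. Norm bounds thereby reduce to estimates at
  each \<open>x\<close>.\<close>

lemma has_X_integral_at:
  fixes h :: "real \<Rightarrow> real^'m \<Rightarrow> real^'n"
  assumes I: "I \<in> lmeasurable" and h: "has_X_integral \<kappa> U I h J" and x: "x \<in> closure U"
  shows "integrable (lebesgue_on I) (\<lambda>\<tau>. h \<tau> x)" and "(\<integral>\<tau>. h \<tau> x \<partial>lebesgue_on I) = J x"
proof -
  have Iset: "I \<in> sets lebesgue" using I by auto
  obtain s where s: "\<And>k. simple_on \<kappa> U I (s k)"
    and lim: "AE \<tau> in lebesgue. \<tau> \<in> I \<longrightarrow> h \<tau> \<in> X \<and> (\<lambda>k. nrm (\<lambda>x. h \<tau> x - s k \<tau> x)) \<longlonglongrightarrow> 0"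
    and nn: "(\<lambda>k. \<integral>\<^sup>+\<tau>\<in>I. ennreal (nrm (\<lambda>x. h \<tau> x - s k \<tau> x)) \<partial>lebesgue) \<longlonglongrightarrow> 0"
    and Jlim: "(\<lambda>k. nrm (\<lambda>x. simple_integral_on I (s k) x - J x)) \<longlonglongrightarrow> 0" and J: "J \<in> X"
    using h unfolding has_X_integral_def by blast
  have sX: "s k \<tau> \<in> X" if "\<tau> \<in> I" for k \<tau>
    using s [of k] that by (auto simp: simple_on_def)
  have le: "norm (h \<tau> x - s k \<tau> x) \<le> nrm (\<lambda>x. h \<tau> x - s k \<tau> x)" if "\<tau> \<in> I" "h \<tau> \<in> X" for k \<tau>
    using norm1_le_nrm' [OF cspace_diff [OF that(2) sX [OF that(1), of k]], of x] norm_le_norm1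
    by (rule order_trans [rotated])
  have int_s: "integrable (lebesgue_on I) (\<lambda>\<tau>. s k \<tau> x)" for k
    by (rule simple_integral_on_eq [OF I s])
  have AE_lim: "AE \<tau> in lebesgue_on I. h \<tau> \<in> X \<and> (\<lambda>k. s k \<tau> x) \<longlonglongrightarrow> h \<tau> x"
    unfolding AE_lebesgue_on_iff [OF Iset]
    using lim
  proof eventually_elim
    case (elim \<tau>)
    show ?case
    proof (intro impI)
      assume \<tau>: "\<tau> \<in> I"
      then have hX: "h \<tau> \<in> X" and l: "(\<lambda>k. nrm (\<lambda>x. h \<tau> x - s k \<tau> x)) \<longlonglongrightarrow> 0" using elim by auto
      have "(\<lambda>k. h \<tau> x - s k \<tau> x) \<longlonglongrightarrow> 0"
        by (rule Lim_null_comparison [OF always_eventually l]) (use le [OF \<tau> hX] in auto)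
      from tendsto_diff [OF tendsto_const [of "h \<tau> x"] this]
      show "h \<tau> \<in> X \<and> (\<lambda>k. s k \<tau> x) \<longlonglongrightarrow> h \<tau> x" using hX by simp
    qed
  qed
  have meas: "(\<lambda>\<tau>. h \<tau> x) \<in> borel_measurable (lebesgue_on I)"
  proof -
    have [measurable]: "(\<lambda>\<tau>. s k \<tau> x) \<in> borel_measurable (lebesgue_on I)" for k
      using int_s by auto
    have "(\<lambda>\<tau>. lim (\<lambda>k. s k \<tau> x)) \<in> borel_measurable (lebesgue_on I)"
      by measurable
    then have "(\<lambda>\<tau>. if \<tau> \<in> I then lim (\<lambda>k. s k \<tau> x) else 0) \<in> borel_measurable lebesgue"
      using Iset by (simp add: borel_measurable_if)
    then have "(\<lambda>\<tau>. if \<tau> \<in> I then h \<tau> x else 0) \<in> borel_measurable lebesgue"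
    proof (rule borel_measurable_AE)
      show "AE \<tau> in lebesgue. (if \<tau> \<in> I then lim (\<lambda>k. s k \<tau> x) else 0) = (if \<tau> \<in> I then h \<tau> x else 0)"
        using AE_lim unfolding AE_lebesgue_on_iff [OF Iset]
        by eventually_elim (auto intro: limI)
    qed
    then show ?thesis using Iset by (simp add: borel_measurable_if)
  qed
  have nn_le: "(\<integral>\<^sup>+\<tau>. norm (h \<tau> x - s k \<tau> x) \<partial>lebesgue_on I) \<le>
      (\<integral>\<^sup>+\<tau>\<in>I. ennreal (nrm (\<lambda>x. h \<tau> x - s k \<tau> x)) \<partial>lebesgue)" for k
  proof -
    have "(\<integral>\<^sup>+\<tau>. norm (h \<tau> x - s k \<tau> x) \<partial>lebesgue_on I) \<le>
        (\<integral>\<^sup>+\<tau>. ennreal (nrm (\<lambda>x. h \<tau> x - s k \<tau> x)) \<partial>lebesgue_on I)"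
    proof (rule nn_integral_mono_AE)
      show "AE \<tau> in lebesgue_on I. ennreal (norm (h \<tau> x - s k \<tau> x)) \<le> ennreal (nrm (\<lambda>x. h \<tau> x - s k \<tau> x))"
        unfolding AE_lebesgue_on_iff [OF Iset]
        using lim by eventually_elim (use le in \<open>auto intro: ennreal_leI\<close>)
    qed
    then show ?thesis using Iset by (simp add: nn_integral_restrict_space)
  qed
  have nn0: "(\<lambda>k. \<integral>\<^sup>+\<tau>. norm (h \<tau> x - s k \<tau> x) \<partial>lebesgue_on I) \<longlonglongrightarrow> 0"
    by (rule tendsto_sandwich [OF _ _ tendsto_const nn]) (use nn_le in auto)
  have fin: "\<exists>k. (\<integral>\<^sup>+\<tau>. norm (h \<tau> x - s k \<tau> x) \<partial>lebesgue_on I) < 1"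
    using order_tendstoD(2) [OF nn0, of 1] by (auto simp: eventually_sequentially)
  \<comment> \<open>A single simple function at finite L1 distance makes
    \<open>\<lambda>\<tau>. h \<tau> x\<close> integrable.\<close>
  then obtain k where k: "(\<integral>\<^sup>+\<tau>. norm (h \<tau> x - s k \<tau> x) \<partial>lebesgue_on I) < 1" ..
  have "integrable (lebesgue_on I) (\<lambda>\<tau>. h \<tau> x - s k \<tau> x)"
    using meas int_s [of k] k
    by (intro integrableI_bounded borel_measurable_diff) (auto intro: less_trans)
  from Bochner_Integration.integrable_add [OF this int_s [of k]]
  show int_h: "integrable (lebesgue_on I) (\<lambda>\<tau>. h \<tau> x)" by simp
  have lim1: "(\<lambda>k. \<integral>\<tau>. s k \<tau> x \<partial>lebesgue_on I) \<longlonglongrightarrow> (\<integral>\<tau>. h \<tau> x \<partial>lebesgue_on I)"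
  proof (rule tendsto_L1_int [OF int_s int_h])
    show "((\<lambda>k. \<integral>\<^sup>+\<tau>. norm (s k \<tau> x - h \<tau> x) \<partial>lebesgue_on I) \<longlongrightarrow> 0) sequentially"
      using nn0 by (simp add: norm_minus_commute)
  qed
  have "(\<lambda>k. simple_integral_on I (s k) x - J x) \<longlonglongrightarrow> 0"
  proof (rule Lim_null_comparison [OF always_eventually Jlim], rule allI)
    fix k
    show "norm (simple_integral_on I (s k) x - J x) \<le> nrm (\<lambda>x. simple_integral_on I (s k) x - J x)"
      using norm1_le_nrm' [OF cspace_diff [OF simple_integral_on_in [OF s] J]] norm_le_norm1
      by (rule order_trans [rotated])
  qed
  then have "(\<lambda>k. simple_integral_on I (s k) x) \<longlonglongrightarrow> J x"
    by (rule LIM_zero_cancel)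
  then have "(\<lambda>k. \<integral>\<tau>. s k \<tau> x \<partial>lebesgue_on I) \<longlonglongrightarrow> J x"
    using simple_integral_on_eq(2) [OF I s] by simp
  then show "(\<integral>\<tau>. h \<tau> x \<partial>lebesgue_on I) = J x"
    using lim1 LIMSEQ_unique by blast
qed

text \<open>Arguing at each \<open>x\<close> avoids the question whether
  \<open>nrm (\<lambda>x. h \<tau> x - h' \<tau> x)\<close> is measurable in \<open>\<tau>\<close>:
  an integrable majorant \<open>b\<close> is enough.\<close>

lemma has_X_integral_diff_bound:
  assumes I: "I \<in> lmeasurable"
    and h: "has_X_integral \<kappa> U I h J" and h': "has_X_integral \<kappa> U I h' J'"
    and b: "integrable (lebesgue_on I) b"
    and le: "AE \<tau> in lebesgue. \<tau> \<in> I \<longrightarrow> nrm (\<lambda>x. h \<tau> x - h' \<tau> x) \<le> b \<tau>"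
  shows "nrm (\<lambda>x. J x - J' x) \<le> (\<integral>\<tau>. b \<tau> \<partial>lebesgue_on I)"
proof (rule nrm_leI)
  fix x assume x: "x \<in> closure U"
  have Iset: "I \<in> sets lebesgue" using I by auto
  note at = has_X_integral_at [OF I h x] and at' = has_X_integral_at [OF I h' x]
  have int: "integrable (lebesgue_on I) (\<lambda>\<tau>. h \<tau> x - h' \<tau> x)"
    using at(1) at'(1) by (rule Bochner_Integration.integrable_diff)
  have mem: "AE \<tau> in lebesgue. \<tau> \<in> I \<longrightarrow> h \<tau> \<in> X" "AE \<tau> in lebesgue. \<tau> \<in> I \<longrightarrow> h' \<tau> \<in> X"
    using h h' unfolding has_X_integral_def by (auto elim: eventually_mono)
  have "norm1 (J x - J' x) = norm1 (\<integral>\<tau>. h \<tau> x - h' \<tau> x \<partial>lebesgue_on I)"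
    using at at' by simp
  also have "\<dots> \<le> (\<integral>\<tau>. norm1 (h \<tau> x - h' \<tau> x) \<partial>lebesgue_on I)"
    by (rule norm1_integral_le [OF int])
  also have "\<dots> \<le> (\<integral>\<tau>. b \<tau> \<partial>lebesgue_on I)"
  proof (rule integral_mono_AE [OF integrable_norm1 [OF int] b])
    show "AE \<tau> in lebesgue_on I. norm1 (h \<tau> x - h' \<tau> x) \<le> b \<tau>"
      unfolding AE_lebesgue_on_iff [OF Iset]
      using mem le
    proof eventually_elim
      case (elim \<tau>)
      then show ?case
        using norm1_le_nrm [of "\<lambda>x. h \<tau> x - h' \<tau> x" x] cspace_diff [of "h \<tau>" \<kappa> U "h' \<tau>"] x by force
    qed
  qed
  finally show "norm1 (J x - J' x) \<le> (\<integral>\<tau>. b \<tau> \<partial>lebesgue_on I)" .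
qed

section \<open>Convolution with the semigroup\<close>

lemma PS_continuous_at:
  assumes v: "v \<in> X"
  shows "continuous_on {0..} (\<lambda>t. PS t v x)"
  unfolding continuous_on_def
proof
  fix t :: real assume t: "t \<in> {0..}"
  have "((\<lambda>s. PS s v x - PS t v x) \<longlongrightarrow> 0) (at t within {0..})"
  proof (rule Lim_null_comparison [OF _ PS_continuous [OF v]])
    show "\<forall>\<^sub>F s in at t within {0..}. norm (PS s v x - PS t v x) \<le> nrm (\<lambda>x. PS s v x - PS t v x)"
      unfolding eventually_at_filter
    proof (rule always_eventually, intro allI impI)
      fix s :: real assume "s \<in> {0..}"
      then have "(\<lambda>x. PS s v x - PS t v x) \<in> X"
        using t by (intro cspace_diff PS_in v) auto
      from norm1_le_nrm' [OF this, of x] show "norm (PS s v x - PS t v x) \<le> nrm (\<lambda>x. PS s v x - PS t v x)"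
        using norm_le_norm1 order_trans by blast
    qed
  qed (use t in simp)
  then show "((\<lambda>t. PS t v x) \<longlongrightarrow> PS t v x) (at t within {0..})"
    by (rule LIM_zero_cancel)
qed

text \<open>Extending the integrand by zero beyond \<open>t\<close> lets the integrals for all
  \<open>t\<close> live on one interval, so that their dependence on \<open>t\<close> is open to
  dominated convergence.\<close>

definition delayed :: "(real \<Rightarrow> real^'m \<Rightarrow> real^'n) \<Rightarrow> real \<Rightarrow> real \<Rightarrow> real^'m \<Rightarrow> real^'n"
  where "delayed F t \<tau> = (if \<tau> \<le> t then PS (t - \<tau>) (F \<tau>) else (\<lambda>x. 0))"

lemma delayed_in: "F \<tau> \<in> X \<Longrightarrow> delayed F t \<tau> \<in> X"
  by (simp add: delayed_def PS_in cspace_zero)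

lemma nrm_delayed_le: "F \<tau> \<in> X \<Longrightarrow> nrm (delayed F t \<tau>) \<le> real CARD('n) * nrm (F \<tau>)"
  by (simp add: delayed_def PS_bound nrm_nonneg)

text \<open>Both the time and the vector fed to the semigroup vary with \<open>\<tau>\<close>. For a
  fixed vector the dependence is continuous; the countably valued approximants of
  \<open>F \<tau>\<close> then give measurable functions, and boundedness of the semigroup carries
  this to the limit.\<close>

lemma measurable_on_X_delayed:
  assumes F: "measurable_on_X I F"
  shows "measurable_on_X I (delayed F t)"
proof (rule measurable_on_X_I)
  show "delayed F t \<tau> \<in> X" if "\<tau> \<in> I" for \<tau>
    by (intro delayed_in measurable_on_X_in [OF F that])
  fix x assume x: "x \<in> closure U"
  \<comment> \<open>\<open>max 0\<close> keeps the time nonnegative, so that the semigroup term is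
    continuous on the whole line; it changes nothing where \<open>\<tau> \<le> t\<close>.\<close>
  let ?g = "\<lambda>v \<tau>. if \<tau> \<le> t then PS (max 0 (t - \<tau>)) v x else 0"
  have g_meas: "?g v \<in> borel_measurable (lebesgue_on I)" if "v \<in> X" for v
  proof -
    have "continuous_on UNIV (\<lambda>\<tau>. PS (max 0 (t - \<tau>)) v x)"
      by (rule continuous_on_compose2 [OF PS_continuous_at [OF that]]) (auto intro!: continuous_intros)
    then have "(\<lambda>\<tau>. PS (max 0 (t - \<tau>)) v x) \<in> borel_measurable borel"
      by (rule borel_measurable_continuous_onI)
    then have "?g v \<in> borel_measurable borel" by measurable
    then show ?thesis by (intro measurable_restrict_space1 measurable_completion) simp
  qed
  show "(\<lambda>\<tau>. delayed F t \<tau> x) \<in> borel_measurable (lebesgue_on I)"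
  proof (rule borel_measurable_LIMSEQ_metric)
    show "(\<lambda>\<tau>. ?g (approx k (F \<tau>)) \<tau>) \<in> borel_measurable (lebesgue_on I)" for k
      by (rule measurable_compose_countable [OF g_meas [OF dense_seq_in] measurable_approx_index [OF F]])
    fix \<tau> assume "\<tau> \<in> space (lebesgue_on I)"
    then have F\<tau>: "F \<tau> \<in> X" using measurable_on_X_in [OF F] by simp
    show "(\<lambda>k. ?g (approx k (F \<tau>)) \<tau>) \<longlonglongrightarrow> delayed F t \<tau> x"
    proof (cases "\<tau> \<le> t")
      case True
      have "(\<lambda>k. PS (t - \<tau>) (F \<tau>) x - PS (t - \<tau>) (approx k (F \<tau>)) x) \<longlonglongrightarrow> 0"
      proof (rule Lim_null_comparison [OF always_eventually tendsto_mult_right_zero [OF approx_tendsto [OF F\<tau>]]], rule allI)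
        fix k
        have "norm (PS (t - \<tau>) (F \<tau>) x - PS (t - \<tau>) (approx k (F \<tau>)) x)
            \<le> nrm (\<lambda>x. PS (t - \<tau>) (F \<tau>) x - PS (t - \<tau>) (approx k (F \<tau>)) x)"
          using True by (intro order_trans [OF norm_le_norm1]
              norm1_le_nrm [of "\<lambda>x. _ x - _ x", OF _ x] cspace_diff PS_in F\<tau> dense_seq_in) auto
        also have "\<dots> \<le> real CARD('n) * nrm (\<lambda>x. F \<tau> x - approx k (F \<tau>) x)"
          using True by (intro PS_diff_bound F\<tau> dense_seq_in) simp
        finally show "norm (PS (t - \<tau>) (F \<tau>) x - PS (t - \<tau>) (approx k (F \<tau>)) x)
            \<le> real CARD('n) * nrm (\<lambda>x. F \<tau> x - approx k (F \<tau>) x)" .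
      qed
      from tendsto_diff [OF tendsto_const [of "PS (t - \<tau>) (F \<tau>) x"] this]
      show ?thesis using True by (simp add: delayed_def max_def)
    qed (simp add: delayed_def)
  qed
qed

section \<open>Continuous paths and the convolution integral\<close>

definition path_in_X :: "real \<Rightarrow> (real \<Rightarrow> real^'m \<Rightarrow> real^'n) \<Rightarrow> bool"
  where "path_in_X T w \<longleftrightarrow> (\<forall>t\<in>{0..T}. w t \<in> X) \<and>
    (\<forall>t\<in>{0..T}. ((\<lambda>s. nrm (\<lambda>x. w s x - w t x)) \<longlongrightarrow> 0) (at t within {0..T}))"

lemma path_in_X_in: "\<lbrakk>path_in_X T w; t \<in> {0..T}\<rbrakk> \<Longrightarrow> w t \<in> X"
  by (simp add: path_in_X_def)

lemma path_in_X_add: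
  assumes w: "path_in_X T w" and v: "path_in_X T v"
  shows "path_in_X T (\<lambda>t x. w t x + v t x)"
  unfolding path_in_X_def
proof (intro conjI ballI)
  show "(\<lambda>x. w t x + v t x) \<in> X" if "t \<in> {0..T}" for t
    using that assms by (intro cspace_add path_in_X_in)
  fix t assume t: "t \<in> {0..T}"
  have lim: "((\<lambda>s. nrm (\<lambda>x. w s x - w t x) + nrm (\<lambda>x. v s x - v t x)) \<longlongrightarrow> 0 + 0) (at t within {0..T})"
    using t assms by (intro tendsto_add) (auto simp: path_in_X_def)
  show "((\<lambda>s. nrm (\<lambda>x. w s x + v s x - (w t x + v t x))) \<longlongrightarrow> 0) (at t within {0..T})"
  proof (rule Lim_null_comparison [OF _ lim [simplified]])
    show "\<forall>\<^sub>F s in at t within {0..T}. norm (nrm (\<lambda>x. w s x + v s x - (w t x + v t x))) \<le>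
        nrm (\<lambda>x. w s x - w t x) + nrm (\<lambda>x. v s x - v t x)"
      unfolding eventually_at_filter
    proof (rule always_eventually, intro allI impI)
      fix s assume s: "s \<in> {0..T}"
      have a: "(\<lambda>x. w s x - w t x) \<in> X" "(\<lambda>x. v s x - v t x) \<in> X"
        by (rule cspace_diff [OF path_in_X_in [OF w s] path_in_X_in [OF w t]]
            cspace_diff [OF path_in_X_in [OF v s] path_in_X_in [OF v t]])+
      have eq: "(\<lambda>x. w s x + v s x - (w t x + v t x)) = (\<lambda>x. (w s x - w t x) + (v s x - v t x))"
        by (auto simp: algebra_simps)
      show "norm (nrm (\<lambda>x. w s x + v s x - (w t x + v t x))) \<le>
          nrm (\<lambda>x. w s x - w t x) + nrm (\<lambda>x. v s x - v t x)"
        unfolding eq using nrm_add_le [OF a] nrm_nonneg [OF cspace_add [OF a]] by simp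
    qed
  qed
qed

lemma path_in_X_PS:
  assumes "z \<in> X"
  shows "path_in_X T (\<lambda>t. PS t z)"
  unfolding path_in_X_def
  by (auto intro!: PS_in assms intro: tendsto_within_subset [OF PS_continuous [OF assms]])

lemma path_in_X_continuous_at:
  assumes w: "path_in_X T w"
  shows "continuous_on {0..T} (\<lambda>t. w t x)"
  unfolding continuous_on_def
proof
  fix t assume t: "t \<in> {0..T}"
  have lim: "((\<lambda>s. nrm (\<lambda>x. w s x - w t x)) \<longlongrightarrow> 0) (at t within {0..T})"
    using w t by (simp add: path_in_X_def)
  have "((\<lambda>s. w s x - w t x) \<longlongrightarrow> 0) (at t within {0..T})"
  proof (rule Lim_null_comparison [OF _ lim])
    show "\<forall>\<^sub>F s in at t within {0..T}. norm (w s x - w t x) \<le> nrm (\<lambda>x. w s x - w t x)"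
      unfolding eventually_at_filter
      by (rule always_eventually, intro allI impI order_trans [OF norm_le_norm1]
          norm1_le_nrm' [of "\<lambda>x. _ x - _ x"] cspace_diff path_in_X_in [OF w] t)
  qed
  then show "((\<lambda>t. w t x) \<longlongrightarrow> w t x) (at t within {0..T})"
    by (rule LIM_zero_cancel)
qed

lemma path_in_X_bounded:
  assumes w: "path_in_X T w"
  obtains R where "\<And>t. t \<in> {0..T} \<Longrightarrow> nrm (w t) \<le> R"
proof -
  have "continuous_on {0..T} (\<lambda>t. nrm (w t))"
    unfolding continuous_on_def
  proof
    fix t assume t: "t \<in> {0..T}"
    have lim: "((\<lambda>s. nrm (\<lambda>x. w s x - w t x)) \<longlongrightarrow> 0) (at t within {0..T})"
      using w t by (simp add: path_in_X_def)
    have "((\<lambda>s. nrm (w s) - nrm (w t)) \<longlongrightarrow> 0) (at t within {0..T})"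
    proof (rule Lim_null_comparison [OF _ lim])
      show "\<forall>\<^sub>F s in at t within {0..T}. norm (nrm (w s) - nrm (w t)) \<le> nrm (\<lambda>x. w s x - w t x)"
        unfolding eventually_at_filter
      proof (rule always_eventually, intro allI impI)
        fix s assume s: "s \<in> {0..T}"
        have m: "w s \<in> X" "w t \<in> X" using s t w by (auto intro: path_in_X_in)
        show "norm (nrm (w s) - nrm (w t)) \<le> nrm (\<lambda>x. w s x - w t x)"
          using nrm_triangle [OF m cspace_zero] nrm_triangle [OF m(2,1) cspace_zero]
            nrm_minus_commute [of "w s" "w t"] by simp
      qed
    qed
    then show "((\<lambda>t. nrm (w t)) \<longlongrightarrow> nrm (w t)) (at t within {0..T})"
      by (rule LIM_zero_cancel)
  qed
  then have "compact ((\<lambda>t. nrm (w t)) ` {0..T})"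
    by (intro compact_continuous_image) auto
  then obtain R where "\<forall>y\<in>(\<lambda>t. nrm (w t)) ` {0..T}. norm y \<le> R"
    using compact_imp_bounded bounded_iff by blast
  then have "nrm (w t) \<le> R" if "t \<in> {0..T}" for t
    using that abs_ge_self [of "nrm (w t)"] by (force simp del: atLeastAtMost_iff)
  then show thesis by (rule that)
qed

lemma measurable_on_X_subset:
  assumes "measurable_on_X I h" "J \<subseteq> I"
  shows "measurable_on_X J h"
proof (rule measurable_on_X_I)
  show "h \<tau> \<in> X" if "\<tau> \<in> J" for \<tau>
    using assms that by (intro measurable_on_X_in [OF assms(1)]) auto
  show "(\<lambda>\<tau>. h \<tau> x) \<in> borel_measurable (lebesgue_on J)" for x
    by (rule measurable_restrict_mono [OF measurable_on_X_at [OF assms(1)] assms(2)])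
qed

text \<open>For almost every \<open>\<tau>\<close> the integrand depends continuously on
  \<open>t\<close> at the given point, by strong continuity of the semigroup, and it is dominated by
  a multiple of \<open>nrm (F \<tau>)\<close>. Continuity is tested along sequences to match
  dominated convergence.\<close>

lemma convolution_path:
  assumes F: "measurable_on_X {0..T} F" and int: "integrable (lebesgue_on {0..T}) (\<lambda>\<tau>. nrm (F \<tau>))"
  obtains J where "path_in_X T J"
    "\<And>t. t \<in> {0..T} \<Longrightarrow> has_X_integral \<kappa> U {0..t} (\<lambda>\<tau>. PS (t - \<tau>) (F \<tau>)) (J t)"
proof -
  let ?N = "real CARD('n)"
  define J where "J = (\<lambda>t x. \<integral>\<tau>. delayed F t \<tau> x \<partial>lebesgue_on {0..T})"
  have md: "measurable_on_X {0..T} (delayed F t)" for t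
    by (rule measurable_on_X_delayed [OF F])
  have intN: "integrable (lebesgue_on {0..T}) (\<lambda>\<tau>. ?N * nrm (F \<tau>))"
    by (intro integrable_mult_right int)
  have le: "AE \<tau> in lebesgue_on {0..T}. nrm (delayed F t \<tau>) \<le> ?N * nrm (F \<tau>)" for t
    by (rule AE_I2, rule nrm_delayed_le [of F], rule measurable_on_X_in [OF F]) simp
  have integral: "has_X_integral \<kappa> U {0..t} (\<lambda>\<tau>. PS (t - \<tau>) (F \<tau>)) (J t)" if t: "t \<in> {0..T}" for t
  proof -
    have "has_X_integral \<kappa> U {0..t} (delayed F t) (\<lambda>x. \<integral>\<tau>. delayed F t \<tau> x \<partial>lebesgue_on {0..t})"
    proof (rule has_X_integralI)
      show "measurable_on_X {0..t} (delayed F t)"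
        by (rule measurable_on_X_subset [OF md]) (use t in auto)
      show "integrable (lebesgue_on {0..t}) (\<lambda>\<tau>. ?N * nrm (F \<tau>))"
        by (rule integrable_subinterval [OF intN]) (use t in auto)
      show "AE \<tau> in lebesgue_on {0..t}. nrm (delayed F t \<tau>) \<le> ?N * nrm (F \<tau>)"
        by (rule AE_I2, rule nrm_delayed_le [of F], rule measurable_on_X_in [OF F]) (use t in auto)
    qed auto
    moreover have "(\<integral>\<tau>. delayed F t \<tau> x \<partial>lebesgue_on {0..t}) = J t x" for x
    proof -
      have "(\<integral>\<tau>. delayed F t \<tau> x \<partial>lebesgue_on {0..t}) =
          (\<integral>\<tau>. (if \<tau> \<in> {0..t} then delayed F t \<tau> x else 0) \<partial>lebesgue)"
        by (rule Lebesgue_Measure.integral_restrict_UNIV [symmetric]) auto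
      also have "\<dots> = (\<integral>\<tau>. (if \<tau> \<in> {0..T} then delayed F t \<tau> x else 0) \<partial>lebesgue)"
        using t by (intro Bochner_Integration.integral_cong) (auto simp: delayed_def)
      also have "\<dots> = J t x"
        unfolding J_def by (rule Lebesgue_Measure.integral_restrict_UNIV) auto
      finally show ?thesis .
    qed
    ultimately have "has_X_integral \<kappa> U {0..t} (delayed F t) (J t)" by simp
    then show ?thesis
      by (rule has_X_integral_cong_AE) (auto simp: delayed_def)
  qed
  have cont: "((\<lambda>s. nrm (\<lambda>x. J s x - J t x)) \<longlongrightarrow> 0) (at t within {0..T})" if t: "t \<in> {0..T}" for t
    unfolding tendsto_at_iff_sequentially
  proof (intro allI impI)
    fix \<sigma> :: "nat \<Rightarrow> real"
    assume \<sigma>: "\<forall>i. \<sigma> i \<in> {0..T} - {t}" and lim: "\<sigma> \<longlonglongrightarrow> t"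
    let ?D = "\<lambda>i \<tau> x. delayed F (\<sigma> i) \<tau> x - delayed F t \<tau> x"
    have mD: "measurable_on_X {0..T} (?D i)" for i
      by (intro measurable_on_X_diff md)
    have D_le: "nrm (?D i \<tau>) \<le> 2 * ?N * nrm (F \<tau>)" if "\<tau> \<in> {0..T}" for i \<tau>
    proof -
      have F\<tau>: "F \<tau> \<in> X" by (rule measurable_on_X_in [OF F that])
      have "nrm (?D i \<tau>) \<le> nrm (delayed F (\<sigma> i) \<tau>) + nrm (delayed F t \<tau>)"
        using nrm_triangle [OF delayed_in cspace_zero delayed_in, of F \<tau> F \<tau> "\<sigma> i" t] F\<tau>
          nrm_minus_commute [of "\<lambda>x. 0" "delayed F t \<tau>"] by simp
      then show ?thesis
        using nrm_delayed_le [of F, OF F\<tau>, of "\<sigma> i"] nrm_delayed_le [of F, OF F\<tau>, of t] by simp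
    qed
    have int2: "integrable (lebesgue_on {0..T}) (\<lambda>\<tau>. 2 * ?N * nrm (F \<tau>))"
      by (intro integrable_mult_right int)
    have intD: "integrable (lebesgue_on {0..T}) (\<lambda>\<tau>. nrm (?D i \<tau>))" for i
      by (rule integrable_nrm_bound [OF mD int2]) (rule AE_I2, rule D_le, simp)
    have "(\<lambda>i. \<integral>\<tau>. nrm (?D i \<tau>) \<partial>lebesgue_on {0..T}) \<longlonglongrightarrow> (\<integral>\<tau>. 0 \<partial>lebesgue_on {0..T})"
    proof (rule integral_dominated_convergence [OF _ _ int2])
      show "(\<lambda>\<tau>. nrm (?D i \<tau>)) \<in> borel_measurable (lebesgue_on {0..T})" for i
        by (rule borel_measurable_nrm [OF mD])
      show "AE \<tau> in lebesgue_on {0..T}. norm (nrm (?D i \<tau>)) \<le> 2 * ?N * nrm (F \<tau>)" for i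
      proof (rule AE_I2)
        fix \<tau> assume "\<tau> \<in> space (lebesgue_on {0..T})"
        then have \<tau>: "\<tau> \<in> {0..T}" by simp
        show "norm (nrm (?D i \<tau>)) \<le> 2 * ?N * nrm (F \<tau>)"
          using D_le [OF \<tau>, of i] nrm_nonneg [OF measurable_on_X_in [OF mD \<tau>], of i] by simp
      qed
      \<comment> \<open>At \<open>\<tau> = t\<close> the cut-off jumps; this single point is
        null.\<close>
      have "AE \<tau> in lebesgue. \<tau> \<noteq> t"
        by (rule AE_completion [OF AE_lborel_singleton])
      then show "AE \<tau> in lebesgue_on {0..T}. (\<lambda>i. nrm (?D i \<tau>)) \<longlonglongrightarrow> 0"
        unfolding AE_lebesgue_on_iff [OF lmeasurable_interval(1) [THEN fmeasurableD]]
      proof eventually_elim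
        case (elim \<tau>)
        show ?case
        proof
          assume "\<tau> \<in> {0..T}"
          then have F\<tau>: "F \<tau> \<in> X" by (rule measurable_on_X_in [OF F])
          consider "\<tau> < t" | "t < \<tau>" using elim by linarith
          then show "(\<lambda>i. nrm (?D i \<tau>)) \<longlonglongrightarrow> 0"
          proof cases
            case 1
            have ev: "\<forall>\<^sub>F i in sequentially. \<tau> < \<sigma> i"
              using lim 1 by (rule order_tendstoD)
            have f: "filterlim (\<lambda>i. \<sigma> i - \<tau>) (at (t - \<tau>) within {0..}) sequentially"
              unfolding filterlim_at
              using ev \<sigma> by (auto intro!: tendsto_diff lim elim!: eventually_mono)
            have "(\<lambda>i. nrm (\<lambda>x. PS (\<sigma> i - \<tau>) (F \<tau>) x - PS (t - \<tau>) (F \<tau>) x)) \<longlonglongrightarrow> 0"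
              using filterlim_compose [OF PS_continuous [OF F\<tau>] f] 1 by simp
            moreover have "\<forall>\<^sub>F i in sequentially.
                nrm (\<lambda>x. PS (\<sigma> i - \<tau>) (F \<tau>) x - PS (t - \<tau>) (F \<tau>) x) = nrm (?D i \<tau>)"
              using ev by eventually_elim (use 1 in \<open>simp add: delayed_def\<close>)
            ultimately show ?thesis by (rule Lim_transform_eventually)
          next
            case 2
            have "\<forall>\<^sub>F i in sequentially. \<sigma> i < \<tau>"
              using lim 2 by (rule order_tendstoD)
            then have "\<forall>\<^sub>F i in sequentially. 0 = nrm (?D i \<tau>)"
              by eventually_elim (use 2 in \<open>simp add: delayed_def\<close>)
            then show ?thesis by (rule Lim_transform_eventually [OF tendsto_const])
          qed
        qed
      qed
    qed simp
    then have lim0: "(\<lambda>i. \<integral>\<tau>. nrm (?D i \<tau>) \<partial>lebesgue_on {0..T}) \<longlonglongrightarrow> 0" by simp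
    have JD: "nrm (\<lambda>x. J (\<sigma> i) x - J t x) \<le> (\<integral>\<tau>. nrm (?D i \<tau>) \<partial>lebesgue_on {0..T})" for i
    proof (rule nrm_leI)
      fix x
      have "integrable (lebesgue_on {0..T}) (\<lambda>\<tau>. delayed F s \<tau> x)" for s
        by (rule integrable_at [OF md integrable_nrm_bound [OF md intN le]])
      then have "J (\<sigma> i) x - J t x = (\<integral>\<tau>. ?D i \<tau> x \<partial>lebesgue_on {0..T})"
        by (simp add: J_def)
      then show "norm1 (J (\<sigma> i) x - J t x) \<le> (\<integral>\<tau>. nrm (?D i \<tau>) \<partial>lebesgue_on {0..T})"
        using norm1_integral_at_le [OF mD intD] by simp
    qed
    have JX: "J s \<in> X" if "s \<in> {0..T}" for s
      using integral [OF that] by (simp add: has_X_integral_def)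
    have "(\<lambda>i. nrm (\<lambda>x. J (\<sigma> i) x - J t x)) \<longlonglongrightarrow> 0"
    proof (rule Lim_null_comparison [OF always_eventually lim0], rule allI)
      fix i
      have "0 \<le> nrm (\<lambda>x. J (\<sigma> i) x - J t x)"
        using \<sigma> t by (intro nrm_nonneg cspace_diff JX) auto
      then show "norm (nrm (\<lambda>x. J (\<sigma> i) x - J t x)) \<le> (\<integral>\<tau>. nrm (?D i \<tau>) \<partial>lebesgue_on {0..T})"
        using JD [of i] by simp
    qed
    then show "((\<lambda>s. nrm (\<lambda>x. J s x - J t x)) \<circ> \<sigma>) \<longlonglongrightarrow> 0"
      by (simp add: o_def)
  qed
  have "path_in_X T J"
    using cont integral by (auto simp: path_in_X_def has_X_integral_def)
  then show thesis using integral by (rule that)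
qed

section \<open>Existence and stability of mild solutions\<close>

text \<open>In the Dirichlet case the path is \<open>0\<close> on the boundary and the map sends
  \<open>0\<close> to \<open>0\<close> there, so the composition vanishes on the boundary again.
  Continuity in space is available only at almost every time.\<close>

lemma superposition_AE_in:
  assumes g: "g \<in> SC U" and dir: "\<kappa> = 0 \<longrightarrow> (\<forall>t. \<forall>x\<in>frontier U. g t x 0 = 0)"
    and w: "\<forall>t\<in>I. w t \<in> X"
  shows "AE \<tau> in lebesgue. \<tau> \<in> I \<longrightarrow> superposition U g \<tau> (w \<tau>) \<in> X"
proof -
  have "AE \<tau> in lebesgue. continuous_on (closure U \<times> UNIV) (\<lambda>(x, y). g \<tau> x y)"
    using g by (simp add: SC_def)
  then show ?thesis
  proof eventually_elim
    case (elim \<tau>)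
    show ?case
    proof
      assume \<tau>: "\<tau> \<in> I"
      have "continuous_on (closure U) (\<lambda>x. g \<tau> x (w \<tau> x))"
        using continuous_on_compose2 [OF elim
            continuous_on_Pair [OF continuous_on_id cspace_continuous [OF bspec [OF w \<tau>]]]]
        by auto
      then have "continuous_on (closure U) (superposition U g \<tau> (w \<tau>))"
        by (rule continuous_on_eq) (simp add: superposition_def)
      moreover have "superposition U g \<tau> (w \<tau>) x = 0" if "\<kappa> = 0" "x \<in> frontier U" for x
        using dir that bspec [OF w \<tau>] by (auto simp: superposition_def cspace_def frontier_def)
      ultimately show "superposition U g \<tau> (w \<tau>) \<in> X"
        by (auto simp: cspace_def superposition_def)
    qed
  qed
qed

lemma borel_measurable_SC_at:
  assumes g: "g \<in> SC U" and x: "x \<in> closure U" and y: "y \<in> borel_measurable (lebesgue_on I)"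
  shows "(\<lambda>\<tau>. g \<tau> x (y \<tau>)) \<in> borel_measurable (lebesgue_on I)"
proof -
  have id: "(\<lambda>\<tau>. \<tau>) \<in> borel_measurable (lebesgue_on I)"
    by (intro measurable_restrict_space1 measurable_completion) simp
  have "(\<lambda>\<tau>. (\<tau>, x, y \<tau>)) \<in> borel_measurable (lebesgue_on I)"
    by (intro borel_measurable_Pair id borel_measurable_const y)
  then have 1: "(\<lambda>\<tau>. (\<tau>, x, y \<tau>)) \<in> measurable (lebesgue_on I) (restrict_space borel (UNIV \<times> closure U \<times> UNIV))"
    using x by (intro measurable_restrict_space2) auto
  have 2: "(\<lambda>(t, x, y). g t x y) \<in> borel_measurable (restrict_space borel (UNIV \<times> closure U \<times> UNIV))"
    using g by (simp add: SC_def)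
  show ?thesis
    using measurable_compose [OF 1 2] by simp
qed

text \<open>\<open>measurable_on_X\<close> demands membership in \<open>X\<close> at every time;
  resetting the superposition to \<open>0\<close> on the exceptional null set meets this without
  changing any integral.\<close>

lemma superposition_measurable:
  assumes g: "g \<in> SC U" and dir: "\<kappa> = 0 \<longrightarrow> (\<forall>t. \<forall>x\<in>frontier U. g t x 0 = 0)"
    and w: "path_in_X T w"
  obtains F where "measurable_on_X {0..T} F"
    "AE \<tau> in lebesgue. \<tau> \<in> {0..T} \<longrightarrow> superposition U g \<tau> (w \<tau>) = F \<tau>"
proof -
  define F where "F = (\<lambda>\<tau>. if superposition U g \<tau> (w \<tau>) \<in> X then superposition U g \<tau> (w \<tau>) else (\<lambda>x. 0))"
  have "\<forall>t\<in>{0..T}. w t \<in> X" using path_in_X_in [OF w] by blast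
  from superposition_AE_in [OF g dir this]
  have ae: "AE \<tau> in lebesgue. \<tau> \<in> {0..T} \<longrightarrow> superposition U g \<tau> (w \<tau>) = F \<tau>"
    by eventually_elim (simp add: F_def)
  have "measurable_on_X {0..T} F"
  proof (rule measurable_on_X_I)
    show "F \<tau> \<in> X" for \<tau> by (simp add: F_def cspace_zero)
    fix x assume x: "x \<in> closure U"
    show "(\<lambda>\<tau>. F \<tau> x) \<in> borel_measurable (lebesgue_on {0..T})"
    proof (rule borel_measurable_lebesgue_on_AE)
      show "(\<lambda>\<tau>. g \<tau> x (w \<tau> x)) \<in> borel_measurable (lebesgue_on {0..T})"
        by (rule borel_measurable_SC_at [OF g x
            continuous_imp_measurable_on_sets_lebesgue [OF path_in_X_continuous_at [OF w]]]) auto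
      show "AE \<tau> in lebesgue. \<tau> \<in> {0..T} \<longrightarrow> g \<tau> x (w \<tau> x) = F \<tau> x"
        using ae by eventually_elim (use x in \<open>auto simp: superposition_def dest!: fun_cong [where x = x]\<close>)
    qed auto
  qed
  then show thesis using ae by (rule that)
qed

lemma convolution_superposition:
  assumes g: "g \<in> SC U" and dir: "\<kappa> = 0 \<longrightarrow> (\<forall>t. \<forall>x\<in>frontier U. g t x 0 = 0)"
    and w: "path_in_X T w" and m: "integrable (lebesgue_on {0..T}) m"
    and le: "AE \<tau> in lebesgue. \<tau> \<in> {0..T} \<longrightarrow> nrm (superposition U g \<tau> (w \<tau>)) \<le> m \<tau>"
  obtains J where "path_in_X T J"
    "\<And>t. t \<in> {0..T} \<Longrightarrow> has_X_integral \<kappa> U {0..t} (\<lambda>\<tau>. PS (t - \<tau>) (superposition U g \<tau> (w \<tau>))) (J t)"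
proof -
  obtain F where F: "measurable_on_X {0..T} F"
    and ae: "AE \<tau> in lebesgue. \<tau> \<in> {0..T} \<longrightarrow> superposition U g \<tau> (w \<tau>) = F \<tau>"
    using superposition_measurable [OF g dir w] .
  have "AE \<tau> in lebesgue_on {0..T}. nrm (F \<tau>) \<le> m \<tau>"
    unfolding AE_lebesgue_on_iff [OF fmeasurableD [OF lmeasurable_interval(1)]]
    using ae le by eventually_elim auto
  then have int: "integrable (lebesgue_on {0..T}) (\<lambda>\<tau>. nrm (F \<tau>))"
    by (rule integrable_nrm_bound [OF F m])
  obtain J where J: "path_in_X T J"
    "\<And>t. t \<in> {0..T} \<Longrightarrow> has_X_integral \<kappa> U {0..t} (\<lambda>\<tau>. PS (t - \<tau>) (F \<tau>)) (J t)"
    using convolution_path [OF F int] by blast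
  show thesis
  proof (rule that [OF J(1)])
    fix t assume t: "t \<in> {0..T}"
    show "has_X_integral \<kappa> U {0..t} (\<lambda>\<tau>. PS (t - \<tau>) (superposition U g \<tau> (w \<tau>))) (J t)"
      by (rule has_X_integral_cong_AE [OF J(2) [OF t]]) (use ae t in \<open>auto elim: eventually_mono\<close>)
  qed
qed

text \<open>A Bielecki weight. The factor \<open>CARD('n)\<close> absorbs the norm of the semigroup:
  integrating \<open>CARD('n) * l\<close> against the weight returns
  \<open>(weight l t - 1) / 2\<close>.\<close>

definition weight :: "(real \<Rightarrow> real) \<Rightarrow> real \<Rightarrow> real"
  where "weight l t = exp (2 * (\<integral>s. real CARD('n) * l s \<partial>lebesgue_on {0..t}))"

lemma weight_pos: "0 < weight l t"
  by (simp add: weight_def)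

lemma one_le_weight: "(\<And>t. 0 \<le> l t) \<Longrightarrow> 1 \<le> weight l t"
  by (simp add: weight_def Bochner_Integration.integral_nonneg)

lemma weight_le:
  assumes l: "integrable (lebesgue_on {0..T}) l" "\<And>t. 0 \<le> l t" and t: "t \<in> {0..T}"
  shows "weight l t \<le> exp (2 * real CARD('n) * (\<integral>s. l s \<partial>lebesgue_on {0..T}))"
proof -
  have "(\<integral>s. real CARD('n) * l s \<partial>lebesgue_on {0..t}) \<le> (\<integral>s. real CARD('n) * l s \<partial>lebesgue_on {0..T})"
    using l t by (intro integral_mono_lebesgue_on_AE AE_I2) auto
  then show ?thesis by (simp add: weight_def mult.assoc)
qed

text \<open>One estimate for two uses: with \<open>g' = g\<close> and \<open>\<rho> = 0\<close> it
  is the contraction behind Picard iteration, with an error term \<open>\<rho>\<close> it drives the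
  stability bound. The halving is \<open>integral_exp_weight\<close> at \<open>c = 2\<close>, with
  the term \<open>- 1\<close> dropped.\<close>

lemma convolution_estimate:
  assumes g: "g \<in> SC U" and dir: "\<kappa> = 0 \<longrightarrow> (\<forall>t. \<forall>x\<in>frontier U. g t x 0 = 0)"
    and g': "g' \<in> SC U" and dir': "\<kappa> = 0 \<longrightarrow> (\<forall>t. \<forall>x\<in>frontier U. g' t x 0 = 0)"
    and w: "\<forall>s\<in>{0..T}. w s \<in> X" and v: "\<forall>s\<in>{0..T}. v s \<in> X"
    and l: "integrable (lebesgue_on {0..T}) l" "\<And>t. 0 \<le> l t"
    and \<rho>: "integrable (lebesgue_on {0..T}) \<rho>" "\<And>t. 0 \<le> \<rho> t"
    and lip: "AE s in lebesgue. s \<in> {0..T} \<longrightarrow>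
      nrm (\<lambda>x. superposition U g s (w s) x - superposition U g' s (v s) x) \<le> l s * nrm (\<lambda>x. w s x - v s x) + \<rho> s"
    and M: "\<And>s. s \<in> {0..T} \<Longrightarrow> nrm (\<lambda>x. w s x - v s x) \<le> M * weight l s" "0 \<le> M"
    and t: "t \<in> {0..T}"
    and J: "has_X_integral \<kappa> U {0..t} (\<lambda>\<tau>. PS (t - \<tau>) (superposition U g \<tau> (w \<tau>))) J"
    and J': "has_X_integral \<kappa> U {0..t} (\<lambda>\<tau>. PS (t - \<tau>) (superposition U g' \<tau> (v \<tau>))) J'"
  shows "nrm (\<lambda>x. J x - J' x) \<le> real CARD('n) * (\<integral>s. \<rho> s \<partial>lebesgue_on {0..T}) + M / 2 * weight l t"
proof -
  let ?N = "real CARD('n)"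
  have l': "integrable (lebesgue_on {0..T}) (\<lambda>s. ?N * l s)" "\<And>t. 0 \<le> ?N * l t"
    using l by auto
  note W = integral_exp_weight [OF l', where c = 2 and t = t, folded weight_def]
  have W1: "integrable (lebesgue_on {0..t}) (\<lambda>s. ?N * l s * weight l s)"
    and W2: "(\<integral>s. ?N * l s * weight l s \<partial>lebesgue_on {0..t}) = (weight l t - 1) / 2"
    using W t by auto
  have \<rho>t: "integrable (lebesgue_on {0..t}) \<rho>"
    by (rule integrable_subinterval [OF \<rho>(1)]) (use t in auto)
  define b where "b = (\<lambda>s. M * (?N * l s * weight l s) + ?N * \<rho> s)"
  have int_b: "integrable (lebesgue_on {0..t}) b"
    unfolding b_def by (intro Bochner_Integration.integrable_add integrable_mult_right W1 \<rho>t)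
  have "nrm (\<lambda>x. J x - J' x) \<le> (\<integral>s. b s \<partial>lebesgue_on {0..t})"
  proof (rule has_X_integral_diff_bound [OF _ J J' int_b])
    show "AE s in lebesgue. s \<in> {0..t} \<longrightarrow>
      nrm (\<lambda>x. PS (t - s) (superposition U g s (w s)) x - PS (t - s) (superposition U g' s (v s)) x) \<le> b s"
      using superposition_AE_in [OF g dir w] superposition_AE_in [OF g' dir' v] lip
    proof eventually_elim
      case (elim s)
      show ?case
      proof
        assume s: "s \<in> {0..t}"
        then have sT: "s \<in> {0..T}" using t by auto
        have "nrm (\<lambda>x. PS (t - s) (superposition U g s (w s)) x - PS (t - s) (superposition U g' s (v s)) x)
            \<le> ?N * nrm (\<lambda>x. superposition U g s (w s) x - superposition U g' s (v s) x)"
          using s sT elim by (intro PS_diff_bound) auto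
        also have "\<dots> \<le> ?N * (l s * (M * weight l s) + \<rho> s)"
        proof (rule mult_left_mono)
          show "nrm (\<lambda>x. superposition U g s (w s) x - superposition U g' s (v s) x) \<le> l s * (M * weight l s) + \<rho> s"
            using elim(3) sT mult_left_mono [OF M(1) [OF sT] l(2) [of s]] by auto
        qed simp
        also have "\<dots> = b s" by (simp add: b_def algebra_simps)
        finally show "nrm (\<lambda>x. PS (t - s) (superposition U g s (w s)) x - PS (t - s) (superposition U g' s (v s)) x) \<le> b s" .
      qed
    qed
  qed auto
  also have "\<dots> = M * ((weight l t - 1) / 2) + ?N * (\<integral>s. \<rho> s \<partial>lebesgue_on {0..t})"
    unfolding b_def W2 [symmetric] using W1 \<rho>t by simp
  also have "\<dots> \<le> M * (weight l t / 2) + ?N * (\<integral>s. \<rho> s \<partial>lebesgue_on {0..T})"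
  proof (intro add_mono mult_left_mono)
    show "(\<integral>s. \<rho> s \<partial>lebesgue_on {0..t}) \<le> (\<integral>s. \<rho> s \<partial>lebesgue_on {0..T})"
      using \<rho> t by (intro integral_mono_lebesgue_on_AE AE_I2) auto
  qed (use M in auto)
  finally show ?thesis by simp
qed

text \<open>Completeness of the space of paths, with a geometric rate so that the limit can be
  compared with every iterate.\<close>

lemma path_limit:
  assumes w: "\<And>k. path_in_X T (w k)"
    and le: "\<And>k t. t \<in> {0..T} \<Longrightarrow> nrm (\<lambda>x. w (Suc k) t x - w k t x) \<le> C / 2 ^ k"
  obtains v where "path_in_X T v" "\<And>k t. t \<in> {0..T} \<Longrightarrow> nrm (\<lambda>x. v t x - w k t x) \<le> 2 * C / 2 ^ k"
proof -
  have wX: "w k t \<in> X" if "t \<in> {0..T}" for k t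
    using path_in_X_in [OF w that] .
  \<comment> \<open>Subtracting the remaining tail \<open>2 * C / 2 ^ (k + n)\<close> makes the
    geometric bound close under induction.\<close>
  have tail: "norm1 (w (k + n) t x - w k t x) \<le> 2 * C / 2 ^ k - 2 * C / 2 ^ (k + n)" if t: "t \<in> {0..T}" for k n t x
  proof (induction n)
    case (Suc n)
    have "norm1 (w (Suc (k + n)) t x - w (k + n) t x) \<le> C / 2 ^ (k + n)"
      using norm1_le_nrm' [OF cspace_diff [OF wX wX], OF t t] le [OF t] by (rule order_trans)
    then show ?case
      using Suc norm1_diff_triangle [of "w (k + Suc n) t x" "w k t x" "w (k + n) t x"] by simp
  qed simp
  have C: "0 \<le> C" if "t \<in> {0..T}" for t
    using le [OF that, of 0] nrm_nonneg [OF cspace_diff [OF wX wX], OF that that, of 1 0] by simp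
  have lim0: "(\<lambda>k. 2 * C / 2 ^ k) \<longlonglongrightarrow> 0"
    by (rule LIMSEQ_divide_realpow_zero) simp
  have conv: "convergent (\<lambda>k. w k t x)" if t: "t \<in> {0..T}" for t x
  proof (rule Cauchy_convergent, rule CauchyI')
    fix e :: real assume "0 < e"
    then obtain k0 where k0: "\<And>k. k \<ge> k0 \<Longrightarrow> 2 * C / 2 ^ k < e"
      using order_tendstoD(2) [OF lim0] by (auto simp: eventually_sequentially)
    have "norm (w m t x - w n t x) < e" if "m \<ge> k0" "n > m" for m n
    proof -
      have "norm (w m t x - w n t x) \<le> norm1 (w (m + (n - m)) t x - w m t x)"
        using norm_le_norm1 [of "w n t x - w m t x"] that by (simp add: norm_minus_commute)
      also have "\<dots> \<le> 2 * C / 2 ^ m"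
        using tail [OF t, of m "n - m" x] C [OF t] by (smt (verit) divide_nonneg_nonneg zero_le_power)
      finally show ?thesis using k0 [OF that(1)] by simp
    qed
    then show "\<exists>M. \<forall>m\<ge>M. \<forall>n>m. dist (w m t x) (w n t x) < e"
      unfolding dist_norm by blast
  qed
  define v where "v = (\<lambda>t x. lim (\<lambda>k. w k t x))"
  have v_lim: "(\<lambda>k. w k t x) \<longlonglongrightarrow> v t x" if "t \<in> {0..T}" for t x
    using conv [OF that] by (simp add: v_def convergent_LIMSEQ_iff)
  have norm1_le: "norm1 (v t x - w k t x) \<le> 2 * C / 2 ^ k" if t: "t \<in> {0..T}" for t x k
  proof (rule LIMSEQ_le_const2)
    have "(\<lambda>n. w (n + k) t x) \<longlonglongrightarrow> v t x"
      by (rule LIMSEQ_ignore_initial_segment [OF v_lim [OF t]])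
    then show "(\<lambda>n. norm1 (w (n + k) t x - w k t x)) \<longlonglongrightarrow> norm1 (v t x - w k t x)"
      unfolding norm1_def by (intro tendsto_intros)
    have "norm1 (w (n + k) t x - w k t x) \<le> 2 * C / 2 ^ k" for n
      using tail [OF t, of k n x] C [OF t]
      by (smt (verit) add.commute divide_nonneg_nonneg zero_le_power)
    then show "\<exists>N. \<forall>n\<ge>N. norm1 (w (n + k) t x - w k t x) \<le> 2 * C / 2 ^ k" by blast
  qed
  have vX: "v t \<in> X" if t: "t \<in> {0..T}" for t
  proof (rule cspace_uniform_limit)
    fix x assume "x \<notin> closure U"
    then have "w k t x = 0" for k using cspace_outside [OF wX [OF t]] by blast
    then show "v t x = 0" using v_lim [OF t, of x] by (simp add: LIMSEQ_const_iff)
  next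
    fix e :: real assume "0 < e"
    then obtain k where "2 * C / 2 ^ k < e"
      using order_tendstoD(2) [OF lim0] by (auto simp: eventually_sequentially)
    then show "\<exists>u\<in>X. \<forall>x\<in>closure U. norm1 (u x - v t x) \<le> e"
      using norm1_le [OF t, of _ k] norm1_minus_commute [of "v t _"]
      by (intro bexI [of _ "w k t"] wX t ballI) (metis less_imp_le order_trans)
  qed
  have nrm_le: "nrm (\<lambda>x. v t x - w k t x) \<le> 2 * C / 2 ^ k" if "t \<in> {0..T}" for t k
    by (rule nrm_leI [OF norm1_le [OF that]])
  have "path_in_X T v"
    unfolding path_in_X_def
  proof (intro conjI ballI vX)
    fix t assume t: "t \<in> {0..T}"
    show "((\<lambda>s. nrm (\<lambda>x. v s x - v t x)) \<longlongrightarrow> 0) (at t within {0..T})"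
    proof (rule tendstoI)
      fix e :: real assume "0 < e"
      then have "0 < e / 3" by simp
      obtain k where k: "2 * C / 2 ^ k < e / 3"
        using eventually_happens' [OF sequentially_bot order_tendstoD(2) [OF lim0 \<open>0 < e / 3\<close>]] by blast
      have "((\<lambda>s. nrm (\<lambda>x. w k s x - w k t x)) \<longlongrightarrow> 0) (at t within {0..T})"
        using w [of k] t by (simp add: path_in_X_def)
      then have "\<forall>\<^sub>F s in at t within {0..T}. nrm (\<lambda>x. w k s x - w k t x) < e / 3"
        using \<open>0 < e / 3\<close> by (rule order_tendstoD)
      moreover have "\<forall>\<^sub>F s in at t within {0..T}. s \<in> {0..T}"
        by (simp add: eventually_at_filter)
      ultimately show "\<forall>\<^sub>F s in at t within {0..T}. dist (nrm (\<lambda>x. v s x - v t x)) 0 < e"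
      proof eventually_elim
        case (elim s)
        have "nrm (\<lambda>x. v s x - v t x) \<le> nrm (\<lambda>x. v s x - w k s x) + nrm (\<lambda>x. w k s x - w k t x)
            + nrm (\<lambda>x. w k t x - v t x)"
          using nrm_triangle [OF vX wX vX, OF elim(2,2) t, of k]
            nrm_triangle [OF wX wX vX, OF elim(2) t t, of k k] by linarith
        then have "nrm (\<lambda>x. v s x - v t x) < e"
          using nrm_le [OF elim(2), of k] nrm_le [OF t, of k] nrm_minus_commute [of "w k t" "v t"] elim(1) k
          by linarith
        moreover have "0 \<le> nrm (\<lambda>x. v s x - v t x)"
          by (intro nrm_nonneg cspace_diff vX elim(2) t)
        ultimately show ?case by simp
      qed
    qed
  qed
  then show thesis using nrm_le by (rule that)
qed

lemma mild_solution_path: "mild_solution \<kappa> U S g z T u \<longleftrightarrow> path_in_X T u \<and>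
    (\<forall>t\<in>{0..T}. \<exists>J. has_X_integral \<kappa> U {0..t} (\<lambda>s. PS (t - s) (superposition U g s (u s))) J \<and>
      u t = (\<lambda>x. PS t z x + J x))"
  unfolding mild_solution_def path_in_X_def by blast

lemma superposition_lipschitz:
  assumes l: "is_l_bound U g K l"
    and w: "\<And>s x. \<lbrakk>s \<in> I; x \<in> closure U\<rbrakk> \<Longrightarrow> w s x \<in> K" and v: "\<And>s x. \<lbrakk>s \<in> I; x \<in> closure U\<rbrakk> \<Longrightarrow> v s x \<in> K"
    and X: "\<And>s. s \<in> I \<Longrightarrow> w s \<in> X" "\<And>s. s \<in> I \<Longrightarrow> v s \<in> X"
  shows "AE s in lebesgue. s \<in> I \<longrightarrow>
    nrm (\<lambda>x. superposition U g s (w s) x - superposition U g s (v s) x) \<le> l s * nrm (\<lambda>x. w s x - v s x)"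
proof -
  have l0: "\<And>s. 0 \<le> l s" using l by (simp add: is_l_bound_def)
  have "AE s in lebesgue. \<forall>x\<in>closure U. \<forall>y1\<in>K. \<forall>y2\<in>K.
      norm1 (g s x y1 - g s x y2) \<le> l s * norm1 (y1 - y2)"
    using l by (simp add: is_l_bound_def)
  then show ?thesis
  proof eventually_elim
    case (elim s)
    show ?case
    proof
      assume s: "s \<in> I"
      show "nrm (\<lambda>x. superposition U g s (w s) x - superposition U g s (v s) x) \<le> l s * nrm (\<lambda>x. w s x - v s x)"
      proof (rule nrm_leI)
        fix x assume x: "x \<in> closure U"
        have "norm1 (g s x (w s x) - g s x (v s x)) \<le> l s * norm1 (w s x - v s x)"
          using elim x w [OF s x] v [OF s x] by blast
        also have "\<dots> \<le> l s * nrm (\<lambda>x. w s x - v s x)"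
          by (intro mult_left_mono norm1_le_nrm [of "\<lambda>x. _ x - _ x"] cspace_diff X s x l0)
        finally show "norm1 (superposition U g s (w s) x - superposition U g s (v s) x) \<le> l s * nrm (\<lambda>x. w s x - v s x)"
          using x by (simp add: superposition_def)
      qed
    qed
  qed
qed

text \<open>In the weighted norm the integral operator contracts on all of \<open>{0..T}\<close>,
  whatever its length, so the interval is not subdivided. The m-bound for all \<open>y\<close>
  allows the convolution to be formed for every iterate.\<close>

lemma global_mild_solution:
  assumes g: "g \<in> SC U" and dir: "\<kappa> = 0 \<longrightarrow> (\<forall>t. \<forall>x\<in>frontier U. g t x 0 = 0)"
    and l: "is_l_bound U g UNIV l" and m: "is_m_bound U g UNIV m"
    and z: "z \<in> X"
  shows "\<exists>u. mild_solution \<kappa> U S g z T u"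
proof -
  have l': "integrable (lebesgue_on {0..T}) l" "\<And>t. 0 \<le> l t"
    using l by (auto simp: is_l_bound_def L1_loc_def set_integrable_lebesgue_on)
  have m': "integrable (lebesgue_on {0..T}) m"
    using m by (auto simp: is_m_bound_def L1_loc_def set_integrable_lebesgue_on)
  have m_le: "AE \<tau> in lebesgue. \<tau> \<in> {0..T} \<longrightarrow> nrm (superposition U g \<tau> (w \<tau>)) \<le> m \<tau>" for w
  proof -
    have "AE \<tau> in lebesgue. \<forall>x\<in>closure U. \<forall>y\<in>UNIV. norm1 (g \<tau> x y) \<le> m \<tau>"
      using m by (simp add: is_m_bound_def)
    then show ?thesis
      by eventually_elim (auto simp: superposition_def intro!: nrm_leI)
  qed
  \<comment> \<open>A relation instead of a map: the integral is given only by its defining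
    property, and the iterates are selected by choice.\<close>
  define step where "step = (\<lambda>w w'. path_in_X T w' \<and> (\<forall>t\<in>{0..T}. \<exists>J.
    has_X_integral \<kappa> U {0..t} (\<lambda>\<tau>. PS (t - \<tau>) (superposition U g \<tau> (w \<tau>))) J \<and> w' t = (\<lambda>x. PS t z x + J x)))"
  have step_ex: "\<exists>w'. step w w'" if w: "path_in_X T w" for w
  proof -
    obtain J where J: "path_in_X T J"
      "\<And>t. t \<in> {0..T} \<Longrightarrow> has_X_integral \<kappa> U {0..t} (\<lambda>\<tau>. PS (t - \<tau>) (superposition U g \<tau> (w \<tau>))) (J t)"
      using convolution_superposition [OF g dir w m' m_le] by blast
    have "step w (\<lambda>t x. PS t z x + J t x)"
      unfolding step_def using path_in_X_add [OF path_in_X_PS [OF z] J(1)] J(2) by blast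
    then show ?thesis by blast
  qed
  have contract: "nrm (\<lambda>x. w' t x - v' t x) \<le> M / 2 * weight l t"
    if paths: "path_in_X T w" "path_in_X T v" and st: "step w w'" "step v v'"
      and M: "\<And>s. s \<in> {0..T} \<Longrightarrow> nrm (\<lambda>x. w s x - v s x) \<le> M * weight l s" "0 \<le> M"
      and t: "t \<in> {0..T}" for w v w' v' M t
  proof -
    obtain J J' where J: "has_X_integral \<kappa> U {0..t} (\<lambda>\<tau>. PS (t - \<tau>) (superposition U g \<tau> (w \<tau>))) J"
        "w' t = (\<lambda>x. PS t z x + J x)"
      and J': "has_X_integral \<kappa> U {0..t} (\<lambda>\<tau>. PS (t - \<tau>) (superposition U g \<tau> (v \<tau>))) J'"
        "v' t = (\<lambda>x. PS t z x + J' x)"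
      using st t unfolding step_def by blast
    note X = path_in_X_in [OF paths(1)] path_in_X_in [OF paths(2)]
    have X': "\<forall>s\<in>{0..T}. w s \<in> X" "\<forall>s\<in>{0..T}. v s \<in> X" using X by auto
    have lip: "AE s in lebesgue. s \<in> {0..T} \<longrightarrow>
      nrm (\<lambda>x. superposition U g s (w s) x - superposition U g s (v s) x) \<le> l s * nrm (\<lambda>x. w s x - v s x) + 0"
      using superposition_lipschitz [OF l, of "{0..T}" w v] X by simp
    have "nrm (\<lambda>x. J x - J' x) \<le> real CARD('n) * (\<integral>s. 0 \<partial>lebesgue_on {0..T}) + M / 2 * weight l t"
      by (rule convolution_estimate [OF g dir g dir X' l' _ _ lip M t J(1) J'(1)]) auto
    then show ?thesis using J(2) J'(2) by simp
  qed
  define w where "w = rec_nat (\<lambda>t x. 0) (\<lambda>_ w. SOME w'. step w w')"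
  have w0: "w 0 = (\<lambda>t x. 0)" by (simp add: w_def)
  have path0: "path_in_X T (\<lambda>t x. 0)"
    by (simp add: path_in_X_def cspace_zero)
  have path_w: "path_in_X T (w k)" for k
  proof (induction k)
    case (Suc k)
    then show ?case
      using someI_ex [OF step_ex [OF Suc]] by (simp add: w_def step_def)
  qed (simp add: w0 path0)
  have step_w: "step (w k) (w (Suc k))" for k
    using someI_ex [OF step_ex [OF path_w [of k]]] by (simp add: w_def)
  obtain R where R: "\<And>t. t \<in> {0..T} \<Longrightarrow> nrm (w 1 t) \<le> R"
    using path_in_X_bounded [OF path_w] by blast
  define M where "M = max 0 R"
  have M0: "0 \<le> M" by (simp add: M_def)
  have diff: "nrm (\<lambda>x. w (Suc k) t x - w k t x) \<le> M / 2 ^ k * weight l t" if "t \<in> {0..T}" for k t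
    using that
  proof (induction k arbitrary: t)
    case 0
    have "nrm (w 1 t) \<le> M * 1" using R [OF 0] by (simp add: M_def)
    also have "\<dots> \<le> M * weight l t"
      by (intro mult_left_mono one_le_weight l' M0)
    finally show ?case by (simp add: w0)
  next
    case (Suc k)
    have "nrm (\<lambda>x. w (Suc (Suc k)) t x - w (Suc k) t x) \<le> M / 2 ^ k / 2 * weight l t"
      by (rule contract [OF path_w path_w step_w step_w]) (use Suc M0 in auto)
    then show ?case by (simp add: field_simps)
  qed
  \<comment> \<open>\<open>W\<close> bounds the weight on \<open>{0..T}\<close> and turns weighted
    estimates into plain ones.\<close>
  define W where "W = exp (2 * real CARD('n) * (\<integral>s. l s \<partial>lebesgue_on {0..T}))"
  have le: "nrm (\<lambda>x. w (Suc k) t x - w k t x) \<le> M * W / 2 ^ k" if t: "t \<in> {0..T}" for k t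
  proof -
    have "M / 2 ^ k * weight l t \<le> M / 2 ^ k * W"
      unfolding W_def using M0 by (intro mult_left_mono weight_le l' t) auto
    then show ?thesis using diff [OF t, of k] by simp
  qed
  obtain u where u: "path_in_X T u"
    "\<And>k t. t \<in> {0..T} \<Longrightarrow> nrm (\<lambda>x. u t x - w k t x) \<le> 2 * (M * W) / 2 ^ k"
    by (rule path_limit [of T w "M * W", OF path_w le]) (assumption, rule that)
  \<comment> \<open>The limit is a solution as soon as one further step \<open>u'\<close> from
    \<open>u\<close> agrees with \<open>u\<close>; both are compared with
    \<open>w (Suc k)\<close>.\<close>
  obtain u' where u': "step u u'" using step_ex [OF u(1)] ..
  then have path_u': "path_in_X T u'" by (simp add: step_def)
  have "u' t = u t" if t: "t \<in> {0..T}" for t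
  proof
    fix x
    \<comment> \<open>\<open>M * W * W\<close> arises by halving the weighted distance from
      \<open>u\<close> to \<open>w k\<close>, \<open>M * W\<close> from the distance between
      \<open>w (Suc k)\<close> and \<open>u\<close>.\<close>
    let ?C = "M * W * W + M * W"
    have "norm1 (u' t x - u t x) \<le> ?C / 2 ^ k" for k
    proof -
      have MW: "0 \<le> 2 * (M * W) / 2 ^ k" using M0 by (simp add: W_def)
      have "nrm (\<lambda>x. u s x - w k s x) \<le> 2 * (M * W) / 2 ^ k * weight l s" if s: "s \<in> {0..T}" for s
        using u(2) [OF s, of k] mult_left_mono [OF one_le_weight [of l s] MW] l' by simp
      then have "nrm (\<lambda>x. u' t x - w (Suc k) t x) \<le> 2 * (M * W) / 2 ^ k / 2 * weight l t"
        using contract [OF u(1) path_w u' step_w _ MW t] by blast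
      also have "\<dots> \<le> 2 * (M * W) / 2 ^ k / 2 * W"
        using MW unfolding W_def by (intro mult_left_mono weight_le l' t) auto
      finally have "nrm (\<lambda>x. u' t x - w (Suc k) t x) \<le> M * W * W / 2 ^ k" by simp
      moreover have "nrm (\<lambda>x. w (Suc k) t x - u t x) \<le> M * W / 2 ^ k"
        using u(2) [OF t, of "Suc k"] nrm_minus_commute [of "u t"] by simp
      moreover have "nrm (\<lambda>x. u' t x - u t x) \<le> nrm (\<lambda>x. u' t x - w (Suc k) t x) + nrm (\<lambda>x. w (Suc k) t x - u t x)"
        by (intro nrm_triangle path_in_X_in [OF _ t] path_u' path_w u)
      moreover have "norm1 (u' t x - u t x) \<le> nrm (\<lambda>x. u' t x - u t x)"
        by (intro norm1_le_nrm' [of "\<lambda>x. _ x - _ x"] cspace_diff path_in_X_in [OF _ t] path_u' u)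
      ultimately show ?thesis by (simp add: add_divide_distrib)
    qed
    moreover have "(\<lambda>k. ?C / 2 ^ k) \<longlonglongrightarrow> 0"
      by (rule LIMSEQ_divide_realpow_zero) simp
    ultimately have "norm1 (u' t x - u t x) \<le> 0"
      by (intro LIMSEQ_le_const) auto
    then have "norm (u' t x - u t x) \<le> 0"
      using norm_le_norm1 order_trans by blast
    then show "u' t x = u t x" by simp
  qed
  then have "mild_solution \<kappa> U S g z T u"
    unfolding mild_solution_path using u(1) u' by (auto simp: step_def)
  then show ?thesis by blast
qed

text \<open>Gronwall by absorption: the weighted supremum \<open>M\<close> of the difference
  satisfies \<open>M \<le> ?c + M / 2\<close> and is finite because paths are bounded, whence
  \<open>M \<le> 2 * ?c\<close>. The Lipschitz condition is asked for along the two given paths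
  only.\<close>

lemma mild_solution_stability:
  assumes g: "g \<in> SC U" and dir: "\<kappa> = 0 \<longrightarrow> (\<forall>t. \<forall>x\<in>frontier U. g t x 0 = 0)"
    and g': "g' \<in> SC U" and dir': "\<kappa> = 0 \<longrightarrow> (\<forall>t. \<forall>x\<in>frontier U. g' t x 0 = 0)"
    and z: "z \<in> X" "z' \<in> X"
    and u: "mild_solution \<kappa> U S g z T u" and v: "mild_solution \<kappa> U S g' z' T v"
    and l: "integrable (lebesgue_on {0..T}) l" "\<And>t. 0 \<le> l t"
    and \<rho>: "integrable (lebesgue_on {0..T}) \<rho>" "\<And>t. 0 \<le> \<rho> t"
    and lip: "AE s in lebesgue. s \<in> {0..T} \<longrightarrow>
      nrm (\<lambda>x. superposition U g s (u s) x - superposition U g' s (v s) x) \<le> l s * nrm (\<lambda>x. u s x - v s x) + \<rho> s"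
    and t: "t \<in> {0..T}"
  shows "nrm (\<lambda>x. u t x - v t x) \<le>
    2 * real CARD('n) * (nrm (\<lambda>x. z x - z' x) + (\<integral>s. \<rho> s \<partial>lebesgue_on {0..T})) *
    exp (2 * real CARD('n) * (\<integral>s. l s \<partial>lebesgue_on {0..T}))"
proof -
  let ?N = "real CARD('n)"
  let ?c = "?N * (nrm (\<lambda>x. z x - z' x) + (\<integral>s. \<rho> s \<partial>lebesgue_on {0..T}))"
  have pu: "path_in_X T u" and pv: "path_in_X T v"
    using u v by (auto simp: mild_solution_path)
  note X = path_in_X_in [OF pu] path_in_X_in [OF pv]
  have X': "\<forall>s\<in>{0..T}. u s \<in> X" "\<forall>s\<in>{0..T}. v s \<in> X" using X by auto
  define q where "q = (\<lambda>s. nrm (\<lambda>x. u s x - v s x) / weight l s)"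
  obtain R1 where R1: "\<And>t. t \<in> {0..T} \<Longrightarrow> nrm (u t) \<le> R1" using path_in_X_bounded [OF pu] by blast
  obtain R2 where R2: "\<And>t. t \<in> {0..T} \<Longrightarrow> nrm (v t) \<le> R2" using path_in_X_bounded [OF pv] by blast
  have q_nonneg: "0 \<le> q s" if "s \<in> {0..T}" for s
    unfolding q_def using weight_pos by (intro divide_nonneg_pos nrm_nonneg cspace_diff X that) auto
  have "q s \<le> R1 + R2" if s: "s \<in> {0..T}" for s
  proof -
    have "q s \<le> nrm (\<lambda>x. u s x - v s x) / 1"
      unfolding q_def using one_le_weight [of l s] l
      by (intro divide_left_mono nrm_nonneg cspace_diff X s) auto
    also have "\<dots> \<le> nrm (u s) + nrm (v s)"
      using nrm_triangle [OF X(1) cspace_zero X(2), OF s s] nrm_minus_commute [of "\<lambda>x. 0" "v s"] by simp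
    finally show ?thesis using R1 [OF s] R2 [OF s] by simp
  qed
  then have bdd: "bdd_above (q ` {0..T})" by (rule bdd_aboveI2)
  define M where "M = (SUP s\<in>{0..T}. q s)"
  have q_le: "q s \<le> M" if "s \<in> {0..T}" for s
    unfolding M_def by (rule cSUP_upper [OF that bdd])
  have M0: "0 \<le> M" using q_le [OF t] q_nonneg [OF t] by simp
  have M: "nrm (\<lambda>x. u s x - v s x) \<le> M * weight l s" if "s \<in> {0..T}" for s
    using q_le [OF that] weight_pos [of l s] by (simp add: q_def divide_le_eq)
  have est: "nrm (\<lambda>x. u s x - v s x) \<le> ?c + M / 2 * weight l s" if s: "s \<in> {0..T}" for s
  proof -
    obtain J J' where J: "has_X_integral \<kappa> U {0..s} (\<lambda>\<tau>. PS (s - \<tau>) (superposition U g \<tau> (u \<tau>))) J"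
        "u s = (\<lambda>x. PS s z x + J x)"
      and J': "has_X_integral \<kappa> U {0..s} (\<lambda>\<tau>. PS (s - \<tau>) (superposition U g' \<tau> (v \<tau>))) J'"
        "v s = (\<lambda>x. PS s z' x + J' x)"
      using u v s unfolding mild_solution_path by blast
    have JX: "J \<in> X" "J' \<in> X" using J J' by (auto simp: has_X_integral_def)
    have "nrm (\<lambda>x. J x - J' x) \<le> ?N * (\<integral>s. \<rho> s \<partial>lebesgue_on {0..T}) + M / 2 * weight l s"
      by (rule convolution_estimate [OF g dir g' dir' X' l \<rho> lip M M0 s J(1) J'(1)])
    moreover have "nrm (\<lambda>x. PS s z x - PS s z' x) \<le> ?N * nrm (\<lambda>x. z x - z' x)"
      using s z by (intro PS_diff_bound) auto
    moreover have "nrm (\<lambda>x. (PS s z x - PS s z' x) + (J x - J' x)) \<le>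
        nrm (\<lambda>x. PS s z x - PS s z' x) + nrm (\<lambda>x. J x - J' x)"
      using s z by (intro nrm_add_le cspace_diff PS_in JX) auto
    moreover have "(\<lambda>x. u s x - v s x) = (\<lambda>x. (PS s z x - PS s z' x) + (J x - J' x))"
      using J J' by (simp add: algebra_simps)
    ultimately show ?thesis by (simp add: algebra_simps)
  qed
  have c0: "0 \<le> ?c"
    using z \<rho> by (intro mult_nonneg_nonneg add_nonneg_nonneg nrm_nonneg cspace_diff Bochner_Integration.integral_nonneg) auto
  have "q s \<le> ?c + M / 2" if s: "s \<in> {0..T}" for s
  proof -
    have "q s \<le> (?c + M / 2 * weight l s) / weight l s"
      unfolding q_def by (intro divide_right_mono est s) (simp add: weight_pos less_imp_le)
    also have "\<dots> = ?c / weight l s + M / 2"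
      using weight_pos [of l s] by (simp add: field_simps)
    also have "?c / weight l s \<le> ?c / 1"
      using c0 one_le_weight [of l s] l by (intro divide_left_mono) auto
    finally show ?thesis by simp
  qed
  then have "M \<le> ?c + M / 2"
    unfolding M_def by (intro cSUP_least) (use t in auto)
  then have "M \<le> 2 * ?c" by simp
  then have "M * weight l t \<le> 2 * ?c * exp (2 * ?N * (\<integral>s. l s \<partial>lebesgue_on {0..T}))"
    using M0 weight_pos [of l t] by (intro mult_mono weight_le l t) auto
  then show ?thesis using M [OF t] by (simp add: mult.assoc)
qed

section \<open>Perturbation of the nonlinearity\<close>

lemma mild_solution_restrict:
  assumes "mild_solution \<kappa> U S g z T u" "T' \<le> T"
  shows "mild_solution \<kappa> U S g z T' u"
proof -
  have sub: "{0..T'} \<subseteq> {0..T}" using assms(2) by auto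
  show ?thesis
    using assms(1) sub unfolding mild_solution_def
    by (meson subsetD tendsto_within_subset)
qed

text \<open>A constant \<open>y\<close> is not a member of \<open>X\<close> in the Dirichlet case
  unless it is \<open>0\<close>, so measurability of the norm comes from spatial continuity alone,
  after a correction on a null set.\<close>

lemma integrable_nrm_SC_diff:
  assumes g: "g \<in> SC U" and g': "g' \<in> SC U"
  shows "integrable (lebesgue_on {a..b}) (\<lambda>s. nrm (\<lambda>x. g s x y - g' s x y))"
    and "AE s in lebesgue. continuous_on (closure U) (\<lambda>x. g s x y - g' s x y)"
proof -
  let ?h = "\<lambda>s x. g s x y - g' s x y"
  have "continuous_on (closure U) (\<lambda>x. k s x y)"
    if "continuous_on (closure U \<times> UNIV) (\<lambda>(x, y). k s x y)" for k :: "('m, 'n) cmap" and s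
    using continuous_on_compose2 [OF that continuous_on_Pair [OF continuous_on_id continuous_on_const [of _ y]], of "closure U"]
    by auto
  moreover have "AE s in lebesgue. continuous_on (closure U \<times> UNIV) (\<lambda>(x, y). g s x y)"
    "AE s in lebesgue. continuous_on (closure U \<times> UNIV) (\<lambda>(x, y). g' s x y)"
    using g g' by (simp_all add: SC_def)
  ultimately show cont: "AE s in lebesgue. continuous_on (closure U) (?h s)"
    by (auto elim!: eventually_elim2 intro!: continuous_on_diff)
  define h where "h = (\<lambda>s. if continuous_on (closure U) (?h s) then ?h s else (\<lambda>x. 0))"
  have h_eq: "AE s in lebesgue. s \<in> {a..b} \<longrightarrow> h s = ?h s"
    using cont by eventually_elim (simp add: h_def)
  have "(\<lambda>s. nrm (h s)) \<in> borel_measurable (lebesgue_on {a..b})"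
  proof (rule borel_measurable_nrm_gen)
    show "continuous_on (closure U) (h s)" for s by (simp add: h_def)
    fix x assume x: "x \<in> closure U"
    show "(\<lambda>s. h s x) \<in> borel_measurable (lebesgue_on {a..b})"
    proof (rule borel_measurable_lebesgue_on_AE)
      show "(\<lambda>s. ?h s x) \<in> borel_measurable (lebesgue_on {a..b})"
        by (rule borel_measurable_diff) (rule borel_measurable_SC_at [OF _ x borel_measurable_const], rule assms)+
      show "AE s in lebesgue. s \<in> {a..b} \<longrightarrow> ?h s x = h s x"
        using h_eq by eventually_elim simp
    qed simp
  qed
  note h_meas = this
  have meas: "(\<lambda>s. nrm (?h s)) \<in> borel_measurable (lebesgue_on {a..b})"
  proof (rule borel_measurable_lebesgue_on_AE [OF _ h_meas])
    show "AE s in lebesgue. s \<in> {a..b} \<longrightarrow> nrm (h s) = nrm (?h s)"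
      using h_eq by eventually_elim simp
  qed simp
  obtain m where m: "is_m_bound U g {y} m" using SC_m_bound [OF g, of "{y}"] by auto
  obtain m' where m': "is_m_bound U g' {y} m'" using SC_m_bound [OF g', of "{y}"] by auto
  have "integrable (lebesgue_on {a..b}) m" "integrable (lebesgue_on {a..b}) m'"
    using m m' by (auto simp: is_m_bound_def L1_loc_def set_integrable_lebesgue_on)
  then have int_m: "integrable (lebesgue_on {a..b}) (\<lambda>s. m s + m' s)"
    by (rule Bochner_Integration.integrable_add)
  show "integrable (lebesgue_on {a..b}) (\<lambda>s. nrm (?h s))"
  proof (rule Bochner_Integration.integrable_bound [OF int_m meas])
    have "AE s in lebesgue. \<forall>x\<in>closure U. \<forall>v\<in>{y}. norm1 (g s x v) \<le> m s"
      "AE s in lebesgue. \<forall>x\<in>closure U. \<forall>v\<in>{y}. norm1 (g' s x v) \<le> m' s"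
      using m m' by (simp_all add: is_m_bound_def)
    then have "AE s in lebesgue. norm (nrm (?h s)) \<le> norm (m s + m' s)"
      using cont
    proof eventually_elim
      case (elim s)
      have "nrm (?h s) \<le> m s + m' s"
      proof (rule nrm_leI)
        fix x assume x: "x \<in> closure U"
        have "norm1 (?h s x) \<le> norm1 (g s x y) + norm1 (g' s x y)"
          using norm1_diff_triangle [of "g s x y" "g' s x y" 0] norm1_minus_commute [of 0 "g' s x y"] by simp
        then show "norm1 (?h s x) \<le> m s + m' s" using elim x by force
      qed
      moreover have "0 \<le> nrm (?h s)"
      proof -
        obtain x where "x \<in> closure U" using closure_nonempty by (meson ex_in_conv)
        from norm1_le_sup_norm1 [OF compact_closure_U elim(3) this] show ?thesis
          using norm1_nonneg order_trans by blast
      qed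
      ultimately show ?case by simp
    qed
    then show "AE s in lebesgue_on {a..b}. norm (nrm (?h s)) \<le> norm (m s + m' s)"
      by (auto simp: AE_lebesgue_on_iff elim: eventually_mono)
  qed
qed

text \<open>Both paths are bounded, so an l-bound on one ball serves along both, and stability
  applies with equal initial values and zero error.\<close>

lemma mild_solution_unique:
  assumes f: "f \<in> LC U" and dir: "\<kappa> = 0 \<longrightarrow> (\<forall>t. \<forall>x\<in>frontier U. f t x 0 = 0)"
    and z: "z \<in> X"
    and u: "mild_solution \<kappa> U S f z T u" and v: "mild_solution \<kappa> U S f z T v"
    and t: "t \<in> {0..T}"
  shows "u t = v t"
proof -
  have pu: "path_in_X T u" and pv: "path_in_X T v"
    using u v by (auto simp: mild_solution_path)
  note X = path_in_X_in [OF pu] path_in_X_in [OF pv]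
  obtain R1 where R1: "\<And>t. t \<in> {0..T} \<Longrightarrow> nrm (u t) \<le> R1" using path_in_X_bounded [OF pu] by blast
  obtain R2 where R2: "\<And>t. t \<in> {0..T} \<Longrightarrow> nrm (v t) \<le> R2" using path_in_X_bounded [OF pv] by blast
  let ?K = "{y. norm1 y \<le> max R1 R2}"
  obtain l where l: "is_l_bound U f ?K l"
    using LC_l_bound [OF f compact_norm1_ball] by blast
  have l': "integrable (lebesgue_on {0..T}) l" "\<And>t. 0 \<le> l t"
    using l by (auto simp: is_l_bound_def L1_loc_def set_integrable_lebesgue_on)
  have uK: "u s x \<in> ?K" and vK: "v s x \<in> ?K" if "s \<in> {0..T}" for s x
    using norm1_le_nrm' [OF X(1) [OF that], of x] norm1_le_nrm' [OF X(2) [OF that], of x]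
      R1 [OF that] R2 [OF that] by auto
  have "AE s in lebesgue. s \<in> {0..T} \<longrightarrow>
      nrm (\<lambda>x. superposition U f s (u s) x - superposition U f s (v s) x) \<le> l s * nrm (\<lambda>x. u s x - v s x)"
    by (rule superposition_lipschitz [OF l]) (use uK vK X in auto)
  then have lip: "AE s in lebesgue. s \<in> {0..T} \<longrightarrow>
      nrm (\<lambda>x. superposition U f s (u s) x - superposition U f s (v s) x) \<le> l s * nrm (\<lambda>x. u s x - v s x) + 0"
    by simp
  have fSC: "f \<in> SC U" using f by (simp add: LC_def)
  have "nrm (\<lambda>x. u t x - v t x) \<le>
    2 * real CARD('n) * (nrm (\<lambda>x. z x - z x) + (\<integral>s. 0 \<partial>lebesgue_on {0..T})) *
    exp (2 * real CARD('n) * (\<integral>s. l s \<partial>lebesgue_on {0..T}))"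
    by (rule mild_solution_stability [OF fSC dir fSC dir z z u v l' _ _ lip t]) auto
  then have *: "nrm (\<lambda>x. u t x - v t x) \<le> 0" by simp
  show ?thesis
  proof
    fix x
    have "norm (u t x - v t x) \<le> nrm (\<lambda>x. u t x - v t x)"
      by (intro order_trans [OF norm_le_norm1] norm1_le_nrm' [of "\<lambda>x. _ x - _ x"] cspace_diff X t)
    then have "norm (u t x - v t x) \<le> 0" using * by linarith
    then show "u t x = v t x" by simp
  qed
qed

lemma max_solution_eq:
  assumes f: "f \<in> LC U" and dir: "\<kappa> = 0 \<longrightarrow> (\<forall>t. \<forall>x\<in>frontier U. f t x 0 = 0)"
    and z: "z \<in> X" and T: "0 < T"
    and u: "mild_solution \<kappa> U S f z T u" and t: "t \<in> {0..T}"
  shows "max_solution \<kappa> U S f z t = u t"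
  unfolding max_solution_def
proof (rule the_equality)
  show "\<exists>\<delta> u'. 0 < \<delta> \<and> t \<in> {0..\<delta>} \<and> mild_solution \<kappa> U S f z \<delta> u' \<and> u t = u' t"
    using T u t by blast
  fix v assume "\<exists>\<delta> u'. 0 < \<delta> \<and> t \<in> {0..\<delta>} \<and> mild_solution \<kappa> U S f z \<delta> u' \<and> v = u' t"
  then obtain \<delta> u' where u': "t \<in> {0..\<delta>}" "mild_solution \<kappa> U S f z \<delta> u'" "v = u' t" by blast
  have "u t = u' t"
    \<comment> \<open>Competing solutions may live on different intervals; they are compared on the
      shorter one.\<close>
    by (rule mild_solution_unique [OF f dir z, where T = "min T \<delta>"])
       (use u u' t in \<open>auto intro: mild_solution_restrict\<close>)
  then show "v = u t" using u' by simp
qed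

text \<open>All constants are explicit so that the limit can be taken afterwards. The condition
  \<open>\<eta> \<le> 1\<close> matches the truncation at \<open>R + 1\<close>: a path within
  \<open>1\<close> of \<open>u\<close> is never truncated. The ball of the l-bounds has radius at
  least \<open>CARD('n) * (R + 1)\<close> in order to contain all truncated values.\<close>

lemma perturbed_mild_solution:
  assumes f: "f \<in> LC U" and dir: "\<kappa> = 0 \<longrightarrow> (\<forall>t. \<forall>x\<in>frontier U. f t x 0 = 0)"
    and g: "g \<in> LC U" and dir': "\<kappa> = 0 \<longrightarrow> (\<forall>t. \<forall>x\<in>frontier U. g t x 0 = 0)"
    and z: "z \<in> X" "z' \<in> X"
    and u: "mild_solution \<kappa> U S f z T u"
    and R: "\<And>t. t \<in> {0..T} \<Longrightarrow> nrm (u t) \<le> R" "0 \<le> R" "real CARD('n) * (R + 1) \<le> r"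
    and l: "is_l_bound U f {y. norm1 y \<le> r} l" and l': "is_l_bound U g {y. norm1 y \<le> r} l'"
    and Y: "finite Y" "\<And>y. y \<in> Y \<Longrightarrow> norm1 y \<le> R + 1"
    and net: "\<And>y. norm1 y \<le> R \<Longrightarrow> \<exists>y'\<in>Y. norm1 (y - y') < e" and e: "0 \<le> e"
    and small: "2 * real CARD('n) * (nrm (\<lambda>x. z x - z' x) +
      ((\<Sum>y\<in>Y. \<integral>s. \<bar>nrm (\<lambda>x. g s x y - f s x y)\<bar> \<partial>lebesgue_on {0..T}) +
       e * ((\<integral>s. l s \<partial>lebesgue_on {0..T}) + (\<integral>s. l' s \<partial>lebesgue_on {0..T})))) *
      exp (2 * real CARD('n) * (\<integral>s. l' s \<partial>lebesgue_on {0..T})) \<le> \<eta>" "\<eta> \<le> 1"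
  shows "\<exists>v. mild_solution \<kappa> U S g z' T v \<and> (\<forall>t\<in>{0..T}. nrm (\<lambda>x. u t x - v t x) \<le> \<eta>)"
proof -
  have fSC: "f \<in> SC U" and gSC: "g \<in> SC U" using f g by (simp_all add: LC_def)
  define h where "h = (\<lambda>t x y. g t x (trunc (R + 1) y))"
  have R1: "0 \<le> R + 1" using R(2) by simp
  have trunc0: "trunc (R + 1) 0 = 0" by (rule trunc_eq) (use R1 in simp)
  have hSC: "h \<in> SC U" unfolding h_def by (rule trunc_in_SC [OF gSC R1])
  obtain m where m: "is_m_bound U h UNIV m" unfolding h_def using trunc_in_SC(2) [OF gSC R1] by blast
  have hl: "is_l_bound U h UNIV l'" unfolding h_def by (rule is_l_bound_trunc [OF l' R1 R(3)])
  have hdir: "\<kappa> = 0 \<longrightarrow> (\<forall>t. \<forall>x\<in>frontier U. h t x 0 = 0)" using dir' by (simp add: h_def trunc0)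
  obtain v where v: "mild_solution \<kappa> U S h z' T v"
    using global_mild_solution [OF hSC hdir hl m z(2)] by blast
  have pu: "path_in_X T u" and pv: "path_in_X T v"
    using u v by (auto simp: mild_solution_path)
  note X = path_in_X_in [OF pu] path_in_X_in [OF pv]
  have uR: "norm1 (u s x) \<le> R" if "s \<in> {0..T}" for s x
    using norm1_le_nrm' [OF X(1) [OF that], of x] R(1) [OF that] by linarith
  have int_l: "integrable (lebesgue_on {0..T}) l" "\<And>t. 0 \<le> l t"
    using l by (auto simp: is_l_bound_def L1_loc_def set_integrable_lebesgue_on)
  have int_l': "integrable (lebesgue_on {0..T}) l'" "\<And>t. 0 \<le> l' t"
    using l' by (auto simp: is_l_bound_def L1_loc_def set_integrable_lebesgue_on)
  define \<sigma> where "\<sigma> = (\<lambda>y s. nrm (\<lambda>x. g s x y - f s x y))"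
  \<comment> \<open>The nearest net point depends on \<open>s\<close> and \<open>x\<close>, so the
    error is summed over the whole net. The absolute values guard the null set of times where
    continuity in space fails and the sign of the supremum \<open>\<sigma> y s\<close> is unknown:
    stability asks for \<open>\<rho>\<close> nonnegative at every time.\<close>
  define \<rho> where "\<rho> = (\<lambda>s. (\<Sum>y\<in>Y. \<bar>\<sigma> y s\<bar>) + e * (l s + l' s))"
  have int_\<sigma>: "integrable (lebesgue_on {0..T}) (\<lambda>s. \<bar>\<sigma> y s\<bar>)" for y
    unfolding \<sigma>_def by (intro integrable_abs integrable_nrm_SC_diff gSC fSC)
  have int_\<rho>: "integrable (lebesgue_on {0..T}) \<rho>"
    unfolding \<rho>_def
    by (intro Bochner_Integration.integrable_add Bochner_Integration.integrable_sum int_\<sigma> integrable_mult_right int_l int_l')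
  have \<rho>_nonneg: "0 \<le> \<rho> s" for s
    unfolding \<rho>_def using e int_l int_l' by (intro add_nonneg_nonneg sum_nonneg mult_nonneg_nonneg) auto
  have \<rho>_eq: "(\<integral>s. \<rho> s \<partial>lebesgue_on {0..T}) = (\<Sum>y\<in>Y. \<integral>s. \<bar>\<sigma> y s\<bar> \<partial>lebesgue_on {0..T}) +
      e * ((\<integral>s. l s \<partial>lebesgue_on {0..T}) + (\<integral>s. l' s \<partial>lebesgue_on {0..T}))"
    unfolding \<rho>_def using int_\<sigma> int_l int_l' by simp
  have Rr: "R + 1 \<le> r"
  proof -
    have "1 * (R + 1) \<le> real CARD('n) * (R + 1)"
      using R1 by (intro mult_right_mono) (auto simp: Suc_le_eq)
    then show ?thesis using R(3) by simp
  qed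
  \<comment> \<open>With \<open>y\<close> a net point near \<open>?y\<close>, go from
    \<open>f\<close> at \<open>?y\<close> to \<open>f\<close> at \<open>y\<close>, to
    \<open>g\<close> at \<open>y\<close>, to \<open>g\<close> at \<open>?y\<close>: the outer moves
    cost \<open>l s * e\<close> and \<open>l' s * e\<close>, the middle one is a term of the
    sum.\<close>
  have AE_\<rho>: "AE s in lebesgue. s \<in> {0..T} \<longrightarrow>
      nrm (\<lambda>x. superposition U f s (u s) x - superposition U h s (u s) x) \<le> \<rho> s"
  proof -
    have "AE s in lebesgue. \<forall>x\<in>closure U. \<forall>y1\<in>{y. norm1 y \<le> r}. \<forall>y2\<in>{y. norm1 y \<le> r}.
        norm1 (f s x y1 - f s x y2) \<le> l s * norm1 (y1 - y2)"
      using l by (simp add: is_l_bound_def)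
    moreover have "AE s in lebesgue. \<forall>x\<in>closure U. \<forall>y1\<in>{y. norm1 y \<le> r}. \<forall>y2\<in>{y. norm1 y \<le> r}.
        norm1 (g s x y1 - g s x y2) \<le> l' s * norm1 (y1 - y2)"
      using l' by (simp add: is_l_bound_def)
    moreover have "AE s in lebesgue. \<forall>y\<in>Y. continuous_on (closure U) (\<lambda>x. g s x y - f s x y)"
      using integrable_nrm_SC_diff(2) [OF gSC fSC] Y(1) by (intro AE_finite_allI)
    ultimately show ?thesis
    proof eventually_elim
      case (elim s)
      show ?case
      proof
        assume s: "s \<in> {0..T}"
        show "nrm (\<lambda>x. superposition U f s (u s) x - superposition U h s (u s) x) \<le> \<rho> s"
        proof (rule nrm_leI)
          fix x assume x: "x \<in> closure U"
          let ?y = "u s x"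
          obtain y where y: "y \<in> Y" "norm1 (?y - y) < e" using net [OF uR [OF s]] by blast
          have h_eq: "h s x ?y = g s x ?y"
            unfolding h_def using uR [OF s, of x] by (subst trunc_eq) auto
          have balls: "?y \<in> {y. norm1 y \<le> r}" "y \<in> {y. norm1 y \<le> r}"
            using uR [OF s, of x] Y(2) [OF y(1)] Rr by auto
          have "norm1 (f s x ?y - f s x y) \<le> l s * norm1 (?y - y)"
            using elim(1) x balls by blast
          also have "\<dots> \<le> l s * e" using y(2) int_l(2) by (intro mult_left_mono) auto
          finally have 1: "norm1 (f s x ?y - f s x y) \<le> l s * e" .
          have "norm1 (g s x y - g s x ?y) \<le> l' s * norm1 (y - ?y)"
            using elim(2) x balls by blast
          also have "\<dots> \<le> l' s * e"
            using y(2) int_l'(2) norm1_minus_commute [of y ?y] by (intro mult_left_mono) auto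
          finally have 2: "norm1 (g s x y - g s x ?y) \<le> l' s * e" .
          have "norm1 (g s x y - f s x y) \<le> \<sigma> y s"
            unfolding \<sigma>_def using elim(3) y(1) x
            by (intro norm1_le_sup_norm1 [where z = "\<lambda>x. g s x y - f s x y"] compact_closure_U) auto
          also have "\<dots> \<le> (\<Sum>y\<in>Y. \<bar>\<sigma> y s\<bar>)"
            using member_le_sum [OF y(1), of "\<lambda>y. \<bar>\<sigma> y s\<bar>"] Y(1) by fastforce
          finally have 3: "norm1 (f s x y - g s x y) \<le> (\<Sum>y\<in>Y. \<bar>\<sigma> y s\<bar>)"
            by (simp add: norm1_minus_commute)
          have "norm1 (f s x ?y - g s x ?y) \<le> \<rho> s"
            using norm1_diff_triangle [of "f s x ?y" "g s x ?y" "f s x y"]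
              norm1_diff_triangle [of "f s x y" "g s x ?y" "g s x y"] 1 2 3
            by (simp add: \<rho>_def algebra_simps)
          then show "norm1 (superposition U f s (u s) x - superposition U h s (u s) x) \<le> \<rho> s"
            using x by (simp add: superposition_def h_eq)
        qed
      qed
    qed
  qed
  have AE_lip: "AE s in lebesgue. s \<in> {0..T} \<longrightarrow>
      nrm (\<lambda>x. superposition U h s (u s) x - superposition U h s (v s) x) \<le> l' s * nrm (\<lambda>x. u s x - v s x)"
    by (rule superposition_lipschitz [OF hl]) (use X in auto)
  have uX: "\<forall>s\<in>{0..T}. u s \<in> X" and vX: "\<forall>s\<in>{0..T}. v s \<in> X" using X by auto
  have lip: "AE s in lebesgue. s \<in> {0..T} \<longrightarrow>
      nrm (\<lambda>x. superposition U f s (u s) x - superposition U h s (v s) x) \<le> l' s * nrm (\<lambda>x. u s x - v s x) + \<rho> s"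
    using AE_\<rho> AE_lip superposition_AE_in [OF fSC dir uX] superposition_AE_in [OF hSC hdir uX]
      superposition_AE_in [OF hSC hdir vX]
  proof eventually_elim
    case (elim s)
    then show ?case
      using nrm_triangle [of "superposition U f s (u s)" "superposition U h s (u s)" "superposition U h s (v s)"]
      by force
  qed
  have le: "nrm (\<lambda>x. u t x - v t x) \<le> \<eta>" if t: "t \<in> {0..T}" for t
  proof -
    have "nrm (\<lambda>x. u t x - v t x) \<le>
      2 * real CARD('n) * (nrm (\<lambda>x. z x - z' x) + (\<integral>s. \<rho> s \<partial>lebesgue_on {0..T})) *
      exp (2 * real CARD('n) * (\<integral>s. l' s \<partial>lebesgue_on {0..T}))"
      by (rule mild_solution_stability [OF fSC dir hSC hdir z u v int_l' int_\<rho> \<rho>_nonneg lip t])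
    then show ?thesis using small(1) unfolding \<rho>_eq \<sigma>_def by linarith
  qed
  \<comment> \<open>As \<open>v\<close> stays within \<open>1\<close> of \<open>u\<close>, it
    remains in the region where \<open>h\<close> and \<open>g\<close> agree.\<close>
  have h_v: "superposition U h s (v s) = superposition U g s (v s)" if s: "s \<in> {0..T}" for s
  proof -
    have "norm1 (v s x) \<le> R + 1" for x
    proof -
      have "norm1 (u s x - v s x) \<le> nrm (\<lambda>x. u s x - v s x)"
        by (intro norm1_le_nrm' [of "\<lambda>x. _ x - _ x"] cspace_diff X s)
      then show ?thesis
        using le [OF s] small(2) uR [OF s, of x] norm1_le_add_diff [of "v s x" "u s x"]
          norm1_minus_commute [of "v s x" "u s x"] by linarith
    qed
    then show ?thesis by (auto simp: superposition_def h_def trunc_eq)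
  qed
  have "mild_solution \<kappa> U S g z' T v"
    unfolding mild_solution_path
  proof (intro conjI ballI pv)
    fix t assume t: "t \<in> {0..T}"
    obtain J where J: "has_X_integral \<kappa> U {0..t} (\<lambda>s. PS (t - s) (superposition U h s (v s))) J"
        "v t = (\<lambda>x. PS t z' x + J x)"
      using v t unfolding mild_solution_path by blast
    have "has_X_integral \<kappa> U {0..t} (\<lambda>s. PS (t - s) (superposition U g s (v s))) J"
      by (rule has_X_integral_cong_AE [OF J(1)]) (use h_v t in \<open>auto intro!: always_eventually\<close>)
    then show "\<exists>J. has_X_integral \<kappa> U {0..t} (\<lambda>s. PS (t - s) (superposition U g s (v s))) J \<and>
        v t = (\<lambda>x. PS t z' x + J x)"
      using J(2) by blast
  qed
  then show ?thesis using le by blast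
qed

text \<open>The seminorms have rational endpoints while \<open>T\<close> is real. Enlarging the
  interval does not shrink the integral, as the integrand is nonnegative almost everywhere.\<close>

lemma TD_seminorm_bound:
  assumes g: "g \<in> SC U" and f: "f \<in> SC U" and q: "T \<le> q"
  shows "(\<integral>s. \<bar>nrm (\<lambda>x. g s x y - f s x y)\<bar> \<partial>lebesgue_on {0..T}) \<le>
    TD_seminorm U 0 q y (\<lambda>t x v. g t x v - f t x v)"
proof -
  let ?\<sigma> = "\<lambda>s. nrm (\<lambda>x. g s x y - f s x y)"
  have nonneg: "AE s in lebesgue. 0 \<le> ?\<sigma> s"
    using integrable_nrm_SC_diff(2) [OF g f, of y]
  proof eventually_elim
    case (elim s)
    obtain x where "x \<in> closure U" using closure_nonempty by (meson ex_in_conv)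
    from norm1_le_sup_norm1 [OF compact_closure_U elim this] show ?case
      using norm1_nonneg order_trans by blast
  qed
  have int: "integrable (lebesgue_on {0..q}) ?\<sigma>"
    by (rule integrable_nrm_SC_diff [OF g f])
  have "AE s in lebesgue_on {0..T}. \<bar>?\<sigma> s\<bar> \<le> ?\<sigma> s"
    using nonneg by (auto simp: AE_lebesgue_on_iff elim: eventually_mono)
  moreover have "AE s in lebesgue_on {0..q}. 0 \<le> ?\<sigma> s"
    using nonneg by (auto simp: AE_lebesgue_on_iff elim: eventually_mono)
  ultimately have "(\<integral>s. \<bar>?\<sigma> s\<bar> \<partial>lebesgue_on {0..T}) \<le> (\<integral>s. ?\<sigma> s \<partial>lebesgue_on {0..q})"
    using q by (intro integral_mono_lebesgue_on_AE [OF int]) auto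
  then show ?thesis by (simp add: TD_seminorm_def set_integrable_lebesgue_on)
qed

lemma TD_convergence:
  assumes conv: "limitin (subtopology (TD_topology U D) (LC U)) fs f sequentially"
    and f: "f \<in> LC U" and y: "y \<in> D" and e: "0 < e"
  shows "\<forall>\<^sub>F n in sequentially.
    (\<integral>s. \<bar>nrm (\<lambda>x. fs n s x y - f s x y)\<bar> \<partial>lebesgue_on {0..T}) < e"
proof -
  have fSC: "f \<in> SC U" using f by (simp add: LC_def)
  \<comment> \<open>A natural number serves as the rational right endpoint; \<open>max T 0\<close>
    makes it positive as well.\<close>
  obtain k :: nat where k: "max T 0 < real k" using reals_Archimedean2 by blast
  let ?q = "real k"
  let ?B = "{g \<in> SC U. TD_seminorm U 0 ?q y (\<lambda>t x v. g t x v - f t x v) < e}"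
  have "openin (TD_topology U D) ?B"
    unfolding TD_topology_def
  proof (rule topology_generated_by_Basis, rule CollectI)
    have "(0::real) \<in> \<rat>" "?q \<in> \<rat>" "0 < ?q" using k by auto
    then show "\<exists>f\<in>SC U. \<exists>y\<in>D. \<exists>q1\<in>\<rat>. \<exists>q2\<in>\<rat>. \<exists>e>0. q1 < q2 \<and>
        ?B = {g \<in> SC U. TD_seminorm U q1 q2 y (\<lambda>t x v. g t x v - f t x v) < e}"
      using fSC y e by blast
  qed
  then have "openin (subtopology (TD_topology U D) (LC U)) (?B \<inter> LC U)"
    by (rule openin_subtopology_Int)
  moreover have "f \<in> ?B \<inter> LC U"
    using f fSC e nrm_zero by (simp add: TD_seminorm_def)
  ultimately have "\<forall>\<^sub>F n in sequentially. fs n \<in> ?B \<inter> LC U"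
    using conv by (auto simp: limitin_def)
  then show ?thesis
  proof eventually_elim
    case (elim n)
    then show ?case
      using TD_seminorm_bound [of "fs n" f T ?q y] fSC k by auto
  qed
qed

end

theorem theorem4p11:
  fixes U :: "(real^'m) set"
    and \<kappa> :: real
    and \<alpha> :: "'n::finite \<Rightarrow> real^'m \<Rightarrow> real"
    and S :: "'n::finite \<Rightarrow> real \<Rightarrow> (real^'m \<Rightarrow> real) \<Rightarrow> (real^'m \<Rightarrow> real)"
    and E :: "('m::finite, 'n::finite) cmap set"
    and D :: "(real^'n) set"
    and fs :: "nat \<Rightarrow> ('m::finite, 'n::finite) cmap"
    and f :: "('m::finite, 'n::finite) cmap"
    and zs :: "nat \<Rightarrow> real^'m \<Rightarrow> real^'n"
    and z :: "real^'m \<Rightarrow> real^'n"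
    and T :: real
  assumes domain: "U \<noteq> {}" "bounded U" "open U" "connected U" "C1_boundary U"
    and bc: "boundary_condition \<kappa> \<alpha> U"
    and semigroup: "\<And>i. diffusion_semigroup \<kappa> (\<alpha> i) U (S i)"
    and dirichlet: "\<kappa> = 0 \<Longrightarrow> \<forall>g\<in>insert f E. \<forall>t. \<forall>x\<in>frontier U. g t x 0 = 0"
    and E: "E \<subseteq> LC U" "L1_loc_bounded_l_bounds U E"
    and D: "countable D" "closure D = UNIV"
    and fs: "\<And>n. 1 \<le> n \<Longrightarrow> fs n \<in> E"
    and f: "f \<in> LC U"
    and conv_f: "limitin (subtopology (TD_topology U D) (LC U)) fs f sequentially"
    and zs: "\<And>n. 1 \<le> n \<Longrightarrow> zs n \<in> cspace \<kappa> U"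
    and z: "z \<in> cspace \<kappa> U"
    and conv_z: "(\<lambda>n. sup_norm1 (closure U) (\<lambda>x. zs n x - z x)) \<longlonglongrightarrow> 0"
    and T: "0 < T" "{0..T} \<subseteq> solution_interval \<kappa> U S f z"
  shows "(\<forall>\<^sub>F n in sequentially. {0..T} \<subseteq> solution_interval \<kappa> U S (fs n) (zs n)) \<and>
    (\<lambda>n. SUP t\<in>{0..T}. sup_norm1 (closure U)
       (\<lambda>x. max_solution \<kappa> U S (fs n) (zs n) t x - max_solution \<kappa> U S f z t x)) \<longlonglongrightarrow> 0"
proof -
  interpret diffusion_problem \<kappa> U S
    using domain semigroup by unfold_locales (auto simp: diffusion_semigroup_def)
  let ?N = "real CARD('n)"
  have dir: "\<kappa> = 0 \<longrightarrow> (\<forall>t. \<forall>x\<in>frontier U. f t x 0 = 0)" using dirichlet by auto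
  have dir_n: "\<kappa> = 0 \<longrightarrow> (\<forall>t. \<forall>x\<in>frontier U. fs n t x 0 = 0)" if "1 \<le> n" for n
    using dirichlet fs [OF that] by auto
  have fs_LC: "fs n \<in> LC U" if "1 \<le> n" for n using fs [OF that] E(1) by blast
  obtain u where u: "mild_solution \<kappa> U S f z T u"
  proof -
    have "T \<in> solution_interval \<kappa> U S f z" using T by auto
    then obtain \<delta> u where "T \<le> \<delta>" "mild_solution \<kappa> U S f z \<delta> u"
      unfolding solution_interval_def by auto
    then show thesis using that mild_solution_restrict by blast
  qed
  then have pu: "path_in_X T u" by (simp add: mild_solution_path)
  obtain R0 where R0: "\<And>t. t \<in> {0..T} \<Longrightarrow> nrm (u t) \<le> R0" using path_in_X_bounded [OF pu] by blast
  define R where "R = max 0 R0"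
  have R: "nrm (u t) \<le> R" if "t \<in> {0..T}" for t using R0 [OF that] by (simp add: R_def)
  have R_nonneg: "0 \<le> R" by (simp add: R_def)
  \<comment> \<open>The l-bounds of \<open>E\<close> come on balls of integer radius at least
    \<open>1\<close>, so the radius required by the truncation is rounded up.\<close>
  obtain j0 :: nat where j0: "?N * (R + 1) \<le> real j0" using real_arch_simple by blast
  define j where "j = max 1 j0"
  have j: "1 \<le> j" "?N * (R + 1) \<le> real j" using j0 by (auto simp: j_def)
  let ?K = "{y :: real^'n. norm1 y \<le> real j}"
  obtain l where l: "is_l_bound U f ?K l" using LC_l_bound [OF f compact_norm1_ball] by blast
  define Lf where "Lf = (\<integral>s. l s \<partial>lebesgue_on {0..T})"
  have Lf: "0 \<le> Lf"
    using l unfolding Lf_def by (intro Bochner_Integration.integral_nonneg) (simp add: is_l_bound_def)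
  obtain \<L> where \<L>: "\<forall>l\<in>\<L>. \<exists>f\<in>E. is_l_bound U f ?K l" "\<forall>f\<in>E. \<exists>l\<in>\<L>. is_l_bound U f ?K l"
      "\<forall>r>0. bdd_above ((\<lambda>l. LINT t:{-r..r}|lebesgue. l t) ` \<L>)"
    using E(2) [unfolded L1_loc_bounded_l_bounds_def, THEN spec, THEN mp, OF j(1)] by (elim exE conjE)
  obtain C0 where C0: "\<And>l. l \<in> \<L> \<Longrightarrow> (LINT t:{-T..T}|lebesgue. l t) \<le> C0"
    using \<L>(3) T(1) by (force simp: bdd_above_def)
  define C where "C = max 0 C0"
  \<comment> \<open>The uniform bound is over a symmetric interval; as l-bounds are nonnegative, it
    also controls their integrals over \<open>{0..T}\<close>.\<close>
  have ex_l: "\<exists>l'. is_l_bound U (fs n) ?K l' \<and> (\<integral>s. l' s \<partial>lebesgue_on {0..T}) \<le> C" if n: "1 \<le> n" for n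
  proof -
    obtain l' where l': "l' \<in> \<L>" "is_l_bound U (fs n) ?K l'" using \<L>(2) fs [OF n] by blast
    have "(\<integral>s. l' s \<partial>lebesgue_on {0..T}) \<le> (\<integral>s. l' s \<partial>lebesgue_on {-T..T})"
      using l'(2) T(1)
      by (intro integral_mono_lebesgue_on_AE AE_I2)
         (auto simp: is_l_bound_def L1_loc_def set_integrable_lebesgue_on)
    also have "\<dots> \<le> C"
      using C0 [OF l'(1)] by (simp add: set_integrable_lebesgue_on C_def)
    finally show ?thesis using l'(2) by blast
  qed
  \<comment> \<open>The sequences are indexed from \<open>1\<close>; carrying
    \<open>1 \<le> n\<close> along keeps the assumptions on \<open>fs n\<close> and
    \<open>zs n\<close> available.\<close>
  have core: "\<forall>\<^sub>F n in sequentially. 1 \<le> n \<and> (\<exists>v. mild_solution \<kappa> U S (fs n) (zs n) T v \<and>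
      (\<forall>t\<in>{0..T}. nrm (\<lambda>x. u t x - v t x) \<le> \<eta>))" if \<eta>: "0 < \<eta>" "\<eta> \<le> 1" for \<eta>
  proof -
    \<comment> \<open>\<open>Q\<close> is the amplification in the stability bound. The budget
      \<open>d\<close> carries the divisor \<open>3\<close> since three errors share
      \<open>\<eta>\<close>: initial values, seminorms on the net, and the cost of moving to the
      net.\<close>
    define Q where "Q = 2 * ?N * exp (2 * ?N * C)"
    have Q: "0 < Q" by (simp add: Q_def)
    define d where "d = \<eta> / (3 * Q)"
    have d: "0 < d" using \<eta> Q by (simp add: d_def)
    \<comment> \<open>The mesh is fixed before the net and before \<open>n\<close>, which is
      possible because \<open>C\<close> bounds the integrals of the chosen l-bounds of all
      \<open>fs n\<close>. The summand \<open>1\<close> in the denominator prevents division by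
      zero.\<close>
    define e where "e = min 1 (d / (Lf + C + 1))"
    have LC1: "0 < Lf + C + 1" using Lf by (simp add: C_def)
    have e: "0 < e" "e \<le> 1" using d LC1 by (auto simp: e_def)
    have "e * (Lf + C + 1) \<le> d"
    proof -
      have "e \<le> d / (Lf + C + 1)" by (simp add: e_def)
      then show ?thesis using LC1 by (simp add: pos_le_divide_eq)
    qed
    then have eL: "e * (Lf + C) \<le> d" using e by (simp add: algebra_simps)
    obtain Y where Y: "finite Y" "Y \<subseteq> D" "\<And>y. y \<in> Y \<Longrightarrow> norm1 y \<le> R + 1"
      and net: "\<And>y. norm1 y \<le> R \<Longrightarrow> \<exists>y'\<in>Y. norm1 (y - y') < e"
      using dense_finite_net [OF D(2) e, of R] by metis
    let ?I = "\<lambda>n y. \<integral>s. \<bar>nrm (\<lambda>x. fs n s x y - f s x y)\<bar> \<partial>lebesgue_on {0..T}"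
    \<comment> \<open>Only now is the number of net points known, and \<open>d\<close> is shared
      among them; \<open>+ 1\<close> keeps the denominator positive without asking whether
      \<open>Y\<close> is empty.\<close>
    define p where "p = d / (real (card Y) + 1)"
    have p: "0 < p" using d by (simp add: p_def add_nonneg_pos)
    have "\<forall>\<^sub>F n in sequentially. \<forall>y\<in>Y. ?I n y < p"
      using TD_convergence [OF conv_f f _ p] Y by (intro eventually_ball_finite) auto
    moreover have "\<forall>\<^sub>F n in sequentially. nrm (\<lambda>x. zs n x - z x) < d"
      using conv_z d by (rule order_tendstoD)
    ultimately show ?thesis using eventually_ge_at_top [of "1::nat"]
    proof eventually_elim
      case (elim n)
      obtain l' where l': "is_l_bound U (fs n) ?K l'" "(\<integral>s. l' s \<partial>lebesgue_on {0..T}) \<le> C"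
        using ex_l [OF elim(3)] by blast
      have "(\<Sum>y\<in>Y. ?I n y) \<le> (\<Sum>y\<in>Y. p)" using elim(1) by (intro sum_mono) (auto intro: less_imp_le)
      also have "\<dots> \<le> (real (card Y) + 1) * p" using p by (simp add: algebra_simps)
      also have "\<dots> = d" by (simp add: p_def add_nonneg_eq_0_iff)
      finally have sum_le: "(\<Sum>y\<in>Y. ?I n y) \<le> d" .
      have el: "e * (Lf + (\<integral>s. l' s \<partial>lebesgue_on {0..T})) \<le> d"
        using mult_left_mono [OF l'(2), of e] e(1) eL unfolding distrib_left by linarith
      have zle: "nrm (\<lambda>x. z x - zs n x) \<le> d"
        using elim(2) nrm_minus_commute [of z "zs n"] by simp
      have I_nonneg: "0 \<le> ?I n y" for y
        by (rule Bochner_Integration.integral_nonneg) simp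
      have l'0: "0 \<le> (\<integral>s. l' s \<partial>lebesgue_on {0..T})"
        using l'(1) by (intro Bochner_Integration.integral_nonneg) (simp add: is_l_bound_def)
      have "2 * ?N * (nrm (\<lambda>x. z x - zs n x) +
          ((\<Sum>y\<in>Y. ?I n y) + e * (Lf + (\<integral>s. l' s \<partial>lebesgue_on {0..T})))) *
          exp (2 * ?N * (\<integral>s. l' s \<partial>lebesgue_on {0..T})) \<le> 2 * ?N * (3 * d) * exp (2 * ?N * C)"
      proof (intro mult_mono mult_nonneg_nonneg)
        show "nrm (\<lambda>x. z x - zs n x) + ((\<Sum>y\<in>Y. ?I n y) + e * (Lf + (\<integral>s. l' s \<partial>lebesgue_on {0..T}))) \<le> 3 * d"
          using sum_le el zle by simp
        show "0 \<le> nrm (\<lambda>x. z x - zs n x) + ((\<Sum>y\<in>Y. ?I n y) + e * (Lf + (\<integral>s. l' s \<partial>lebesgue_on {0..T})))"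
          using e Lf l'0 I_nonneg nrm_nonneg [OF cspace_diff [OF z zs [OF elim(3)]]]
          by (intro add_nonneg_nonneg sum_nonneg mult_nonneg_nonneg) auto
      qed (use d l'(2) in auto)
      also have "\<dots> = \<eta>" using Q by (simp add: d_def Q_def)
      finally have small: "2 * ?N * (nrm (\<lambda>x. z x - zs n x) +
          ((\<Sum>y\<in>Y. ?I n y) + e * ((\<integral>s. l s \<partial>lebesgue_on {0..T}) + (\<integral>s. l' s \<partial>lebesgue_on {0..T})))) *
          exp (2 * ?N * (\<integral>s. l' s \<partial>lebesgue_on {0..T})) \<le> \<eta>"
        unfolding Lf_def .
      have "\<exists>v. mild_solution \<kappa> U S (fs n) (zs n) T v \<and> (\<forall>t\<in>{0..T}. nrm (\<lambda>x. u t x - v t x) \<le> \<eta>)"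
        by (rule perturbed_mild_solution [OF f dir fs_LC [OF elim(3)] dir_n [OF elim(3)] z zs [OF elim(3)] u
              R R_nonneg j(2) l l'(1) Y(1,3) net less_imp_le [OF e(1)] small \<eta>(2)])
      then show ?case using elim(3) by blast
    qed
  qed
  show ?thesis
  proof
    show "\<forall>\<^sub>F n in sequentially. {0..T} \<subseteq> solution_interval \<kappa> U S (fs n) (zs n)"
      using core [of 1]
    proof (rule eventually_mono)
      fix n assume "1 \<le> n \<and> (\<exists>v. mild_solution \<kappa> U S (fs n) (zs n) T v \<and>
        (\<forall>t\<in>{0..T}. nrm (\<lambda>x. u t x - v t x) \<le> 1))"
      then show "{0..T} \<subseteq> solution_interval \<kappa> U S (fs n) (zs n)"
        unfolding solution_interval_def using T(1) by blast
    qed auto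
    show "(\<lambda>n. SUP t\<in>{0..T}. nrm (\<lambda>x. max_solution \<kappa> U S (fs n) (zs n) t x - max_solution \<kappa> U S f z t x))
        \<longlonglongrightarrow> 0"
    proof (rule tendstoI)
      fix e :: real assume e: "0 < e"
      \<comment> \<open>\<open>core\<close> needs \<open>\<eta> \<le> 1\<close>; halving
        \<open>e\<close> leaves room for a strict inequality after the non-strict bound on the
        supremum.\<close>
      define \<eta> where "\<eta> = min 1 (e / 2)"
      have \<eta>: "0 < \<eta>" "\<eta> \<le> 1" "\<eta> < e" using e by (auto simp: \<eta>_def)
      show "\<forall>\<^sub>F n in sequentially. dist (SUP t\<in>{0..T}. nrm (\<lambda>x. max_solution \<kappa> U S (fs n) (zs n) t x -
          max_solution \<kappa> U S f z t x)) 0 < e"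
        using core [OF \<eta>(1,2)]
      proof eventually_elim
        case (elim n)
        then obtain v where n: "1 \<le> n" and v: "mild_solution \<kappa> U S (fs n) (zs n) T v"
          and le: "\<And>t. t \<in> {0..T} \<Longrightarrow> nrm (\<lambda>x. u t x - v t x) \<le> \<eta>" by blast
        let ?d = "\<lambda>t. nrm (\<lambda>x. max_solution \<kappa> U S (fs n) (zs n) t x - max_solution \<kappa> U S f z t x)"
        have pv: "path_in_X T v" using v by (simp add: mild_solution_path)
        have d_eq: "?d t = nrm (\<lambda>x. v t x - u t x)" if "t \<in> {0..T}" for t
          using max_solution_eq [OF f dir z T(1) u that]
            max_solution_eq [OF fs_LC [OF n] dir_n [OF n] zs [OF n] T(1) v that] by simp
        have d_le: "?d t \<le> \<eta>" if "t \<in> {0..T}" for t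
          using d_eq [OF that] le [OF that] nrm_minus_commute [of "v t" "u t"] by simp
        \<comment> \<open>The value at time \<open>0\<close> serves to show that the supremum is
          nonnegative.\<close>
        have d0: "0 \<le> ?d 0"
          using T(1) d_eq [of 0] path_in_X_in [OF pu, of 0] path_in_X_in [OF pv, of 0]
          by (simp add: nrm_nonneg cspace_diff)
        have "(SUP t\<in>{0..T}. ?d t) \<le> \<eta>"
          using T(1) by (intro cSUP_least d_le) auto
        moreover have "?d 0 \<le> (SUP t\<in>{0..T}. ?d t)"
          using T(1) by (intro cSUP_upper bdd_aboveI2 [where M = \<eta>] d_le) auto
        ultimately show ?case using d0 \<eta>(3) by simp
      qed
    qed
  qed
qed

end
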